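(* Let $\mathscr{A}$ be a proper abelian subcategory of a Krull--Schmidt triangulated category $\mathscr{C}$ and let $n \geqslant 3$ be an integer or $\infty$. (i) The relation $\preccurlyeq$ is a partial order on the $E_n$-interval $[\mathscr{A},\Sigma\mathscr{A}]_n$. (ii) If $\mathscr{A}$ satisfies condition $E_n$, then $\mathscr{A}$ and $\Sigma\mathscr{A}$ are the least and the greatest element of $[\mathscr{A},\Sigma\mathscr{A}]_n$ for $\preccurlyeq$.
   Context: $\Sigma$ denotes the suspension functor of a triangulated category $\mathscr{C}$. An additive subcategory is a full subcategory closed under isomorphisms, direct sums, and direct summands. A short triangle is a diagram $c' \xrightarrow{\gamma'} c \xrightarrow{\gamma} c''$ in $\mathscr{C}$ for which there is a triangle $c' \xrightarrow{\gamma'} c \xrightarrow{\gamma} c'' \xrightarrow{\gamma''} \Sigma c'$. For full subcategories $\mathscr{X},\mathscr{Y} \subseteq \mathscr{C}$, $\mathscr{X} * \mathscr{Y}$ is the full subcategory of those $e \in \mathscr{C}$ for which there is a short triangle $x \to e \to y$ with $x \in \mathscr{X}$, $y \in \mathscr{Y}$. Proper abelian subcategory: an additive subcategory $\mathscr{A}$ of $\mathscr{C}$ which is abelian and satisfies that $0 \to a' \xrightarrow{\alpha'} a \xrightarrow{\alpha} a'' \to 0$ is a short exact sequence in $\mathscr{A}$ if and only if $a',a,a''$ are in $\mathscr{A}$ and there is a triangle $a' \xrightarrow{\alpha'} a \xrightarrow{\alpha} a'' \to \Sigma a'$ in $\mathscr{C}$. Condition $E_n$ ($n \geqslant 1$ an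 integer or $\infty$): a full subcategory $\mathscr{X} \subseteq \mathscr{C}$ satisfies $E_n$ if $\mathscr{C}(\mathscr{X},\Sigma^i\mathscr{X}) = 0$ for all integers $i$ with $-n-1 < i < 0$. For a proper abelian subcategory $\mathscr{A}$, the $E_n$-interval $[\mathscr{A},\Sigma\mathscr{A}]_n$ is the class of proper abelian subcategories $\mathscr{B} \subseteq \mathscr{C}$ satisfying $E_n$ such that $\mathscr{A} \subseteq \mathscr{B} * \Sigma^{-1}\mathscr{B}$ and $\mathscr{B} \subseteq \Sigma\mathscr{A} * \mathscr{A}$. For $\mathscr{B}',\mathscr{B} \in [\mathscr{A},\Sigma\mathscr{A}]_n$, write $\mathscr{B}' \preccurlyeq \mathscr{B}$ if $\mathscr{B}' \subseteq \mathscr{B} * \Sigma^{-1}\mathscr{B}$ and $\mathscr{B} \subseteq \Sigma\mathscr{B}' * \mathscr{B}'$. *)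

theory Defs
  imports "HOL-Algebra.Ring" "HOL-Library.Extended_Nat"
begin

section \<open>Categories\<close>

record ('o, 'm) category =
  Obj :: "'o set"
  Arr :: "'m set"
  Src :: "'m \<Rightarrow> 'o"
  Tgt :: "'m \<Rightarrow> 'o"
  Idn :: "'o \<Rightarrow> 'm"
  Cmp :: "'m \<Rightarrow> 'm \<Rightarrow> 'm" (infixl \<open>\<cdot>\<index>\<close> 70)

definition Hom :: "('o, 'm, 'x) category_scheme \<Rightarrow> 'o \<Rightarrow> 'o \<Rightarrow> 'm set"
  where "Hom C a b = {f \<in> Arr C. Src C f = a \<and> Tgt C f = b}"

locale category =
  fixes C :: "('o, 'm, 'x) category_scheme" (structure)
  assumes Src_in_Obj: "f \<in> Arr C \<Longrightarrow> Src C f \<in> Obj C"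
    and Tgt_in_Obj: "f \<in> Arr C \<Longrightarrow> Tgt C f \<in> Obj C"
    and Idn_in_Hom: "a \<in> Obj C \<Longrightarrow> Idn C a \<in> Hom C a a"
    and Cmp_in_Hom: "\<lbrakk>f \<in> Hom C a b; g \<in> Hom C b c\<rbrakk> \<Longrightarrow> g \<cdot> f \<in> Hom C a c"
    and Cmp_Idn_right: "f \<in> Hom C a b \<Longrightarrow> f \<cdot> Idn C a = f"
    and Cmp_Idn_left: "f \<in> Hom C a b \<Longrightarrow> Idn C b \<cdot> f = f"
    and Cmp_assoc: "\<lbrakk>f \<in> Hom C a b; g \<in> Hom C b c; h \<in> Hom C c d\<rbrakk>
      \<Longrightarrow> h \<cdot> (g \<cdot> f) = (h \<cdot> g) \<cdot> f"

definition is_iso_arr :: "('o, 'm, 'x) category_scheme \<Rightarrow> 'm \<Rightarrow> bool"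
  where "is_iso_arr C f \<longleftrightarrow> f \<in> Arr C \<and>
    (\<exists>g \<in> Hom C (Tgt C f) (Src C f).
      g \<cdot>\<^bsub>C\<^esub> f = Idn C (Src C f) \<and> f \<cdot>\<^bsub>C\<^esub> g = Idn C (Tgt C f))"

definition isomorphic :: "('o, 'm, 'x) category_scheme \<Rightarrow> 'o \<Rightarrow> 'o \<Rightarrow> bool"
  where "isomorphic C a b \<longleftrightarrow> (\<exists>f \<in> Hom C a b. is_iso_arr C f)"

definition is_mono :: "('o, 'm, 'x) category_scheme \<Rightarrow> 'm \<Rightarrow> bool"
  where "is_mono C f \<longleftrightarrow> f \<in> Arr C \<and>
    (\<forall>d. \<forall>g \<in> Hom C d (Src C f). \<forall>h \<in> Hom C d (Src C f). f \<cdot>\<^bsub>C\<^esub> g = f \<cdot>\<^bsub>C\<^esub> h \<longrightarrow> g = h)"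

definition is_epi :: "('o, 'm, 'x) category_scheme \<Rightarrow> 'm \<Rightarrow> bool"
  where "is_epi C f \<longleftrightarrow> f \<in> Arr C \<and>
    (\<forall>d. \<forall>g \<in> Hom C (Tgt C f) d. \<forall>h \<in> Hom C (Tgt C f) d. g \<cdot>\<^bsub>C\<^esub> f = h \<cdot>\<^bsub>C\<^esub> f \<longrightarrow> g = h)"

definition is_zero_obj :: "('o, 'm, 'x) category_scheme \<Rightarrow> 'o \<Rightarrow> bool"
  where "is_zero_obj C z \<longleftrightarrow> z \<in> Obj C \<and>
    (\<forall>a \<in> Obj C. (\<exists>!f. f \<in> Hom C z a) \<and> (\<exists>!f. f \<in> Hom C a z))"

text \<open>Full subcategories are represented by their sets of objects.\<close>

definition full_subcategory :: "('o, 'm, 'x) category_scheme \<Rightarrow> 'o set \<Rightarrow> ('o, 'm, 'x) category_scheme"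
  where "full_subcategory C X =
    C\<lparr>Obj := X, Arr := {f \<in> Arr C. Src C f \<in> X \<and> Tgt C f \<in> X}\<rparr>"


section \<open>Additive and abelian categories\<close>

record ('o, 'm) preadditive = "('o, 'm) category" +
  Add :: "'m \<Rightarrow> 'm \<Rightarrow> 'm" (infixl \<open>\<boxplus>\<index>\<close> 65)
  Zer :: "'o \<Rightarrow> 'o \<Rightarrow> 'm"

definition hom_group :: "('o, 'm, 'x) preadditive_scheme \<Rightarrow> 'o \<Rightarrow> 'o \<Rightarrow> 'm monoid"
  where "hom_group C a b = \<lparr>carrier = Hom C a b, mult = Add C, one = Zer C a b\<rparr>"

definition Neg :: "('o, 'm, 'x) preadditive_scheme \<Rightarrow> 'm \<Rightarrow> 'm"
  where "Neg C f = inv\<^bsub>hom_group C (Src C f) (Tgt C f)\<^esub> f"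

definition is_biproduct ::
  "('o, 'm, 'x) preadditive_scheme \<Rightarrow> 'o \<Rightarrow> 'o \<Rightarrow> 'o \<Rightarrow> 'm \<Rightarrow> 'm \<Rightarrow> 'm \<Rightarrow> 'm \<Rightarrow> bool"
  where "is_biproduct C a b c i j p q \<longleftrightarrow>
    a \<in> Obj C \<and> b \<in> Obj C \<and> c \<in> Obj C \<and>
    i \<in> Hom C a c \<and> j \<in> Hom C b c \<and> p \<in> Hom C c a \<and> q \<in> Hom C c b \<and>
    p \<cdot>\<^bsub>C\<^esub> i = Idn C a \<and> q \<cdot>\<^bsub>C\<^esub> j = Idn C b \<and>
    p \<cdot>\<^bsub>C\<^esub> j = Zer C b a \<and> q \<cdot>\<^bsub>C\<^esub> i = Zer C a b \<and>
    (i \<cdot>\<^bsub>C\<^esub> p) \<boxplus>\<^bsub>C\<^esub> (j \<cdot>\<^bsub>C\<^esub> q) = Idn C c"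

text \<open>\<^term>\<open>direct_sum C a b c\<close> says that \<^term>\<open>c\<close> is a direct sum of \<^term>\<open>a\<close> and \<^term>\<open>b\<close>.\<close>

definition direct_sum :: "('o, 'm, 'x) preadditive_scheme \<Rightarrow> 'o \<Rightarrow> 'o \<Rightarrow> 'o \<Rightarrow> bool"
  where "direct_sum C a b c \<longleftrightarrow> (\<exists>i j p q. is_biproduct C a b c i j p q)"

primrec finite_direct_sum :: "('o, 'm, 'x) preadditive_scheme \<Rightarrow> 'o list \<Rightarrow> 'o \<Rightarrow> bool"
  where
    "finite_direct_sum C [] c \<longleftrightarrow> is_zero_obj C c"
  | "finite_direct_sum C (x # xs) c \<longleftrightarrow>
      (\<exists>d. finite_direct_sum C xs d \<and> direct_sum C x d c)"

locale additive_category = category C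
  for C :: "('o, 'm, 'x) preadditive_scheme" (structure) +
  assumes hom_group_comm_group: "\<lbrakk>a \<in> Obj C; b \<in> Obj C\<rbrakk> \<Longrightarrow> comm_group (hom_group C a b)"
    and Cmp_Add_right: "\<lbrakk>f \<in> Hom C a b; f' \<in> Hom C a b; g \<in> Hom C b c\<rbrakk>
      \<Longrightarrow> g \<cdot> (f \<boxplus> f') = (g \<cdot> f) \<boxplus> (g \<cdot> f')"
    and Cmp_Add_left: "\<lbrakk>f \<in> Hom C a b; g \<in> Hom C b c; g' \<in> Hom C b c\<rbrakk>
      \<Longrightarrow> (g \<boxplus> g') \<cdot> f = (g \<cdot> f) \<boxplus> (g' \<cdot> f)"
    and ex_zero_obj: "\<exists>z. is_zero_obj C z"
    and ex_direct_sum: "\<lbrakk>a \<in> Obj C; b \<in> Obj C\<rbrakk> \<Longrightarrow> \<exists>c. direct_sum C a b c"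

definition is_kernel :: "('o, 'm, 'x) preadditive_scheme \<Rightarrow> 'm \<Rightarrow> 'm \<Rightarrow> bool"
  where "is_kernel C k f \<longleftrightarrow> k \<in> Arr C \<and> f \<in> Arr C \<and> Tgt C k = Src C f \<and>
    f \<cdot>\<^bsub>C\<^esub> k = Zer C (Src C k) (Tgt C f) \<and>
    (\<forall>d. \<forall>t \<in> Hom C d (Src C f). f \<cdot>\<^bsub>C\<^esub> t = Zer C d (Tgt C f) \<longrightarrow>
      (\<exists>!s. s \<in> Hom C d (Src C k) \<and> k \<cdot>\<^bsub>C\<^esub> s = t))"

definition is_cokernel :: "('o, 'm, 'x) preadditive_scheme \<Rightarrow> 'm \<Rightarrow> 'm \<Rightarrow> bool"
  where "is_cokernel C q f \<longleftrightarrow> q \<in> Arr C \<and> f \<in> Arr C \<and> Src C q = Tgt C f \<and>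
    q \<cdot>\<^bsub>C\<^esub> f = Zer C (Src C f) (Tgt C q) \<and>
    (\<forall>d. \<forall>t \<in> Hom C (Tgt C f) d. t \<cdot>\<^bsub>C\<^esub> f = Zer C (Src C f) d \<longrightarrow>
      (\<exists>!s. s \<in> Hom C (Tgt C q) d \<and> s \<cdot>\<^bsub>C\<^esub> q = t))"

locale abelian_category = additive_category C
  for C :: "('o, 'm, 'x) preadditive_scheme" (structure) +
  assumes ex_kernel: "f \<in> Arr C \<Longrightarrow> \<exists>k. is_kernel C k f"
    and ex_cokernel: "f \<in> Arr C \<Longrightarrow> \<exists>q. is_cokernel C q f"
    and mono_is_kernel: "is_mono C f \<Longrightarrow> \<exists>g. is_kernel C f g"
    and epi_is_cokernel: "is_epi C f \<Longrightarrow> \<exists>g. is_cokernel C f g"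

text \<open>\<^term>\<open>short_exact C f g\<close> says that \<open>0 \<rightarrow> a' \<rightarrow> a \<rightarrow> a'' \<rightarrow> 0\<close> with maps \<^term>\<open>f\<close> and
  \<^term>\<open>g\<close> is a short exact sequence.\<close>

definition short_exact :: "('o, 'm, 'x) preadditive_scheme \<Rightarrow> 'm \<Rightarrow> 'm \<Rightarrow> bool"
  where "short_exact C f g \<longleftrightarrow> is_kernel C f g \<and> is_cokernel C g f"

text \<open>Closure under direct sums includes the empty one, i.e. zero objects.\<close>

definition additive_subcategory :: "('o, 'm, 'x) preadditive_scheme \<Rightarrow> 'o set \<Rightarrow> bool"
  where "additive_subcategory C X \<longleftrightarrow> X \<subseteq> Obj C \<and>
    (\<forall>a \<in> X. \<forall>b. isomorphic C a b \<longrightarrow> b \<in> X) \<and>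
    (\<forall>z. is_zero_obj C z \<longrightarrow> z \<in> X) \<and>
    (\<forall>a \<in> X. \<forall>b \<in> X. \<forall>c. direct_sum C a b c \<longrightarrow> c \<in> X) \<and>
    (\<forall>c \<in> X. \<forall>a b. direct_sum C a b c \<longrightarrow> a \<in> X \<and> b \<in> X)"


section \<open>Krull--Schmidt categories\<close>

definition end_ring :: "('o, 'm, 'x) preadditive_scheme \<Rightarrow> 'o \<Rightarrow> 'm ring"
  where "end_ring C a =
    \<lparr>carrier = Hom C a a, mult = Cmp C, one = Idn C a, zero = Zer C a a, add = Add C\<rparr>"

text \<open>Local rings, not necessarily commutative: the non-units of a non-zero ring are closed
  under addition.\<close>

definition is_local_ring :: "('a, 'x) ring_scheme \<Rightarrow> bool"
  where "is_local_ring R \<longleftrightarrow> ring R \<and> \<one>\<^bsub>R\<^esub> \<noteq> \<zero>\<^bsub>R\<^esub> \<and>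
    (\<forall>x \<in> carrier R. \<forall>y \<in> carrier R.
      x \<notin> Units R \<and> y \<notin> Units R \<longrightarrow> x \<oplus>\<^bsub>R\<^esub> y \<notin> Units R)"

locale krull_schmidt_category = additive_category C
  for C :: "('o, 'm, 'x) preadditive_scheme" (structure) +
  assumes ex_local_decomposition: "c \<in> Obj C \<Longrightarrow>
    \<exists>xs. finite_direct_sum C xs c \<and> (\<forall>x \<in> set xs. is_local_ring (end_ring C x))"


section \<open>Triangulated categories\<close>

text \<open>\<^term>\<open>Sus\<close> and \<^term>\<open>SusA\<close> are the suspension functor on objects and on morphisms, and
  \<^term>\<open>Tri\<close> is the class of distinguished triangles, each given by its three consecutive
  morphisms.\<close>

record ('o, 'm) triangulated = "('o, 'm) preadditive" +
  Sus :: "'o \<Rightarrow> 'o"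
  SusA :: "'m \<Rightarrow> 'm"
  Tri :: "('m \<times> 'm \<times> 'm) set"

definition triangle_shape :: "('o, 'm, 'x) triangulated_scheme \<Rightarrow> 'm \<Rightarrow> 'm \<Rightarrow> 'm \<Rightarrow> bool"
  where "triangle_shape C f g h \<longleftrightarrow> f \<in> Arr C \<and> g \<in> Arr C \<and> h \<in> Arr C \<and>
    Tgt C f = Src C g \<and> Tgt C g = Src C h \<and> Tgt C h = Sus C (Src C f)"

definition triangle_map :: "('o, 'm, 'x) triangulated_scheme \<Rightarrow>
    'm \<times> 'm \<times> 'm \<Rightarrow> 'm \<times> 'm \<times> 'm \<Rightarrow> 'm \<Rightarrow> 'm \<Rightarrow> 'm \<Rightarrow> bool"
  where "triangle_map C = (\<lambda>(f, g, h) (f', g', h') u v w.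
    u \<in> Hom C (Src C f) (Src C f') \<and>
    v \<in> Hom C (Src C g) (Src C g') \<and>
    w \<in> Hom C (Src C h) (Src C h') \<and>
    v \<cdot>\<^bsub>C\<^esub> f = f' \<cdot>\<^bsub>C\<^esub> u \<and> w \<cdot>\<^bsub>C\<^esub> g = g' \<cdot>\<^bsub>C\<^esub> v \<and> SusA C u \<cdot>\<^bsub>C\<^esub> h = h' \<cdot>\<^bsub>C\<^esub> w)"

text \<open>The suspension functor is only required to be an additive autoequivalence (fully faithful
  and essentially surjective), not an automorphism.\<close>

locale triangulated_category = additive_category C
  for C :: "('o, 'm, 'x) triangulated_scheme" (structure) +
  assumes Sus_in_Obj: "a \<in> Obj C \<Longrightarrow> Sus C a \<in> Obj C"
    and SusA_in_Hom: "f \<in> Hom C a b \<Longrightarrow> SusA C f \<in> Hom C (Sus C a) (Sus C b)"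
    and SusA_Idn: "a \<in> Obj C \<Longrightarrow> SusA C (Idn C a) = Idn C (Sus C a)"
    and SusA_Cmp: "\<lbrakk>f \<in> Hom C a b; g \<in> Hom C b c\<rbrakk>
      \<Longrightarrow> SusA C (g \<cdot> f) = SusA C g \<cdot> SusA C f"
    and SusA_Add: "\<lbrakk>f \<in> Hom C a b; g \<in> Hom C a b\<rbrakk>
      \<Longrightarrow> SusA C (f \<boxplus> g) = SusA C f \<boxplus> SusA C g"
    and SusA_fully_faithful: "\<lbrakk>a \<in> Obj C; b \<in> Obj C\<rbrakk>
      \<Longrightarrow> bij_betw (SusA C) (Hom C a b) (Hom C (Sus C a) (Sus C b))"
    and Sus_ess_surj: "b \<in> Obj C \<Longrightarrow> \<exists>a \<in> Obj C. isomorphic C (Sus C a) b"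
    and Tri_shape: "(f, g, h) \<in> Tri C \<Longrightarrow> triangle_shape C f g h"
    and Tri_iso: "\<lbrakk>(f, g, h) \<in> Tri C; triangle_shape C f' g' h';
        triangle_map C (f, g, h) (f', g', h') u v w;
        is_iso_arr C u; is_iso_arr C v; is_iso_arr C w\<rbrakk>
      \<Longrightarrow> (f', g', h') \<in> Tri C"
    and Tri_Idn: "\<lbrakk>a \<in> Obj C; is_zero_obj C z\<rbrakk>
      \<Longrightarrow> (Idn C a, Zer C a z, Zer C z (Sus C a)) \<in> Tri C"
    and Tri_extend: "f \<in> Arr C \<Longrightarrow> \<exists>g h. (f, g, h) \<in> Tri C"
    and Tri_rotate: "triangle_shape C f g h
      \<Longrightarrow> (f, g, h) \<in> Tri C \<longleftrightarrow> (g, h, Neg C (SusA C f)) \<in> Tri C"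
    and Tri_fill: "\<lbrakk>(f, g, h) \<in> Tri C; (f', g', h') \<in> Tri C;
        u \<in> Hom C (Src C f) (Src C f'); v \<in> Hom C (Src C g) (Src C g');
        v \<cdot> f = f' \<cdot> u\<rbrakk>
      \<Longrightarrow> \<exists>w. triangle_map C (f, g, h) (f', g', h') u v w"
    and Tri_octahedral: "\<lbrakk>(f, f', f'') \<in> Tri C; (g, g', g'') \<in> Tri C;
        Tgt C f = Src C g; (g \<cdot> f, h', h'') \<in> Tri C\<rbrakk>
      \<Longrightarrow> \<exists>u v. u \<in> Hom C (Tgt C f') (Tgt C h') \<and> v \<in> Hom C (Tgt C h') (Tgt C g') \<and>
            u \<cdot> f' = h' \<cdot> g \<and> h'' \<cdot> u = f'' \<and>
            v \<cdot> h' = g' \<and> g'' \<cdot> v = SusA C f \<cdot> h'' \<and>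
            (u, v, SusA C f' \<cdot> g'') \<in> Tri C"

text \<open>A desuspension on objects; it is determined up to isomorphism, since the suspension is an
  equivalence.\<close>

definition Desus :: "('o, 'm, 'x) triangulated_scheme \<Rightarrow> 'o \<Rightarrow> 'o"
  where "Desus C c = (SOME a. a \<in> Obj C \<and> isomorphic C (Sus C a) c)"

definition Sus_pow :: "('o, 'm, 'x) triangulated_scheme \<Rightarrow> int \<Rightarrow> 'o \<Rightarrow> 'o"
  where "Sus_pow C i c =
    (if 0 \<le> i then (Sus C ^^ nat i) c else (Desus C ^^ nat (- i)) c)"

text \<open>The full subcategory \<open>\<Sigma>\<^sup>i X\<close>, closed under isomorphism.\<close>

definition Sus_subcat :: "('o, 'm, 'x) triangulated_scheme \<Rightarrow> int \<Rightarrow> 'o set \<Rightarrow> 'o set"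
  where "Sus_subcat C i X = {c \<in> Obj C. \<exists>x \<in> X. isomorphic C (Sus_pow C i x) c}"

definition short_triangle :: "('o, 'm, 'x) triangulated_scheme \<Rightarrow> 'm \<Rightarrow> 'm \<Rightarrow> bool"
  where "short_triangle C f g \<longleftrightarrow> (\<exists>h. (f, g, h) \<in> Tri C)"

definition star :: "('o, 'm, 'x) triangulated_scheme \<Rightarrow> 'o set \<Rightarrow> 'o set \<Rightarrow> 'o set"
  where "star C X Y = {e \<in> Obj C. \<exists>x \<in> X. \<exists>y \<in> Y. \<exists>f \<in> Hom C x e. \<exists>g \<in> Hom C e y.
    short_triangle C f g}"


section \<open>Proper abelian subcategories and intervals\<close>

definition proper_abelian :: "('o, 'm, 'x) triangulated_scheme \<Rightarrow> 'o set \<Rightarrow> bool"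
  where "proper_abelian C A \<longleftrightarrow> additive_subcategory C A \<and>
    abelian_category (full_subcategory C A) \<and>
    (\<forall>f g. short_exact (full_subcategory C A) f g \<longleftrightarrow>
      (\<exists>a' \<in> A. \<exists>a \<in> A. \<exists>a'' \<in> A. f \<in> Hom C a' a \<and> g \<in> Hom C a a'' \<and>
        short_triangle C f g))"

text \<open>For \<open>i < 0\<close>, the bound \<open>- n - 1 < i\<close> reads \<open>- i < n + 1\<close>; it is vacuous for \<open>n = \<infinity>\<close>.\<close>

definition cond_E :: "('o, 'm, 'x) triangulated_scheme \<Rightarrow> enat \<Rightarrow> 'o set \<Rightarrow> bool"
  where "cond_E C n X \<longleftrightarrow>
    (\<forall>i::int. i < 0 \<and> enat (nat (- i)) < n + 1 \<longrightarrow>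
      (\<forall>x \<in> X. \<forall>y \<in> X. Hom C x (Sus_pow C i y) = {Zer C x (Sus_pow C i y)}))"

definition E_interval :: "('o, 'm, 'x) triangulated_scheme \<Rightarrow> enat \<Rightarrow> 'o set \<Rightarrow> 'o set set"
  where "E_interval C n A = {B. proper_abelian C B \<and> cond_E C n B \<and>
    A \<subseteq> star C B (Sus_subcat C (-1) B) \<and> B \<subseteq> star C (Sus_subcat C 1 A) A}"

definition interval_le :: "('o, 'm, 'x) triangulated_scheme \<Rightarrow> 'o set \<Rightarrow> 'o set \<Rightarrow> bool"
  where "interval_le C B' B \<longleftrightarrow>
    B' \<subseteq> star C B (Sus_subcat C (-1) B) \<and> B \<subseteq> star C (Sus_subcat C 1 B') B'"

definition E_interval_order :: "('o, 'm, 'x) triangulated_scheme \<Rightarrow> enat \<Rightarrow> 'o set \<Rightarrow> 'o set gorder"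
  where "E_interval_order C n A = \<lparr>carrier = E_interval C n A, eq = (=), le = interval_le C\<rparr>"

end

theory Submission
  imports Defs
begin

text \<open>For \<open>B\<close> in the interval, the cone of a map of \<open>B\<close> lies in \<open>\<Sigma> B * B\<close>, because \<open>B\<close> is abelian and
  its short exact sequences are triangles. Together with the octahedral axiom and \<open>E\<^sub>3\<close> this shows
  that every object of \<open>B\<close> is an extension of an object of \<open>A \<inter> B\<close> by one of \<open>\<Sigma> A \<inter> B\<close>. For
  transitivity along \<open>X\<close>, \<open>Y\<close>, \<open>Z\<close> this is applied to the pairs \<open>(A, X)\<close> and \<open>(Y, \<Sigma> X)\<close>, which
  presents an object of \<open>X\<close> in \<open>Z * Z * \<Sigma>\<^sup>-\<^sup>1 Z\<close> and in \<open>Z * \<Sigma>\<^sup>-\<^sup>1 Z * \<Sigma>\<^sup>-\<^sup>1 Z\<close>; the vanishing of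
  negative extensions identifies the two truncations, and so the object lies in \<open>Z * \<Sigma>\<^sup>-\<^sup>1 Z\<close>. The
  other half of the relation is the same statement for \<open>Y\<close>, \<open>Z\<close>, \<open>\<Sigma> A\<close>, \<open>\<Sigma> X\<close>, since
  \<open>Z \<subseteq> \<Sigma> X * X\<close> says that \<open>Z \<subseteq> \<Sigma> X * \<Sigma>\<^sup>-\<^sup>1 (\<Sigma> X)\<close>. Antisymmetry holds because an object in both
  \<open>Y * \<Sigma>\<^sup>-\<^sup>1 Y\<close> and \<open>\<Sigma> Y * Y\<close> is a direct summand of an object of \<open>Y\<close>.\<close>

section \<open>Additive categories\<close>

text \<open>The subcategories need not be closed under extensions, so in the comparison arguments
  membership is obtained by exhibiting an object as a retract of a member. In a triangulated
  category a retract is a direct summand, and retractions come from triangles with a vanishing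
  arrow; this is why vanishing Homs drive everything. The bound 3 counts degrees: an object s of
  \<open>A\<close> is known only as a member of \<open>B * \<Sigma>\<^sup>-\<^sup>1 B\<close>, and
  the object y to be killed only through \<Sigma> y in \<open>B\<close>, so Hom from \<Sigma>^2 s to
  y is tested as Hom from \<Sigma>^3 s to \<Sigma> y, which uses degrees 3 and 2. Transitivity and
  the greatest element both need \<Sigma> of a proper abelian subcategory to be proper abelian
  again. Since \<Sigma> is only an equivalence, this structure is transported along a chosen
  desuspension functor, with the signs of rotated triangles under control.\<close>

lemma HomD:
  assumes "f \<in> Hom C a b"
  shows "f \<in> Arr C" "Src C f = a" "Tgt C f = b"
  using assms by (auto simp: Hom_def)

lemma HomI: "f \<in> Arr C \<Longrightarrow> f \<in> Hom C (Src C f) (Tgt C f)"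
  by (simp add: Hom_def)

text \<open>The inverse is carried along explicitly so that it can be composed with, and so that
  reversing an isomorphism is just swapping two arguments.\<close>

definition inverse_arrs :: "('o, 'm, 'x) category_scheme \<Rightarrow> 'o \<Rightarrow> 'o \<Rightarrow> 'm \<Rightarrow> 'm \<Rightarrow> bool"
  where "inverse_arrs C a b u u' \<longleftrightarrow> u \<in> Hom C a b \<and> u' \<in> Hom C b a \<and>
    u' \<cdot>\<^bsub>C\<^esub> u = Idn C a \<and> u \<cdot>\<^bsub>C\<^esub> u' = Idn C b"

lemma inverse_arrs_sym: "inverse_arrs C a b u u' \<Longrightarrow> inverse_arrs C b a u' u"
  by (auto simp: inverse_arrs_def)

lemma isomorphic_iff: "isomorphic C a b \<longleftrightarrow> (\<exists>u u'. inverse_arrs C a b u u')"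
  by (auto simp: isomorphic_def is_iso_arr_def inverse_arrs_def Hom_def)

lemma inverse_arrs_iso: "inverse_arrs C a b u u' \<Longrightarrow> is_iso_arr C u"
  by (auto simp: is_iso_arr_def inverse_arrs_def Hom_def)

lemma isomorphic_sym: "isomorphic C a b \<Longrightarrow> isomorphic C b a"
  by (meson isomorphic_iff inverse_arrs_sym)

context category
begin

lemma Hom_Obj:
  assumes "f \<in> Hom C a b"
  shows "a \<in> Obj C" "b \<in> Obj C"
  using assms Src_in_Obj Tgt_in_Obj by (auto simp: Hom_def)

lemma inverse_arrs_Idn: "a \<in> Obj C \<Longrightarrow> inverse_arrs C a a (Idn C a) (Idn C a)"
  by (simp add: inverse_arrs_def Idn_in_Hom Cmp_Idn_left[OF Idn_in_Hom])

lemma isomorphic_refl: "a \<in> Obj C \<Longrightarrow> isomorphic C a a"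
  using inverse_arrs_Idn isomorphic_iff by metis

lemma Cmp_left_inverse:
  "inverse_arrs C b c u u' \<Longrightarrow> f \<in> Hom C a b \<Longrightarrow> u' \<cdot> (u \<cdot> f) = f"
  by (simp add: inverse_arrs_def Cmp_assoc[of f a b u c u' b] Cmp_Idn_left)

lemma Cmp_right_inverse:
  "inverse_arrs C a b u u' \<Longrightarrow> f \<in> Hom C a c \<Longrightarrow> (f \<cdot> u') \<cdot> u = f"
  by (simp add: inverse_arrs_def Cmp_assoc[of u a b u' a f c, symmetric] Cmp_Idn_right)

lemma inverse_arrs_Cmp:
  assumes u: "inverse_arrs C a b u u'" and v: "inverse_arrs C b c v v'"
  shows "inverse_arrs C a c (v \<cdot> u) (u' \<cdot> v')"
proof -
  have h: "u \<in> Hom C a b" "u' \<in> Hom C b a" "v \<in> Hom C b c" "v' \<in> Hom C c b"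
    using assms by (auto simp: inverse_arrs_def)
  have vu: "v \<cdot> u \<in> Hom C a c" and uv: "u' \<cdot> v' \<in> Hom C c a"
    using h Cmp_in_Hom by blast+
  have "(u' \<cdot> v') \<cdot> (v \<cdot> u) = u' \<cdot> u"
    using Cmp_assoc[OF vu h(4,2)] Cmp_left_inverse[OF v h(1)] by simp
  moreover have "(v \<cdot> u) \<cdot> (u' \<cdot> v') = v \<cdot> v'"
    using Cmp_assoc[OF uv h(1,3)] Cmp_left_inverse[OF inverse_arrs_sym[OF u] h(4)] by simp
  ultimately show ?thesis using u v vu uv unfolding inverse_arrs_def by simp
qed

lemma isomorphic_trans: "isomorphic C a b \<Longrightarrow> isomorphic C b c \<Longrightarrow> isomorphic C a c"
  using inverse_arrs_Cmp isomorphic_iff by metis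

lemma isomorphic_Obj:
  assumes "isomorphic C a b" shows "a \<in> Obj C" "b \<in> Obj C"
  using assms Hom_Obj by (auto simp: isomorphic_def)

end

context additive_category
begin

section \<open>Arithmetic of arrows in the Hom groups\<close>

lemma Zer_in_Hom: assumes "a \<in> Obj C" "b \<in> Obj C" shows "Zer C a b \<in> Hom C a b"
proof -
  interpret comm_group "hom_group C a b" using assms by (rule hom_group_comm_group)
  show ?thesis using one_closed by (simp add: hom_group_def)
qed

lemma hom_group_Hom: "f \<in> Hom C a b \<Longrightarrow> comm_group (hom_group C a b)"
  using hom_group_comm_group Hom_Obj by blast

lemma Add_in_Hom:
  assumes "f \<in> Hom C a b" "g \<in> Hom C a b" shows "f \<boxplus> g \<in> Hom C a b"
proof -
  interpret comm_group "hom_group C a b" using assms(1) by (rule hom_group_Hom)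
  show ?thesis using m_closed assms by (simp add: hom_group_def)
qed

lemma Add_comm:
  assumes "f \<in> Hom C a b" "g \<in> Hom C a b"
  shows "f \<boxplus> g = g \<boxplus> f"
proof -
  interpret comm_group "hom_group C a b" using assms(1) by (rule hom_group_Hom)
  show ?thesis using m_comm assms by (simp add: hom_group_def)
qed

lemma Add_Zer:
  assumes "f \<in> Hom C a b"
  shows "f \<boxplus> Zer C a b = f" "Zer C a b \<boxplus> f = f"
proof -
  interpret comm_group "hom_group C a b" using assms(1) by (rule hom_group_Hom)
  show "f \<boxplus> Zer C a b = f" "Zer C a b \<boxplus> f = f"
    using r_one l_one assms by (simp_all add: hom_group_def)
qed

lemma Neg_in_Hom:
  assumes "f \<in> Hom C a b" shows "Neg C f \<in> Hom C a b"
proof -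
  interpret comm_group "hom_group C a b" using assms(1) by (rule hom_group_Hom)
  show ?thesis using inv_closed[of f] assms HomD[OF assms] by (simp add: hom_group_def Neg_def)
qed

lemma Add_Neg:
  assumes "f \<in> Hom C a b" shows "f \<boxplus> Neg C f = Zer C a b"
proof -
  interpret comm_group "hom_group C a b" using assms(1) by (rule hom_group_Hom)
  show ?thesis using r_inv[of f] assms HomD[OF assms] by (simp add: hom_group_def Neg_def)
qed

lemma Add_cancel:
  assumes "f \<in> Hom C a b" "g \<in> Hom C a b" "h \<in> Hom C a b" "f \<boxplus> g = f \<boxplus> h"
  shows "g = h"
proof -
  interpret comm_group "hom_group C a b" using assms(1) by (rule hom_group_Hom)
  show ?thesis using Units_l_cancel[of f g h] Units_eq assms by (simp add: hom_group_def)
qed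

lemma Neg_unique:
  "f \<in> Hom C a b \<Longrightarrow> g \<in> Hom C a b \<Longrightarrow> f \<boxplus> g = Zer C a b \<Longrightarrow> g = Neg C f"
  using Add_cancel Neg_in_Hom Add_Neg by metis

lemma Neg_Neg: "f \<in> Hom C a b \<Longrightarrow> Neg C (Neg C f) = f"
  using Neg_unique Neg_in_Hom Add_Neg Add_comm by metis

lemma Neg_Zer: "a \<in> Obj C \<Longrightarrow> b \<in> Obj C \<Longrightarrow> Neg C (Zer C a b) = Zer C a b"
  using Neg_unique Zer_in_Hom Add_Zer(1) by metis

lemma eq_of_diff:
  "f \<in> Hom C a b \<Longrightarrow> g \<in> Hom C a b \<Longrightarrow> f \<boxplus> Neg C g = Zer C a b \<Longrightarrow> f = g"
  using Neg_unique Neg_in_Hom Neg_Neg Add_comm by metis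

lemma Cmp_Zer_right:
  assumes "g \<in> Hom C b c" "a \<in> Obj C"
  shows "g \<cdot> Zer C a b = Zer C a c"
proof -
  have z: "Zer C a b \<in> Hom C a b" using assms Zer_in_Hom Hom_Obj by blast
  then have gz: "g \<cdot> Zer C a b \<in> Hom C a c" using assms Cmp_in_Hom by blast
  have z2: "Zer C a c \<in> Hom C a c" using assms Zer_in_Hom Hom_Obj by blast
  have "(g \<cdot> Zer C a b) \<boxplus> (g \<cdot> Zer C a b) = g \<cdot> Zer C a b"
    using Cmp_Add_right[OF z z assms(1)] Add_Zer[OF z] by simp
  then show ?thesis using Add_cancel[OF gz gz z2] Add_Zer[OF gz] by simp
qed

lemma Cmp_Zer_left:
  assumes "f \<in> Hom C a b" "c \<in> Obj C"
  shows "Zer C b c \<cdot> f = Zer C a c"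
proof -
  have z: "Zer C b c \<in> Hom C b c" using assms Zer_in_Hom Hom_Obj by blast
  then have gz: "Zer C b c \<cdot> f \<in> Hom C a c" using assms Cmp_in_Hom by blast
  have z2: "Zer C a c \<in> Hom C a c" using assms Zer_in_Hom Hom_Obj by blast
  have "(Zer C b c \<cdot> f) \<boxplus> (Zer C b c \<cdot> f) = Zer C b c \<cdot> f"
    using Cmp_Add_left[OF assms(1) z z] Add_Zer[OF z] by simp
  then show ?thesis using Add_cancel[OF gz gz z2] Add_Zer[OF gz] by simp
qed

lemma Cmp_Neg_right:
  assumes "f \<in> Hom C a b" "g \<in> Hom C b c"
  shows "g \<cdot> Neg C f = Neg C (g \<cdot> f)"
proof (rule Neg_unique)
  show "g \<cdot> f \<in> Hom C a c" "g \<cdot> Neg C f \<in> Hom C a c"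
    using assms Cmp_in_Hom Neg_in_Hom by blast+
  show "(g \<cdot> f) \<boxplus> (g \<cdot> Neg C f) = Zer C a c"
    using Cmp_Add_right[OF assms(1) Neg_in_Hom[OF assms(1)] assms(2)] Add_Neg[OF assms(1)]
      Cmp_Zer_right assms Hom_Obj by metis
qed

lemma Cmp_Neg_left:
  assumes "f \<in> Hom C a b" "g \<in> Hom C b c"
  shows "Neg C g \<cdot> f = Neg C (g \<cdot> f)"
proof (rule Neg_unique)
  show "g \<cdot> f \<in> Hom C a c" "Neg C g \<cdot> f \<in> Hom C a c"
    using assms Cmp_in_Hom Neg_in_Hom by blast+
  show "(g \<cdot> f) \<boxplus> (Neg C g \<cdot> f) = Zer C a c"
    using Cmp_Add_left[OF assms(1) assms(2) Neg_in_Hom[OF assms(2)]] Add_Neg[OF assms(2)]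
      Cmp_Zer_left assms Hom_Obj by metis
qed

lemma Cmp_Neg_Neg:
  "f \<in> Hom C a b \<Longrightarrow> g \<in> Hom C b c \<Longrightarrow> Neg C g \<cdot> Neg C f = g \<cdot> f"
  using Cmp_Neg_left[OF Neg_in_Hom] Cmp_Neg_right Cmp_in_Hom Neg_Neg by metis

text \<open>If the identity is zero, every arrow into or out of z equals its composite with that
  identity and so is zero. The equation on the right is preserved by additive functors, which is how
  zero objects pass through \<Sigma> and its inverse.\<close>

lemma zero_obj_iff: "is_zero_obj C z \<longleftrightarrow> z \<in> Obj C \<and> Idn C z = Zer C z z"
proof
  assume "is_zero_obj C z"
  then show "z \<in> Obj C \<and> Idn C z = Zer C z z"
    unfolding is_zero_obj_def using Zer_in_Hom Idn_in_Hom by metis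
next
  assume h: "z \<in> Obj C \<and> Idn C z = Zer C z z"
  have 1: "f = Zer C z a" if "f \<in> Hom C z a" for f a
    using that h Cmp_Idn_right Cmp_Zer_right by metis
  have 2: "f = Zer C a z" if "f \<in> Hom C a z" for f a
    using that h Cmp_Idn_left Cmp_Zer_left by metis
  show "is_zero_obj C z"
    unfolding is_zero_obj_def using h 1 2 Zer_in_Hom by metis
qed

lemma Hom_zero_obj:
  assumes "is_zero_obj C z"
  shows "f \<in> Hom C z a \<Longrightarrow> f = Zer C z a" "f \<in> Hom C a z \<Longrightarrow> f = Zer C a z"
  using assms Hom_Obj Zer_in_Hom unfolding is_zero_obj_def by metis+

section \<open>Vanishing Hom sets and their behaviour under retracts\<close>

definition orth :: "'o \<Rightarrow> 'o \<Rightarrow> bool"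
  where "orth a b \<longleftrightarrow> (\<forall>f \<in> Hom C a b. f = Zer C a b)"

lemma orth_iff: "a \<in> Obj C \<Longrightarrow> b \<in> Obj C \<Longrightarrow> Hom C a b = {Zer C a b} \<longleftrightarrow> orth a b"
  using Zer_in_Hom unfolding orth_def by blast

lemma orth_retract_left:
  assumes "r \<in> Hom C b a" "s \<in> Hom C a b" "r \<cdot> s = Idn C a" "orth b c"
  shows "orth a c"
proof -
  have "f = Zer C a c" if f: "f \<in> Hom C a c" for f
  proof -
    have "f \<cdot> r = Zer C b c" using assms f Cmp_in_Hom unfolding orth_def by blast
    then have "(f \<cdot> r) \<cdot> s = Zer C a c" using Cmp_Zer_left assms f Hom_Obj by metis
    then show ?thesis using Cmp_assoc[OF assms(2,1) f] assms(3) Cmp_Idn_right[OF f] by simp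
  qed
  then show ?thesis unfolding orth_def by blast
qed

lemma orth_retract_right:
  assumes "r \<in> Hom C b a" "s \<in> Hom C a b" "r \<cdot> s = Idn C a" "orth c b"
  shows "orth c a"
proof -
  have "f = Zer C c a" if f: "f \<in> Hom C c a" for f
  proof -
    have "s \<cdot> f = Zer C c b" using assms f Cmp_in_Hom unfolding orth_def by blast
    then have "r \<cdot> (s \<cdot> f) = Zer C c a" using Cmp_Zer_right assms f Hom_Obj by metis
    then show ?thesis using Cmp_assoc[OF f assms(2,1)] assms(3) Cmp_Idn_left[OF f] by simp
  qed
  then show ?thesis unfolding orth_def by blast
qed

lemma orth_iso_left: "isomorphic C a a' \<Longrightarrow> orth a b \<Longrightarrow> orth a' b"
  using orth_retract_left unfolding isomorphic_iff inverse_arrs_def by metis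

lemma orth_iso_right: "isomorphic C b b' \<Longrightarrow> orth a b \<Longrightarrow> orth a b'"
  using orth_retract_right unfolding isomorphic_iff inverse_arrs_def by metis

end

section \<open>Triangulated categories\<close>

context triangulated_category
begin

lemma SusA_inj:
  "f \<in> Hom C a b \<Longrightarrow> g \<in> Hom C a b \<Longrightarrow> SusA C f = SusA C g \<Longrightarrow> f = g"
  by (rule inj_onD[OF bij_betw_imp_inj_on[OF SusA_fully_faithful[of a b]]]) (use Hom_Obj in auto)

lemma SusA_full:
  assumes "a \<in> Obj C" "b \<in> Obj C" "g \<in> Hom C (Sus C a) (Sus C b)"
  obtains f where "f \<in> Hom C a b" "SusA C f = g"
proof -
  have "g \<in> SusA C ` Hom C a b"
    using bij_betw_imp_surj_on[OF SusA_fully_faithful[OF assms(1,2)]] assms(3) by simp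
  then show ?thesis using that by auto
qed

lemma SusA_Zer:
  assumes "a \<in> Obj C" "b \<in> Obj C"
  shows "SusA C (Zer C a b) = Zer C (Sus C a) (Sus C b)"
proof -
  let ?z = "Zer C a b"
  have z: "?z \<in> Hom C a b" and s: "SusA C ?z \<in> Hom C (Sus C a) (Sus C b)"
    using assms Zer_in_Hom SusA_in_Hom by blast+
  have "SusA C ?z = SusA C ?z \<boxplus> SusA C ?z" using SusA_Add[OF z z] Add_Zer[OF z] by simp
  then show ?thesis using Add_cancel[OF s s] Add_Zer[OF s] Zer_in_Hom assms Sus_in_Obj by metis
qed

lemma SusA_Neg:
  assumes "f \<in> Hom C a b"
  shows "SusA C (Neg C f) = Neg C (SusA C f)"
proof (rule Neg_unique)
  show "SusA C f \<in> Hom C (Sus C a) (Sus C b)" "SusA C (Neg C f) \<in> Hom C (Sus C a) (Sus C b)"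
    using assms SusA_in_Hom Neg_in_Hom by blast+
  show "SusA C f \<boxplus> SusA C (Neg C f) = Zer C (Sus C a) (Sus C b)"
    using SusA_Add[OF assms Neg_in_Hom[OF assms]] Add_Neg[OF assms] SusA_Zer assms Hom_Obj by metis
qed

lemma inverse_arrs_SusA:
  assumes "inverse_arrs C a b u u'"
  shows "inverse_arrs C (Sus C a) (Sus C b) (SusA C u) (SusA C u')"
  using assms SusA_in_Hom SusA_Cmp SusA_Idn Hom_Obj unfolding inverse_arrs_def by metis

lemma isomorphic_Sus: "isomorphic C a b \<Longrightarrow> isomorphic C (Sus C a) (Sus C b)"
  using inverse_arrs_SusA isomorphic_iff by metis

lemma inverse_arrs_SusA_lift:
  assumes "u \<in> Hom C a b" "u' \<in> Hom C b a"
    "inverse_arrs C (Sus C a) (Sus C b) (SusA C u) (SusA C u')"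
  shows "inverse_arrs C a b u u'"
proof -
  have o: "a \<in> Obj C" "b \<in> Obj C" using assms Hom_Obj by blast+
  have "u' \<cdot> u = Idn C a"
    by (rule SusA_inj[of _ a a])
      (use assms o Cmp_in_Hom Idn_in_Hom SusA_Idn SusA_Cmp in \<open>auto simp: inverse_arrs_def\<close>)
  moreover have "u \<cdot> u' = Idn C b"
    by (rule SusA_inj[of _ b b])
      (use assms o Cmp_in_Hom Idn_in_Hom SusA_Idn SusA_Cmp in \<open>auto simp: inverse_arrs_def\<close>)
  ultimately show ?thesis using assms by (auto simp: inverse_arrs_def)
qed

lemma isomorphic_Sus_iff:
  assumes "a \<in> Obj C" "b \<in> Obj C"
  shows "isomorphic C (Sus C a) (Sus C b) \<longleftrightarrow> isomorphic C a b"
proof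
  assume "isomorphic C (Sus C a) (Sus C b)"
  then obtain v v' where v: "inverse_arrs C (Sus C a) (Sus C b) v v'" by (auto simp: isomorphic_iff)
  then obtain u u' where "u \<in> Hom C a b" "SusA C u = v" "u' \<in> Hom C b a" "SusA C u' = v'"
    using SusA_full assms unfolding inverse_arrs_def by metis
  then show "isomorphic C a b" using v inverse_arrs_SusA_lift isomorphic_iff by metis
qed (rule isomorphic_Sus)

lemma orth_Sus_iff:
  assumes "a \<in> Obj C" "b \<in> Obj C"
  shows "orth (Sus C a) (Sus C b) \<longleftrightarrow> orth a b"
proof
  assume "orth (Sus C a) (Sus C b)"
  then show "orth a b"
    unfolding orth_def using SusA_in_Hom SusA_Zer SusA_inj Zer_in_Hom assms by metis
next
  assume "orth a b"
  then show "orth (Sus C a) (Sus C b)"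
    unfolding orth_def using SusA_full SusA_Zer assms by metis
qed

lemma zero_obj_Sus: "is_zero_obj C z \<Longrightarrow> is_zero_obj C (Sus C z)"
  unfolding zero_obj_iff using Sus_in_Obj SusA_Idn SusA_Zer by metis

section \<open>Distinguished triangles with named vertices, and the exactness of Hom along
  them\<close>

definition tri_arrs :: "'o \<Rightarrow> 'o \<Rightarrow> 'o \<Rightarrow> 'm \<Rightarrow> 'm \<Rightarrow> 'm \<Rightarrow> bool"
  where "tri_arrs a b c f g h \<longleftrightarrow>
    f \<in> Hom C a b \<and> g \<in> Hom C b c \<and> h \<in> Hom C c (Sus C a) \<and> (f, g, h) \<in> Tri C"

lemma tri_arrsD:
  assumes "tri_arrs a b c f g h"
  shows "f \<in> Hom C a b" "g \<in> Hom C b c" "h \<in> Hom C c (Sus C a)" "(f, g, h) \<in> Tri C"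
    "a \<in> Obj C" "b \<in> Obj C" "c \<in> Obj C"
  using assms Hom_Obj unfolding tri_arrs_def by blast+

lemma tri_arrsI:
  assumes "(f, g, h) \<in> Tri C" "f \<in> Hom C a b" "g \<in> Hom C b' c"
  shows "tri_arrs a b c f g h"
  using Tri_shape[OF assms(1)] assms unfolding triangle_shape_def tri_arrs_def Hom_def by auto

lemma tri_arrs_rotate:
  assumes "tri_arrs a b c f g h"
  shows "tri_arrs b c (Sus C a) g h (Neg C (SusA C f))"
proof -
  have "(g, h, Neg C (SusA C f)) \<in> Tri C"
    using Tri_rotate[OF Tri_shape] tri_arrsD(4)[OF assms] by blast
  then show ?thesis using tri_arrsD[OF assms] tri_arrsI by blast
qed

lemma tri_arrs_unrotate:
  assumes "f \<in> Hom C a b" "g \<in> Hom C b c" "h \<in> Hom C c (Sus C a)"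
    "(g, h, Neg C (SusA C f)) \<in> Tri C"
  shows "tri_arrs a b c f g h"
proof -
  have "triangle_shape C f g h"
    using assms unfolding triangle_shape_def Hom_def by auto
  then show ?thesis using Tri_rotate assms unfolding tri_arrs_def by blast
qed

lemma tri_arrs_iso:
  assumes t: "tri_arrs a b c f g h"
    and u: "inverse_arrs C a a' u u'" and v: "inverse_arrs C b b' v v'"
    and w: "inverse_arrs C c c' w w'"
    and f': "f' \<in> Hom C a' b'" "v \<cdot> f = f' \<cdot> u"
    and g': "g' \<in> Hom C b' c'" "w \<cdot> g = g' \<cdot> v"
    and h': "h' \<in> Hom C c' (Sus C a')" "SusA C u \<cdot> h = h' \<cdot> w"
  shows "tri_arrs a' b' c' f' g' h'"
proof -
  have sh: "triangle_shape C f' g' h'"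
    using f' g' h' unfolding triangle_shape_def Hom_def by auto
  have "triangle_map C (f, g, h) (f', g', h') u v w"
    unfolding triangle_map_def
    using tri_arrsD[OF t] u v w f' g' h' by (auto simp: HomD inverse_arrs_def)
  then have "(f', g', h') \<in> Tri C"
    using Tri_iso[OF tri_arrsD(4)[OF t] sh]
      inverse_arrs_iso[OF u] inverse_arrs_iso[OF v] inverse_arrs_iso[OF w] by blast
  then show ?thesis using f' g' h' unfolding tri_arrs_def by blast
qed

lemma tri_arrs_extend:
  assumes "f \<in> Hom C a b"
  obtains c g h where "tri_arrs a b c f g h"
proof -
  obtain g h where t: "(f, g, h) \<in> Tri C" using Tri_extend HomD[OF assms] by blast
  then have "g \<in> Arr C" "Tgt C f = Src C g" using Tri_shape unfolding triangle_shape_def by blast+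
  then have "tri_arrs a b (Tgt C g) f g h" using tri_arrsI[OF t assms HomI] by blast
  then show ?thesis using that by blast
qed

lemma tri_arrs_fill:
  assumes t: "tri_arrs a b c f g h" and t': "tri_arrs a' b' c' f' g' h'"
    and "u \<in> Hom C a a'" "v \<in> Hom C b b'" "v \<cdot> f = f' \<cdot> u"
  obtains w where "w \<in> Hom C c c'" "w \<cdot> g = g' \<cdot> v" "SusA C u \<cdot> h = h' \<cdot> w"
proof -
  note d = tri_arrsD[OF t] and d' = tri_arrsD[OF t']
  have "\<exists>w. triangle_map C (f, g, h) (f', g', h') u v w"
    by (rule Tri_fill) (use assms d d' in \<open>auto simp: HomD\<close>)
  then show ?thesis using that d d' unfolding triangle_map_def by (auto simp: HomD)
qed

lemma tri_Idn: "a \<in> Obj C \<Longrightarrow> is_zero_obj C z \<Longrightarrow>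
  tri_arrs a a z (Idn C a) (Zer C a z) (Zer C z (Sus C a))"
  unfolding tri_arrs_def using Tri_Idn Idn_in_Hom Zer_in_Hom Sus_in_Obj zero_obj_iff by metis

text \<open>The axiom for identities, applied with the zero object \<Sigma> z, is the rotation of
  the wanted triangle; the sign is harmless on a zero arrow.\<close>

lemma tri_zero_Idn:
  assumes "a \<in> Obj C" "is_zero_obj C z"
  shows "tri_arrs z a a (Zer C z a) (Idn C a) (Zer C a (Sus C z))"
proof -
  have z: "z \<in> Obj C" using assms zero_obj_iff by blast
  show ?thesis
  proof (rule tri_arrs_unrotate)
    have "Neg C (SusA C (Zer C z a)) = Zer C (Sus C z) (Sus C a)"
      using SusA_Zer Neg_Zer z assms Sus_in_Obj by simp
    then show "(Idn C a, Zer C a (Sus C z), Neg C (SusA C (Zer C z a))) \<in> Tri C"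
      using tri_Idn[OF assms(1) zero_obj_Sus[OF assms(2)]] unfolding tri_arrs_def by simp
  qed (use assms z Zer_in_Hom Idn_in_Hom Sus_in_Obj in blast)+
qed

text \<open>Mapping the triangle of the identity of a into the given one makes the composite factor
  through a zero object.\<close>

lemma tri_comp_zero:
  assumes t: "tri_arrs a b c f g h"
  shows "g \<cdot> f = Zer C a c"
proof -
  note d = tri_arrsD[OF t]
  obtain z where z: "is_zero_obj C z" using ex_zero_obj by blast
  obtain w where w: "w \<in> Hom C z c" "w \<cdot> Zer C a z = g \<cdot> f"
    by (rule tri_arrs_fill[OF tri_Idn[OF d(5) z] t, of "Idn C a" f])
      (use d Idn_in_Hom in auto)
  then show ?thesis using Cmp_Zer_right d by metis
qed

text \<open>Exactness of Hom out of x. The triangle of the identity of x is mapped to the given one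
  after one rotation of both; the filler lives between suspensions and descends because \<Sigma> is
  fully faithful. The two signs from the rotations cancel.\<close>

lemma tri_lift:
  assumes t: "tri_arrs a b c f g h" and u: "u \<in> Hom C x b" "g \<cdot> u = Zer C x c"
  obtains v where "v \<in> Hom C x a" "f \<cdot> v = u"
proof -
  note d = tri_arrsD[OF t]
  obtain z where z: "is_zero_obj C z" using ex_zero_obj by blast
  have zo: "z \<in> Obj C" and x: "x \<in> Obj C" using z zero_obj_iff u Hom_Obj by blast+
  have e: "Zer C z c \<cdot> Zer C x z = g \<cdot> u" using u Cmp_Zer_left Zer_in_Hom zo x d by metis
  obtain w where w: "w \<in> Hom C (Sus C x) (Sus C a)"
    "SusA C u \<cdot> Neg C (SusA C (Idn C x)) = Neg C (SusA C f) \<cdot> w"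
    by (rule tri_arrs_fill[OF tri_arrs_rotate[OF tri_Idn[OF x z]] tri_arrs_rotate[OF t],
          of u "Zer C z c"])
      (use u e zo d Zer_in_Hom in auto)
  obtain v where v: "v \<in> Hom C x a" "SusA C v = w" using SusA_full x d(5) w by blast
  have "SusA C u \<in> Hom C (Sus C x) (Sus C b)" using SusA_in_Hom u by blast
  then have "Neg C (SusA C u) = Neg C (SusA C f \<cdot> w)"
    using w SusA_Idn x SusA_in_Hom[OF d(1)] Cmp_Neg_left Cmp_Neg_right Cmp_Idn_right Idn_in_Hom
      Sus_in_Obj by metis
  also have "SusA C f \<cdot> w = SusA C (f \<cdot> v)" using SusA_Cmp v d by metis
  finally have "SusA C u = SusA C (f \<cdot> v)"
    using Neg_Neg SusA_in_Hom u v d Cmp_in_Hom by metis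
  then have "u = f \<cdot> v" using SusA_inj u v d Cmp_in_Hom by metis
  then show ?thesis using that v by blast
qed

lemma tri_colift:
  assumes t: "tri_arrs a b c f g h" and u: "u \<in> Hom C b x" "u \<cdot> f = Zer C a x"
  obtains v where "v \<in> Hom C c x" "v \<cdot> g = u"
proof -
  note d = tri_arrsD[OF t]
  obtain z where z: "is_zero_obj C z" using ex_zero_obj by blast
  have zo: "z \<in> Obj C" and x: "x \<in> Obj C" using z zero_obj_iff u Hom_Obj by blast+
  have e: "u \<cdot> f = Zer C z x \<cdot> Zer C a z" using u Cmp_Zer_left Zer_in_Hom zo x d by metis
  obtain w where w: "w \<in> Hom C c x" "w \<cdot> g = Idn C x \<cdot> u"
    by (rule tri_arrs_fill[OF t tri_zero_Idn[OF x z], of "Zer C a z" u])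
      (use u e zo d Zer_in_Hom in auto)
  then show ?thesis using that Cmp_Idn_left u by metis
qed

lemma tri_section:
  assumes "tri_arrs a b c f g h" "g = Zer C b c"
  obtains s where "s \<in> Hom C b a" "f \<cdot> s = Idn C b"
proof -
  note d = tri_arrsD[OF assms(1)]
  have "g \<cdot> Idn C b = Zer C b c" using assms d Cmp_Idn_right by metis
  then show ?thesis using that tri_lift[OF assms(1) Idn_in_Hom] d by metis
qed

lemma tri_retraction:
  assumes "tri_arrs a b c f g h" "f = Zer C a b"
  obtains r where "r \<in> Hom C c b" "r \<cdot> g = Idn C b"
proof -
  note d = tri_arrsD[OF assms(1)]
  have "Idn C b \<cdot> f = Zer C a b" using assms d Cmp_Idn_left by metis
  then show ?thesis using that tri_colift[OF assms(1) Idn_in_Hom] d by metis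
qed

text \<open>The complement is the cone c of the split mono s. Since \<Sigma> s has a left inverse
  and kills h from the left, h vanishes, so g has a section v.\<close>

lemma retract_direct_sum:
  assumes r: "r \<in> Hom C a b" and s: "s \<in> Hom C b a" and rs: "r \<cdot> s = Idn C b"
  obtains c where "direct_sum C b c a"
proof -
  obtain c g h where t: "tri_arrs b a c s g h" using tri_arrs_extend[OF s] .
  note d = tri_arrsD[OF t] and t1 = tri_arrs_rotate[OF t]
  note t2 = tri_arrs_rotate[OF t1]
  have ob: "a \<in> Obj C" "b \<in> Obj C" "c \<in> Obj C" using d by auto
  have gs: "g \<cdot> s = Zer C b c" using tri_comp_zero[OF t] .
  have nh: "Neg C (SusA C s) \<cdot> h = Zer C c (Sus C a)" using tri_comp_zero[OF t2] .
  have Ss: "SusA C s \<in> Hom C (Sus C b) (Sus C a)" and Sr: "SusA C r \<in> Hom C (Sus C a) (Sus C b)"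
    using SusA_in_Hom r s by blast+
  have "SusA C s \<cdot> h = Zer C c (Sus C a)"
    using nh Cmp_Neg_left[OF d(3) Ss] Neg_Neg Neg_Zer Cmp_in_Hom[OF d(3) Ss] ob Sus_in_Obj by metis
  then have "SusA C r \<cdot> (SusA C s \<cdot> h) = Zer C c (Sus C b)"
    using Cmp_Zer_right Sr ob by metis
  moreover have "SusA C r \<cdot> (SusA C s \<cdot> h) = (SusA C r \<cdot> SusA C s) \<cdot> h"
    using Cmp_assoc[OF d(3) Ss Sr] .
  moreover have "SusA C r \<cdot> SusA C s = Idn C (Sus C b)"
    using SusA_Cmp[OF s r] rs SusA_Idn ob by metis
  ultimately have "h = Zer C c (Sus C b)" using Cmp_Idn_left d(3) by metis
  then obtain v where v: "v \<in> Hom C c a" "g \<cdot> v = Idn C c" using tri_section[OF t1] by metis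
  have srv: "s \<cdot> (r \<cdot> v) \<in> Hom C c a" and rv: "r \<cdot> v \<in> Hom C c b"
    using s r v Cmp_in_Hom by blast+
  \<comment> \<open>A section of g is determined only up to arrows through s; subtracting the part
    seen by r makes r vanish on it without changing its composite with g.\<close>
  define j where "j = v \<boxplus> Neg C (s \<cdot> (r \<cdot> v))"
  have j: "j \<in> Hom C c a" unfolding j_def using v srv Add_in_Hom Neg_in_Hom by blast
  have "g \<cdot> (s \<cdot> (r \<cdot> v)) = Zer C c c"
    using Cmp_assoc[OF rv s d(2)] gs Cmp_Zer_left[OF rv ob(3)] by simp
  then have gj: "g \<cdot> j = Idn C c"
    unfolding j_def Cmp_Add_right[OF v(1) Neg_in_Hom[OF srv] d(2)]
    using Cmp_Neg_right[OF srv d(2)] Neg_Zer v(2) Add_Zer(1)[OF Idn_in_Hom] ob by simp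
  have "r \<cdot> (s \<cdot> (r \<cdot> v)) = r \<cdot> v"
    using Cmp_assoc[OF rv s r] rs Cmp_Idn_left[OF rv] by simp
  then have rj: "r \<cdot> j = Zer C c b"
    unfolding j_def Cmp_Add_right[OF v(1) Neg_in_Hom[OF srv] r]
    using Cmp_Neg_right[OF srv r] Add_Neg[OF rv] by simp
  define e where "e = (s \<cdot> r) \<boxplus> (j \<cdot> g)"
  have sr: "s \<cdot> r \<in> Hom C a a" and jg: "j \<cdot> g \<in> Hom C a a" using s r j d Cmp_in_Hom by blast+
  have e: "e \<in> Hom C a a" unfolding e_def using sr jg Add_in_Hom by blast
  have ge: "g \<cdot> e = g"
  proof -
    have "g \<cdot> (s \<cdot> r) = Zer C a c" using Cmp_assoc[OF r s d(2)] gs Cmp_Zer_left[OF r ob(3)] by simp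
    moreover have "g \<cdot> (j \<cdot> g) = g" using Cmp_assoc[OF d(2) j d(2)] gj Cmp_Idn_left[OF d(2)] by simp
    ultimately show ?thesis unfolding e_def using Cmp_Add_right[OF sr jg d(2)] Add_Zer(2)[OF d(2)] by simp
  qed
  have re: "r \<cdot> e = r"
  proof -
    have "r \<cdot> (s \<cdot> r) = r" using Cmp_assoc[OF r s r] rs Cmp_Idn_left[OF r] by simp
    moreover have "r \<cdot> (j \<cdot> g) = Zer C a b"
      using Cmp_assoc[OF d(2) j r] rj Cmp_Zer_left[OF d(2) ob(2)] by simp
    ultimately show ?thesis unfolding e_def using Cmp_Add_right[OF sr jg r] Add_Zer(1)[OF r] by simp
  qed
  \<comment> \<open>To see that e is the identity: the difference k is killed by g, hence factors
    through s, and it is also killed by the left inverse r of s, hence is zero.\<close>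
  define k where "k = e \<boxplus> Neg C (Idn C a)"
  have I: "Idn C a \<in> Hom C a a" using ob Idn_in_Hom by blast
  have k: "k \<in> Hom C a a" unfolding k_def using e I Neg_in_Hom Add_in_Hom by blast
  have gk: "g \<cdot> k = Zer C a c"
    unfolding k_def Cmp_Add_right[OF e Neg_in_Hom[OF I] d(2)] Cmp_Neg_right[OF I d(2)] ge
    using Cmp_Idn_right[OF d(2)] Add_Neg[OF d(2)] by simp
  have rk: "r \<cdot> k = Zer C a b"
    unfolding k_def Cmp_Add_right[OF e Neg_in_Hom[OF I] r] Cmp_Neg_right[OF I r] re
    using Cmp_Idn_right[OF r] Add_Neg[OF r] by simp
  obtain l where l: "l \<in> Hom C a b" "s \<cdot> l = k" using tri_lift[OF t k gk] .
  have "l = r \<cdot> k" using Cmp_assoc[OF l(1) s r] rs Cmp_Idn_left[OF l(1)] l(2) by simp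
  then have "k = Zer C a a" using rk l(2) Cmp_Zer_right[OF s ob(1)] by simp
  then have "e = Idn C a" using eq_of_diff[OF e I] k_def by simp
  then have "is_biproduct C b c a s j r g"
    unfolding is_biproduct_def using ob s j r d rs gj rj gs e_def by simp
  then show ?thesis using that unfolding direct_sum_def by blast
qed

lemma retract_closed:
  assumes "additive_subcategory C X" "a \<in> X" "r \<in> Hom C a b" "s \<in> Hom C b a" "r \<cdot> s = Idn C b"
  shows "b \<in> X"
  using retract_direct_sum[OF assms(3-5)] assms(1,2) unfolding additive_subcategory_def by metis

text \<open>A cone d of g is replaced by some \<Sigma> a, using essential surjectivity; fullness
  then desuspends the connecting arrow to the first arrow of the triangle.\<close>

lemma tri_fiber:
  assumes g: "g \<in> Hom C b c"
  obtains a f h where "tri_arrs a b c f g h"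
proof -
  obtain d q r where t: "tri_arrs b c d g q r" using tri_arrs_extend[OF g] .
  note td = tri_arrsD[OF t]
  obtain a where a: "a \<in> Obj C" "isomorphic C (Sus C a) d" using Sus_ess_surj td by blast
  then obtain w w' where w: "inverse_arrs C d (Sus C a) w w'"
    using isomorphic_sym isomorphic_iff by metis
  have wh: "w \<in> Hom C d (Sus C a)" "w' \<in> Hom C (Sus C a) d" "w' \<cdot> w = Idn C d"
    using w by (auto simp: inverse_arrs_def)
  have rw: "r \<cdot> w' \<in> Hom C (Sus C a) (Sus C b)" "w \<cdot> q \<in> Hom C c (Sus C a)"
    using td wh Cmp_in_Hom by blast+
  have t2: "tri_arrs b c (Sus C a) g (w \<cdot> q) (r \<cdot> w')"
  proof (rule tri_arrs_iso[OF t inverse_arrs_Idn inverse_arrs_Idn w])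
    show "SusA C (Idn C b) \<cdot> r = (r \<cdot> w') \<cdot> w"
      using Cmp_right_inverse[OF w td(3)] SusA_Idn[OF td(5)] Cmp_Idn_left[OF td(3)] by simp
  qed (use td rw Cmp_Idn_left[OF g] Cmp_Idn_right[OF g] Cmp_Idn_right[OF rw(2)] in auto)
  obtain f0 where f0: "f0 \<in> Hom C a b" "SusA C f0 = r \<cdot> w'" using SusA_full a td(5) rw by blast
  \<comment> \<open>The sign compensates the one that the rotation axiom puts on the suspended first
    arrow.\<close>
  have "tri_arrs a b c (Neg C f0) g (w \<cdot> q)"
  proof (rule tri_arrs_unrotate)
    have "Neg C (SusA C (Neg C f0)) = r \<cdot> w'"
      using SusA_Neg f0 SusA_in_Hom Neg_Neg by metis
    then show "(g, w \<cdot> q, Neg C (SusA C (Neg C f0))) \<in> Tri C"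
      using tri_arrsD(4)[OF t2] by simp
  qed (use g f0 Neg_in_Hom rw in auto)
  then show ?thesis using that by blast
qed

section \<open>Triangles with the arrows forgotten\<close>

definition tri :: "'o \<Rightarrow> 'o \<Rightarrow> 'o \<Rightarrow> bool"
  where "tri a b c \<longleftrightarrow> (\<exists>f g h. tri_arrs a b c f g h)"

lemma tri_Obj: "tri a b c \<Longrightarrow> a \<in> Obj C" "tri a b c \<Longrightarrow> b \<in> Obj C" "tri a b c \<Longrightarrow> c \<in> Obj C"
  unfolding tri_def by (auto dest: tri_arrsD)

text \<open>Three rotations suspend all three vertices; the signs they introduce disappear with the
  arrows.\<close>

lemma tri_Sus: "tri a b c \<Longrightarrow> tri (Sus C a) (Sus C b) (Sus C c)"
  unfolding tri_def using tri_arrs_rotate by blast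

lemma tri_iso:
  assumes "tri a b c" "isomorphic C a a'" "isomorphic C b b'" "isomorphic C c c'"
  shows "tri a' b' c'"
proof -
  obtain f g h where t: "tri_arrs a b c f g h" using assms tri_def by blast
  obtain u u' v v' w w' where i: "inverse_arrs C a a' u u'" "inverse_arrs C b b' v v'"
    "inverse_arrs C c c' w w'" using assms isomorphic_iff by metis
  note d = tri_arrsD[OF t]
  have m: "u \<in> Hom C a a'" "u' \<in> Hom C a' a" "v \<in> Hom C b b'" "v' \<in> Hom C b' b"
    "w \<in> Hom C c c'" "w' \<in> Hom C c' c" using i by (auto simp: inverse_arrs_def)
  have c: "v \<cdot> f \<in> Hom C a b'" "w \<cdot> g \<in> Hom C b c'" "SusA C u \<cdot> h \<in> Hom C c (Sus C a')"
    using m d SusA_in_Hom Cmp_in_Hom by blast+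
  have "tri_arrs a' b' c' ((v \<cdot> f) \<cdot> u') ((w \<cdot> g) \<cdot> v') ((SusA C u \<cdot> h) \<cdot> w')"
    by (rule tri_arrs_iso[OF t i])
      (use Cmp_in_Hom[OF m(2) c(1)] Cmp_in_Hom[OF m(4) c(2)] Cmp_in_Hom[OF m(6) c(3)]
        Cmp_right_inverse[OF i(1) c(1)] Cmp_right_inverse[OF i(2) c(2)]
        Cmp_right_inverse[OF i(3) c(3)] in simp_all)
  then show ?thesis unfolding tri_def by blast
qed

lemma tri_orth_left:
  assumes "tri x e w" "orth x b" "orth w b"
  shows "orth e b"
proof -
  obtain f g h where t: "tri_arrs x e w f g h" using assms tri_def by blast
  note d = tri_arrsD[OF t]
  have "u = Zer C e b" if u: "u \<in> Hom C e b" for u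
  proof -
    have "u \<cdot> f = Zer C x b" using assms(2) u d Cmp_in_Hom unfolding orth_def by blast
    then obtain v where v: "v \<in> Hom C w b" "v \<cdot> g = u" using tri_colift[OF t u] by metis
    then show ?thesis using assms(3) Cmp_Zer_left d u Hom_Obj unfolding orth_def by metis
  qed
  then show ?thesis unfolding orth_def by blast
qed

lemma tri_orth_right:
  assumes "tri x e w" "orth b x" "orth b w"
  shows "orth b e"
proof -
  obtain f g h where t: "tri_arrs x e w f g h" using assms tri_def by blast
  note d = tri_arrsD[OF t]
  have "u = Zer C b e" if u: "u \<in> Hom C b e" for u
  proof -
    have "g \<cdot> u = Zer C b w" using assms(3) u d Cmp_in_Hom unfolding orth_def by blast
    then obtain v where v: "v \<in> Hom C b x" "f \<cdot> v = u" using tri_lift[OF t u] by metis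
    then show ?thesis using assms(2) Cmp_Zer_right d u Hom_Obj unfolding orth_def by metis
  qed
  then show ?thesis unfolding orth_def by blast
qed

text \<open>Only the triangle formed by the three cones of f, g and their composite is retained from
  the axiom.\<close>

lemma octahedron:
  assumes f: "tri_arrs a b c f f' f''" and g: "tri_arrs b d e g g' g''"
    and gf: "tri_arrs a d k (g \<cdot> f) h' h''"
  obtains u v w where "tri_arrs c k e u v w"
proof -
  note df = tri_arrsD[OF f] and dg = tri_arrsD[OF g] and dh = tri_arrsD[OF gf]
  obtain u v where "u \<in> Hom C (Tgt C f') (Tgt C h')" "v \<in> Hom C (Tgt C h') (Tgt C g')"
    "(u, v, SusA C f' \<cdot> g'') \<in> Tri C"
    using Tri_octahedral[OF df(4) dg(4) _ dh(4)] df dg by (auto simp: HomD)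
  then show ?thesis
    using that tri_arrsI[of u v "SusA C f' \<cdot> g''" c k k e] df dg dh by (simp add: HomD)
qed

end

section \<open>Abelian categories and proper abelian subcategories\<close>

lemma full_subcategory_simps [simp]:
  "Obj (full_subcategory C X) = X"
  "Src (full_subcategory C X) = Src C"
  "Tgt (full_subcategory C X) = Tgt C"
  "Idn (full_subcategory C X) = Idn C"
  "Cmp (full_subcategory C X) = Cmp C"
  by (simp_all add: full_subcategory_def)

lemma full_subcategory_preadditive_simps [simp]:
  "Add (full_subcategory C X) = Add C"
  "Zer (full_subcategory C X) = Zer C"
  by (simp_all add: full_subcategory_def)

lemma Hom_full_subcategory:
  "f \<in> Hom (full_subcategory C X) a b \<longleftrightarrow> f \<in> Hom C a b \<and> a \<in> X \<and> b \<in> X"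
  by (auto simp: Hom_def full_subcategory_def)

lemma is_kernel_iff:
  assumes "k \<in> Hom C c a" "f \<in> Hom C a b"
  shows "is_kernel C k f \<longleftrightarrow> f \<cdot>\<^bsub>C\<^esub> k = Zer C c b \<and>
    (\<forall>d. \<forall>t \<in> Hom C d a. f \<cdot>\<^bsub>C\<^esub> t = Zer C d b \<longrightarrow> (\<exists>!s. s \<in> Hom C d c \<and> k \<cdot>\<^bsub>C\<^esub> s = t))"
  using assms by (auto simp: is_kernel_def HomD)

lemma is_cokernel_iff:
  assumes "q \<in> Hom C b c" "f \<in> Hom C a b"
  shows "is_cokernel C q f \<longleftrightarrow> q \<cdot>\<^bsub>C\<^esub> f = Zer C a c \<and>
    (\<forall>d. \<forall>t \<in> Hom C b d. t \<cdot>\<^bsub>C\<^esub> f = Zer C a d \<longrightarrow> (\<exists>!s. s \<in> Hom C c d \<and> s \<cdot>\<^bsub>C\<^esub> q = t))"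
  using assms by (auto simp: is_cokernel_def HomD)

lemma is_kernel_Hom:
  assumes "is_kernel C k f" "f \<in> Hom C a b" shows "k \<in> Hom C (Src C k) a"
  using assms by (auto simp: is_kernel_def Hom_def)

lemma is_cokernel_Hom:
  assumes "is_cokernel C q f" "f \<in> Hom C a b" shows "q \<in> Hom C b (Tgt C q)"
  using assms by (auto simp: is_cokernel_def Hom_def)

lemma is_epi_iff:
  assumes "f \<in> Hom C a b"
  shows "is_epi C f \<longleftrightarrow>
    (\<forall>d. \<forall>g \<in> Hom C b d. \<forall>h \<in> Hom C b d. g \<cdot>\<^bsub>C\<^esub> f = h \<cdot>\<^bsub>C\<^esub> f \<longrightarrow> g = h)"
  using assms by (auto simp: is_epi_def HomD)

lemma is_mono_iff:
  assumes "f \<in> Hom C a b"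
  shows "is_mono C f \<longleftrightarrow>
    (\<forall>d. \<forall>g \<in> Hom C d a. \<forall>h \<in> Hom C d a. f \<cdot>\<^bsub>C\<^esub> g = f \<cdot>\<^bsub>C\<^esub> h \<longrightarrow> g = h)"
  using assms by (auto simp: is_mono_def HomD)

context additive_category
begin

section \<open>Kernels, cokernels and the image factorisation\<close>

lemma cokernel_is_epi:
  assumes q: "q \<in> Hom C b c" and f: "f \<in> Hom C a b" and "is_cokernel C q f"
  shows "is_epi C q"
proof -
  have qf: "q \<cdot> f = Zer C a c"
    and u: "\<And>d t. t \<in> Hom C b d \<Longrightarrow> t \<cdot> f = Zer C a d \<Longrightarrow> \<exists>!s. s \<in> Hom C c d \<and> s \<cdot> q = t"
    using assms(3) unfolding is_cokernel_iff[OF q f] by blast+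
  have "g = h" if g: "g \<in> Hom C c d" and h: "h \<in> Hom C c d" and e: "g \<cdot> q = h \<cdot> q" for g h d
  proof -
    have "(g \<cdot> q) \<cdot> f = Zer C a d"
      using Cmp_assoc[OF f q g] qf Cmp_Zer_right[OF g] Hom_Obj[OF f] by simp
    then show ?thesis using u[OF Cmp_in_Hom[OF q g]] g h e by metis
  qed
  then show ?thesis unfolding is_epi_iff[OF q] by blast
qed

lemma is_monoI:
  assumes m: "m \<in> Hom C a b"
    and z: "\<And>d t. t \<in> Hom C d a \<Longrightarrow> m \<cdot> t = Zer C d b \<Longrightarrow> t = Zer C d a"
  shows "is_mono C m"
proof -
  have "g = h" if g: "g \<in> Hom C d a" and h: "h \<in> Hom C d a" and e: "m \<cdot> g = m \<cdot> h" for g h d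
  proof (rule eq_of_diff[OF g h], rule z)
    show "g \<boxplus> Neg C h \<in> Hom C d a" using g h Add_in_Hom Neg_in_Hom by blast
    show "m \<cdot> (g \<boxplus> Neg C h) = Zer C d b"
      using Cmp_Add_right[OF g Neg_in_Hom[OF h] m] Cmp_Neg_right[OF h m] e
        Add_Neg[OF Cmp_in_Hom[OF h m]] by simp
  qed
  then show ?thesis unfolding is_mono_iff[OF m] by blast
qed

text \<open>As f kills k it factors through e, so whatever e kills is killed by f and factors
  uniquely through k.\<close>

lemma kernel_of_cokernel:
  assumes k: "k \<in> Hom C c a" and f: "f \<in> Hom C a b" and ker: "is_kernel C k f"
    and e: "e \<in> Hom C a i" and coker: "is_cokernel C e k"
  shows "is_kernel C k e"
proof -
  have fk: "f \<cdot> k = Zer C c b"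
    and ku: "\<And>d t. t \<in> Hom C d a \<Longrightarrow> f \<cdot> t = Zer C d b \<Longrightarrow> \<exists>!s. s \<in> Hom C d c \<and> k \<cdot> s = t"
    using ker unfolding is_kernel_iff[OF k f] by blast+
  have ek: "e \<cdot> k = Zer C c i"
    and eu: "\<And>d t. t \<in> Hom C a d \<Longrightarrow> t \<cdot> k = Zer C c d \<Longrightarrow> \<exists>!s. s \<in> Hom C i d \<and> s \<cdot> e = t"
    using coker unfolding is_cokernel_iff[OF e k] by blast+
  obtain m where m: "m \<in> Hom C i b" "m \<cdot> e = f" using eu[OF f fk] by blast
  have "f \<cdot> t = Zer C d b" if t: "t \<in> Hom C d a" and et: "e \<cdot> t = Zer C d i" for d t
    using Cmp_assoc[OF t e m(1)] m et Cmp_Zer_right[OF m(1)] Hom_Obj[OF t] by simp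
  then show ?thesis unfolding is_kernel_iff[OF k e] using ek ku by blast
qed

end

text \<open>The image is taken as the cokernel of the kernel. Both halves come out as short exact
  sequences, the form that a proper abelian subcategory turns into triangles. The point to prove is
  that the induced m is mono.\<close>

lemma (in abelian_category) epi_mono_factorisation:
  assumes f: "f \<in> Hom C a b"
  obtains c i d k e m q where "k \<in> Hom C c a" "e \<in> Hom C a i" "m \<in> Hom C i b" "q \<in> Hom C b d"
    "short_exact C k e" "short_exact C m q" "m \<cdot> e = f"
proof -
  obtain k where ker: "is_kernel C k f" using ex_kernel HomD[OF f] by blast
  define c where "c = Src C k"
  have k: "k \<in> Hom C c a" using is_kernel_Hom[OF ker f] c_def by simp
  obtain e where coker: "is_cokernel C e k" using ex_cokernel HomD[OF k] by blast
  define i where "i = Tgt C e"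
  have e: "e \<in> Hom C a i" using is_cokernel_Hom[OF coker k] i_def by simp
  have fk: "f \<cdot> k = Zer C c b"
    and ku: "\<And>d t. t \<in> Hom C d a \<Longrightarrow> f \<cdot> t = Zer C d b \<Longrightarrow> \<exists>!s. s \<in> Hom C d c \<and> k \<cdot> s = t"
    using ker unfolding is_kernel_iff[OF k f] by blast+
  have ek: "e \<cdot> k = Zer C c i"
    and eu: "\<And>d t. t \<in> Hom C a d \<Longrightarrow> t \<cdot> k = Zer C c d \<Longrightarrow> \<exists>!s. s \<in> Hom C i d \<and> s \<cdot> e = t"
    using coker unfolding is_cokernel_iff[OF e k] by blast+
  have e_epi: "is_epi C e" using cokernel_is_epi[OF e k coker] .
  have e_cancel: "g = h" if "g \<in> Hom C i d" "h \<in> Hom C i d" "g \<cdot> e = h \<cdot> e" for g h d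
    using e_epi that unfolding is_epi_iff[OF e] by blast
  obtain m where m: "m \<in> Hom C i b" "m \<cdot> e = f" using eu[OF f fk] by blast
  have "is_mono C m"
  proof (rule is_monoI[OF m(1)])
    fix d t assume t: "t \<in> Hom C d i" and mt: "m \<cdot> t = Zer C d b"
    \<comment> \<open>If m kills t then m factors through the cokernel p of t. It is enough to find
      a left inverse r of p, for then t = r p t = 0.\<close>
    obtain p where p_coker: "is_cokernel C p t" using ex_cokernel HomD[OF t] by blast
    define j where "j = Tgt C p"
    have p: "p \<in> Hom C i j" using is_cokernel_Hom[OF p_coker t] j_def by simp
    have pt: "p \<cdot> t = Zer C d j" using p_coker unfolding is_cokernel_iff[OF p t] by blast
    obtain m' where m': "m' \<in> Hom C j b" "m' \<cdot> p = m"
      using p_coker m(1) mt unfolding is_cokernel_iff[OF p t] by blast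
    have p_cancel: "g = h" if "g \<in> Hom C j x" "h \<in> Hom C j x" "g \<cdot> p = h \<cdot> p" for g h x
      using cokernel_is_epi[OF p t p_coker] that unfolding is_epi_iff[OF p] by blast
    have pe: "p \<cdot> e \<in> Hom C a j" using Cmp_in_Hom[OF e p] .
    have "is_epi C (p \<cdot> e)"
      unfolding is_epi_iff[OF pe]
    proof (intro allI ballI impI)
      fix x g h assume g: "g \<in> Hom C j x" and h: "h \<in> Hom C j x" and "g \<cdot> (p \<cdot> e) = h \<cdot> (p \<cdot> e)"
      then have "(g \<cdot> p) \<cdot> e = (h \<cdot> p) \<cdot> e" using Cmp_assoc[OF e p] by metis
      then have "g \<cdot> p = h \<cdot> p" using e_cancel Cmp_in_Hom[OF p] g h by metis
      then show "g = h" using p_cancel g h by blast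
    qed
    then obtain g where g_coker: "is_cokernel C (p \<cdot> e) g" using epi_is_cokernel by blast
    define y where "y = Src C g"
    have g: "g \<in> Hom C y a" using g_coker pe y_def by (auto simp: is_cokernel_def Hom_def)
    have peg: "(p \<cdot> e) \<cdot> g = Zer C y j" using g_coker unfolding is_cokernel_iff[OF pe g] by blast
    have y: "y \<in> Obj C" using Hom_Obj[OF g] by blast
    have "m' \<cdot> (p \<cdot> e) = f" using Cmp_assoc[OF e p m'(1)] m m' by simp
    \<comment> \<open>The epi p e is a cokernel of g. Since g is killed by f it factors through k
      and is killed by e, so e factors through p e; cancelling the epi e gives the left inverse of
      p.\<close>
    then have "f \<cdot> g = Zer C y b"
      using Cmp_assoc[OF g pe m'(1)] peg Cmp_Zer_right[OF m'(1) y] by simp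
    then obtain s where s: "s \<in> Hom C y c" "k \<cdot> s = g" using ku[OF g] by blast
    have "e \<cdot> g = Zer C y i"
      using Cmp_assoc[OF s(1) k e] s(2) ek Cmp_Zer_left[OF s(1)] Hom_Obj[OF e] by simp
    then obtain r where r: "r \<in> Hom C j i" "r \<cdot> (p \<cdot> e) = e"
      using g_coker e unfolding is_cokernel_iff[OF pe g] by blast
    have "(r \<cdot> p) \<cdot> e = Idn C i \<cdot> e"
      using Cmp_assoc[OF e p r(1)] r(2) Cmp_Idn_left[OF e] by simp
    then have "r \<cdot> p = Idn C i"
      using e_cancel Cmp_in_Hom[OF p r(1)] Idn_in_Hom Hom_Obj[OF e] by blast
    then show "t = Zer C d i"
      using Cmp_assoc[OF t p r(1)] pt Cmp_Zer_right[OF r(1)] Hom_Obj[OF t] Cmp_Idn_left[OF t] by simp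
  qed
  then obtain g where mker: "is_kernel C m g" using mono_is_kernel by blast
  have g: "g \<in> Hom C b (Tgt C g)" using mker m by (auto simp: is_kernel_def Hom_def)
  obtain q where qcok: "is_cokernel C q m" using ex_cokernel HomD[OF m(1)] by blast
  have q: "q \<in> Hom C b (Tgt C q)" using is_cokernel_Hom[OF qcok m(1)] .
  show ?thesis
    using that[OF k e m(1) q] m(2) kernel_of_cokernel[OF k f ker e coker] coker
      kernel_of_cokernel[OF m(1) g mker q qcok] qcok unfolding short_exact_def by blast
qed

context triangulated_category
begin

text \<open>This says that cones of maps in \<open>X\<close> lie in \<Sigma> \<open>X\<close> *
  \<open>X\<close>. For a proper abelian \<open>X\<close>, k and q can be taken to be the kernel and
  the cokernel of f.\<close>

definition has_cones :: "'o set \<Rightarrow> bool"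
  where "has_cones X \<longleftrightarrow> (\<forall>a \<in> X. \<forall>b \<in> X. \<forall>f \<in> Hom C a b.
    \<exists>c g h. tri_arrs a b c f g h \<and> (\<exists>k \<in> X. \<exists>q \<in> X. tri (Sus C k) c q))"

lemma proper_abelian_short_exact:
  assumes "proper_abelian C X"
  shows "short_exact (full_subcategory C X) f g \<longleftrightarrow>
    (\<exists>a' \<in> X. \<exists>a \<in> X. \<exists>a'' \<in> X. f \<in> Hom C a' a \<and> g \<in> Hom C a a'' \<and> short_triangle C f g)"
  using assms unfolding proper_abelian_def by (elim conjE) simp

text \<open>Factor f into an epi followed by a mono. The triangle of the first sequence makes the
  suspended kernel a cone of the epi, that of the second makes the cokernel a cone of the mono, and
  the octahedral axiom assembles a cone of f.\<close>

lemma proper_abelian_has_cones: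
  assumes "proper_abelian C X"
  shows "has_cones X"
proof -
  interpret X: abelian_category "full_subcategory C X"
    using assms unfolding proper_abelian_def by blast
  have se: "\<exists>h. tri_arrs a b c f g h"
    if "short_exact (full_subcategory C X) f g" "f \<in> Hom C a b" "g \<in> Hom C b c" for a b c f g
  proof -
    have "short_triangle C f g" using proper_abelian_short_exact[OF assms] that(1) by metis
    then show ?thesis unfolding short_triangle_def using tri_arrsI[OF _ that(2,3)] by blast
  qed
  show ?thesis
    unfolding has_cones_def
  proof (intro ballI)
    fix a b f assume a: "a \<in> X" and b: "b \<in> X" and f: "f \<in> Hom C a b"
    then have "f \<in> Hom (full_subcategory C X) a b" by (simp add: Hom_full_subcategory)
    then obtain c i d k e m q where 1: "k \<in> Hom (full_subcategory C X) c a"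
      "e \<in> Hom (full_subcategory C X) a i" "m \<in> Hom (full_subcategory C X) i b"
      "q \<in> Hom (full_subcategory C X) b d"
      "short_exact (full_subcategory C X) k e" "short_exact (full_subcategory C X) m q"
      "m \<cdot> e = f"
      by (rule X.epi_mono_factorisation) simp
    then have h: "k \<in> Hom C c a" "e \<in> Hom C a i" "m \<in> Hom C i b" "q \<in> Hom C b d" "c \<in> X" "d \<in> X"
      by (auto simp: Hom_full_subcategory)
    obtain h1 h2 where t: "tri_arrs c a i k e h1" "tri_arrs i b d m q h2"
      using se 1 h by metis
    obtain z g h where z: "tri_arrs a b z f g h" using tri_arrs_extend[OF f] .
    have "tri (Sus C c) z d"
      using octahedron[OF tri_arrs_rotate[OF t(1)] t(2)] z 1(7) unfolding tri_def by metis
    then show "\<exists>c g h. tri_arrs a b c f g h \<and> (\<exists>k \<in> X. \<exists>q \<in> X. tri (Sus C k) c q)"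
      using z h by blast
  qed
qed

section \<open>Comparing subcategories\<close>

text \<open>\<open>lower X Y\<close> and \<open>upper X Y\<close> are the two halves \<open>X \<subseteq> Y * \<Sigma>\<^sup>-\<^sup>1 Y\<close> and \<open>Y \<subseteq> \<Sigma> X * X\<close> of the
  relation defining the interval, stated without desuspensions.\<close>

definition lower :: "'o set \<Rightarrow> 'o set \<Rightarrow> bool"
  where "lower X Y \<longleftrightarrow> (\<forall>x \<in> X. \<exists>y \<in> Y. \<exists>z. Sus C z \<in> Y \<and> tri y x z)"

definition upper :: "'o set \<Rightarrow> 'o set \<Rightarrow> bool"
  where "upper X Y \<longleftrightarrow> (\<forall>y \<in> Y. \<exists>s \<in> X. \<exists>x \<in> X. tri (Sus C s) y x)"

text \<open>Condition E_3, with desuspension in the second argument of Hom traded for suspension in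
  the first.\<close>

definition neg_orth :: "'o set \<Rightarrow> bool"
  where "neg_orth X \<longleftrightarrow> (\<forall>x \<in> X. \<forall>y \<in> X. orth (Sus C x) y \<and>
    orth (Sus C (Sus C x)) y \<and> orth (Sus C (Sus C (Sus C x))) y)"

lemma neg_orthD:
  assumes "neg_orth X" "x \<in> X" "y \<in> X"
  shows "orth (Sus C x) y" "orth (Sus C (Sus C x)) y" "orth (Sus C (Sus C (Sus C x))) y"
  using assms unfolding neg_orth_def by blast+

lemma lowerE:
  assumes "lower X Y" "x \<in> X"
  obtains y z f g h where "y \<in> Y" "Sus C z \<in> Y" "tri y x z" "tri_arrs y x z f g h"
  using assms unfolding lower_def tri_def by metis

lemma upperE:
  assumes "upper X Y" "y \<in> Y"
  obtains s x f g h where "s \<in> X" "x \<in> X" "tri (Sus C s) y x" "tri_arrs (Sus C s) y x f g h"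
  using assms unfolding upper_def tri_def by metis

lemma orth_SusD: "orth (Sus C a) (Sus C b) \<Longrightarrow> a \<in> Obj C \<Longrightarrow> b \<in> Obj C \<Longrightarrow> orth a b"
  using orth_Sus_iff by blast

text \<open>The arrow out of b vanishes, so the identity of b lifts to a and b is a retract of
  a.\<close>

lemma tri_zero_second:
  assumes "tri_arrs a b c f g h" "orth b c" "additive_subcategory C X" "a \<in> X"
  shows "b \<in> X"
proof -
  note d = tri_arrsD[OF assms(1)]
  have "g = Zer C b c" using assms(2) d unfolding orth_def by blast
  then obtain s where "s \<in> Hom C b a" "f \<cdot> s = Idn C b" using tri_section assms(1) by metis
  then show ?thesis using retract_closed[OF assms(3,4)] d by blast
qed

text \<open>Factoring the map from \<open>b\<close> to its quotient \<open>a\<close> through \<open>B\<close> gives a map \<open>f\<close> in \<open>B\<close>. Its cone \<open>c\<close>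
  lies in \<open>\<Sigma> B * B\<close> and, by the octahedral axiom, in a triangle \<open>c \<rightarrow> \<Sigma>\<^sup>2 s \<rightarrow> y\<close> with \<open>\<Sigma> y\<close> in \<open>B\<close>.
  The vanishing of negative extensions then forces \<open>y = 0\<close>.\<close>

lemma torsion_decomposition:
  assumes B: "additive_subcategory C B" "has_cones B" "neg_orth B"
    and low: "lower A B" and up: "upper A B" and b: "b \<in> B"
  obtains s a where "s \<in> A" "a \<in> A" "Sus C s \<in> B" "a \<in> B" "tri (Sus C s) b a"
proof -
  note E = neg_orthD[OF B(3)]
  have BO: "B \<subseteq> Obj C" using B(1) unfolding additive_subcategory_def by blast
  obtain s a \<alpha> \<beta> \<gamma> where sa: "s \<in> A" "a \<in> A" "tri (Sus C s) b a" and t1: "tri_arrs (Sus C s) b a \<alpha> \<beta> \<gamma>"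
    using upperE[OF up b] .
  obtain b0 y g p \<delta> where y: "b0 \<in> B" "Sus C y \<in> B" and t2: "tri_arrs b0 a y g p \<delta>"
    using lowerE[OF low sa(2)] .
  note d1 = tri_arrsD[OF t1] and d2 = tri_arrsD[OF t2]
  \<comment> \<open>Negative orthogonality applies only to \<Sigma> y, which lies in
    \<open>B\<close>, so the claim is checked after one suspension; the same device recurs
    below.\<close>
  have "orth b y" using orth_SusD[OF E(1)[OF b y(2)]] d1 d2 by blast
  then have "p \<cdot> \<beta> = Zer C b y" using d1 d2 Cmp_in_Hom unfolding orth_def by blast
  then obtain f where f: "f \<in> Hom C b b0" "g \<cdot> f = \<beta>" using tri_lift[OF t2 d1(2)] by metis
  obtain c f' f'' k q where t3: "tri_arrs b b0 c f f' f''" and kq: "k \<in> B" "q \<in> B" "tri (Sus C k) c q"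
    using B(2) b y f unfolding has_cones_def by blast
  have "tri_arrs b a (Sus C (Sus C s)) (g \<cdot> f) \<gamma> (Neg C (SusA C \<alpha>))"
    using tri_arrs_rotate[OF t1] f by simp
  then obtain u v w where t4: "tri_arrs c (Sus C (Sus C s)) y u v w"
    using octahedron[OF t3 t2] by metis
  note d4 = tri_arrsD[OF t4]
  obtain s0 s1 where s0: "s0 \<in> B" "Sus C s1 \<in> B" "tri s0 s s1"
    using lowerE[OF low sa(1)] by metis
  have so: "s \<in> Obj C" using tri_Obj s0 by blast
  have S2: "tri (Sus C (Sus C s0)) (Sus C (Sus C s)) (Sus C (Sus C s1))"
    using tri_Sus s0(3) by blast
  \<comment> \<open>Here the third degree is consumed: s is built from s0 in \<open>B\<close> and s1
    with \<Sigma> s1 in \<open>B\<close>, so \<Sigma>^3 s is built from the third suspension of one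
    member and the second of another.\<close>
  have "orth (Sus C (Sus C (Sus C s))) (Sus C y)"
    using tri_orth_left[OF tri_Sus[OF S2]] E(3)[OF s0(1) y(2)] E(2)[OF s0(2) y(2)] by blast
  then have "orth (Sus C (Sus C s)) y" using orth_SusD so d2 Sus_in_Obj by blast
  then have v: "v = Zer C (Sus C (Sus C s)) y" using d4 unfolding orth_def by blast
  \<comment> \<open>With v = 0 the connecting arrow w embeds y as a retract of \<Sigma> c. But
    \<Sigma> c has no arrows to y, by the description of c through k and q, so the identity of y is
    zero.\<close>
  obtain r where r: "r \<in> Hom C (Sus C c) y" "r \<cdot> w = Idn C y"
    using tri_retraction[OF tri_arrs_rotate[OF t4] v] .
  have "orth (Sus C (Sus C c)) (Sus C y)"
    using tri_orth_left[OF tri_Sus[OF tri_Sus[OF kq(3)]]] E(3)[OF kq(1) y(2)] E(2)[OF kq(2) y(2)]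
    by blast
  then have "orth (Sus C c) y" using orth_SusD d4 d2 Sus_in_Obj by blast
  then have "r = Zer C (Sus C c) y" using r unfolding orth_def by blast
  then have "Idn C y = Zer C y y" using r Cmp_Zer_left[OF d4(3) d2(7)] by simp
  then have "orth a y" using Hom_zero_obj(2) zero_obj_iff d2 unfolding orth_def by blast
  then have aB: "a \<in> B" using tri_zero_second[OF t2 _ B(1) y(1)] by blast
  \<comment> \<open>The same vanishing of v splits u. The section has no component in q, so it
    factors through \<Sigma> k and makes \<Sigma>^2 s a retract of \<Sigma> k; desuspending,
    \<Sigma> s is a retract of the member k of \<open>B\<close>.\<close>
  obtain \<sigma> where \<sigma>: "\<sigma> \<in> Hom C (Sus C (Sus C s)) c" "u \<cdot> \<sigma> = Idn C (Sus C (Sus C s))"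
    using tri_section[OF t4 v] .
  obtain \<iota> \<pi> \<rho> where t5: "tri_arrs (Sus C k) c q \<iota> \<pi> \<rho>" using kq(3) unfolding tri_def by blast
  note d5 = tri_arrsD[OF t5]
  have "orth (Sus C (Sus C s)) q"
    using tri_orth_left[OF S2] E(2)[OF s0(1) kq(2)] E(1)[OF s0(2) kq(2)] by blast
  then have "\<pi> \<cdot> \<sigma> = Zer C (Sus C (Sus C s)) q" using \<sigma> d5 Cmp_in_Hom unfolding orth_def by blast
  then obtain \<tau> where \<tau>: "\<tau> \<in> Hom C (Sus C (Sus C s)) (Sus C k)" "\<iota> \<cdot> \<tau> = \<sigma>"
    using tri_lift[OF t5 \<sigma>(1)] by metis
  have ko: "k \<in> Obj C" and sso: "Sus C s \<in> Obj C" using kq BO so Sus_in_Obj by blast+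
  have ui: "u \<cdot> \<iota> \<in> Hom C (Sus C k) (Sus C (Sus C s))" using d4 d5 Cmp_in_Hom by blast
  obtain \<tau>0 where \<tau>0: "\<tau>0 \<in> Hom C (Sus C s) k" "SusA C \<tau>0 = \<tau>" using SusA_full[OF sso ko \<tau>(1)] .
  obtain r0 where r0: "r0 \<in> Hom C k (Sus C s)" "SusA C r0 = u \<cdot> \<iota>" using SusA_full[OF ko sso ui] .
  have "SusA C (r0 \<cdot> \<tau>0) = Idn C (Sus C (Sus C s))"
    using SusA_Cmp[OF \<tau>0(1) r0(1)] \<tau>0(2) r0(2) Cmp_assoc[OF \<tau>(1) d5(1) d4(1)] \<tau>(2) \<sigma>(2) by simp
  then have "r0 \<cdot> \<tau>0 = Idn C (Sus C s)"
    using SusA_inj[OF Cmp_in_Hom[OF \<tau>0(1) r0(1)] Idn_in_Hom[OF sso]] SusA_Idn[OF sso] by simp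
  then have "Sus C s \<in> B" using retract_closed[OF B(1) kq(1) r0(1) \<tau>0(1)] by blast
  then show ?thesis using that sa aB by blast
qed

text \<open>The ambiguity of a lift through f comes from the preceding term of the long exact
  sequence, Hom from \<Sigma> y to b. The difference of two lifts, once suspended, factors through
  that Hom.\<close>

lemma tri_lift_unique:
  assumes t: "tri_arrs e x b f g h" and o: "orth (Sus C y) b"
    and u: "u \<in> Hom C y e" and v: "v \<in> Hom C y e" and uv: "f \<cdot> u = f \<cdot> v"
  shows "u = v"
proof -
  note d = tri_arrsD[OF t]
  define k where "k = u \<boxplus> Neg C v"
  have k: "k \<in> Hom C y e" unfolding k_def using u v Add_in_Hom Neg_in_Hom by blast
  have yo: "y \<in> Obj C" using u Hom_Obj by blast
  have "f \<cdot> k = Zer C y x"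
    unfolding k_def Cmp_Add_right[OF u Neg_in_Hom[OF v] d(1)] Cmp_Neg_right[OF v d(1)] uv
    using Add_Neg[OF Cmp_in_Hom[OF v d(1)]] .
  then have "SusA C f \<cdot> SusA C k = Zer C (Sus C y) (Sus C x)"
    using SusA_Cmp[OF k d(1)] SusA_Zer[OF yo d(6)] by simp
  then have "Neg C (SusA C f) \<cdot> SusA C k = Zer C (Sus C y) (Sus C x)"
    using Cmp_Neg_left[OF SusA_in_Hom[OF k] SusA_in_Hom[OF d(1)]] Neg_Zer Sus_in_Obj yo d(6) by simp
  then obtain m where m: "m \<in> Hom C (Sus C y) b" "h \<cdot> m = SusA C k"
    using tri_lift[OF tri_arrs_rotate[OF tri_arrs_rotate[OF t]] SusA_in_Hom[OF k]] by metis
  have "m = Zer C (Sus C y) b" using m o unfolding orth_def by blast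
  then have "SusA C k = SusA C (Zer C y e)"
    using m Cmp_Zer_right[OF d(3)] Sus_in_Obj[OF yo] SusA_Zer[OF yo d(5)] by simp
  then have "k = Zer C y e" using SusA_inj[OF k Zer_in_Hom[OF yo d(5)]] by blast
  then show ?thesis using eq_of_diff[OF u v] k_def by simp
qed

end

context triangulated_category
begin

text \<open>Going through \<open>W\<close> gives \<open>e \<rightarrow> x \<rightarrow> b\<close> with \<open>e\<close> in \<open>Z * Z\<close> and \<open>\<Sigma> b\<close> in \<open>Z\<close>; going through \<open>Y\<close>
  gives \<open>z\<^sub>0 \<rightarrow> x\<close> with \<open>z\<^sub>0\<close> in \<open>Z\<close>. The two maps to \<open>x\<close> factor through each other, so \<open>e\<close> is a
  direct summand of \<open>z\<^sub>0\<close>. Since \<open>Z\<close> need not be closed under extensions, both descriptions of \<open>x\<close>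
  are needed.\<close>

lemma lower_trans_general:
  assumes X: "proper_abelian C X" "neg_orth X"
    and SX: "additive_subcategory C SX" "has_cones SX" "neg_orth SX"
      "\<And>x. x \<in> X \<Longrightarrow> Sus C x \<in> SX" "\<And>v. v \<in> SX \<Longrightarrow> \<exists>x \<in> X. isomorphic C (Sus C x) v"
    and Z: "additive_subcategory C Z" "neg_orth Z"
    and WZ: "lower W Z" and YZ: "lower Y Z" and WX: "lower W X" "upper W X"
    and XY: "lower X Y" "upper X Y"
  shows "lower X Z"
  unfolding lower_def
proof
  fix x assume x: "x \<in> X"
  note E = neg_orthD[OF Z(2)]
  have XA: "additive_subcategory C X" using X(1) unfolding proper_abelian_def by blast
  have ZO: "z \<in> Obj C" if "z \<in> Z" for z using Z(1) that unfolding additive_subcategory_def by blast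
  \<comment> \<open>Objects of \<open>Y\<close> involve one desuspension of \<open>Z\<close>, which
    costs the top degree: E_3 for \<open>Z\<close> leaves degrees 1 and 2 here.\<close>
  have H: "orth (Sus C z) y" "orth (Sus C (Sus C z)) y" if z: "z \<in> Z" and y: "y \<in> Y" for z y
  proof -
    obtain y0 y1 where 1: "y0 \<in> Z" "Sus C y1 \<in> Z" "tri y0 y y1" using lowerE[OF YZ y] by metis
    have o: "Sus C z \<in> Obj C" "Sus C (Sus C z) \<in> Obj C" "y1 \<in> Obj C"
      using ZO z Sus_in_Obj tri_Obj 1(3) by blast+
    show "orth (Sus C z) y" "orth (Sus C (Sus C z)) y"
      using tri_orth_right[OF 1(3)] E[OF z 1(1)] orth_SusD[OF E(2)[OF z 1(2)]]
        orth_SusD[OF E(3)[OF z 1(2)]] o by blast+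
  qed
  \<comment> \<open>With the desuspension on the left it is the bottom degree that is lost, leaving
    degrees 2 and 3.\<close>
  have G: "orth (Sus C (Sus C w)) z" "orth (Sus C (Sus C (Sus C w))) z"
    if w: "w \<in> W" and z: "z \<in> Z" for w z
  proof -
    obtain y0 y1 where 1: "y0 \<in> Z" "Sus C y1 \<in> Z" "tri y0 w y1" using lowerE[OF WZ w] by metis
    show "orth (Sus C (Sus C w)) z" "orth (Sus C (Sus C (Sus C w))) z"
      using tri_orth_left[OF tri_Sus[OF tri_Sus[OF 1(3)]]]
        tri_orth_left[OF tri_Sus[OF tri_Sus[OF tri_Sus[OF 1(3)]]]]
        E[OF 1(1) z] E[OF 1(2) z] by blast+
  qed
  obtain s w where s: "s \<in> W" "w \<in> W" "Sus C s \<in> X" "tri (Sus C s) x w"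
    using torsion_decomposition[OF XA proper_abelian_has_cones[OF X(1)] X(2) WX x] .
  \<comment> \<open>The arrow from z0 to s vanishes because \<Sigma> s lies in \<open>X\<close>,
    hence is built from \<open>Y\<close>. So s is a retract of z1, and \<Sigma> s one of \<Sigma>
    z1, which lies in \<open>Z\<close>.\<close>
  have "Sus C s \<in> Z"
  proof -
    obtain z0 z1 f g h where z: "z0 \<in> Z" "Sus C z1 \<in> Z" and t: "tri_arrs z0 s z1 f g h"
      using lowerE[OF WZ s(1)] .
    obtain y y' where y: "y \<in> Y" "Sus C y' \<in> Y" "tri y (Sus C s) y'" using lowerE[OF XY(1) s(3)] by metis
    note d = tri_arrsD[OF t]
    have "orth (Sus C z0) y'"
      using orth_SusD[OF H(2)[OF z(1) y(2)]] Sus_in_Obj d(5) tri_Obj y(3) by blast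
    then have "orth (Sus C z0) (Sus C s)" using tri_orth_right[OF y(3)] H(1)[OF z(1) y(1)] by blast
    then have "f = Zer C z0 s" using orth_SusD d unfolding orth_def by blast
    then obtain r where r: "r \<in> Hom C z1 s" "r \<cdot> g = Idn C s" using tri_retraction[OF t] by metis
    have "SusA C r \<cdot> SusA C g = Idn C (Sus C s)"
      using SusA_Cmp[OF d(2) r(1)] r(2) SusA_Idn[OF d(6)] by simp
    then show ?thesis using retract_closed[OF Z(1) z(2) SusA_in_Hom[OF r(1)] SusA_in_Hom[OF d(2)]] by blast
  qed
  note Ss = this
  \<comment> \<open>\<open>SX\<close> stands for \<Sigma> \<open>X\<close>. The relation between
    \<open>X\<close> and \<open>Y\<close> is turned into the same relation between \<open>Y\<close>
    and \<Sigma> \<open>X\<close>, so that \<Sigma> x can be decomposed along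
    \<open>Y\<close>.\<close>
  have low: "lower Y SX"
    unfolding lower_def
  proof
    fix y assume "y \<in> Y"
    then show "\<exists>u \<in> SX. \<exists>z. Sus C z \<in> SX \<and> tri u y z" using XY(2) SX(4) unfolding upper_def by metis
  qed
  have up: "upper Y SX"
    unfolding upper_def
  proof
    fix v assume "v \<in> SX"
    then obtain x' where x': "x' \<in> X" "isomorphic C (Sus C x') v" using SX(5) by blast
    obtain y z where y: "y \<in> Y" "Sus C z \<in> Y" "tri y x' z" using lowerE[OF XY(1) x'(1)] by metis
    have "tri (Sus C y) v (Sus C z)"
      using tri_iso[OF tri_Sus[OF y(3)] isomorphic_refl x'(2) isomorphic_refl] tri_Obj y(3) Sus_in_Obj
      by blast
    then show "\<exists>s \<in> Y. \<exists>a \<in> Y. tri (Sus C s) v a" using y by blast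
  qed
  obtain t \<phi> where t: "t \<in> Y" "\<phi> \<in> Y" "Sus C t \<in> SX" "\<phi> \<in> SX" "tri (Sus C t) (Sus C x) \<phi>"
    using torsion_decomposition[OF SX(1-3) low up SX(4)[OF x]] .
  \<comment> \<open>Up to isomorphism \<phi> is \<Sigma> x' with x' built from \<open>W\<close> as a
    member of \<Sigma> \<open>W\<close> * \<open>W\<close>. Suspending once more, degrees 3 and 2 of
    \<open>G\<close> kill its arrow to \<zeta>.\<close>
  have \<phi>Z: "\<phi> \<in> Z"
  proof -
    obtain z0 \<zeta> f g h where z: "z0 \<in> Z" "Sus C \<zeta> \<in> Z" and tt: "tri_arrs z0 \<phi> \<zeta> f g h"
      using lowerE[OF YZ t(2)] .
    obtain x' where x': "x' \<in> X" "isomorphic C (Sus C x') \<phi>" using SX(5) t by blast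
    obtain w1 w2 where w: "w1 \<in> W" "w2 \<in> W" "tri (Sus C w1) x' w2" using upperE[OF WX(2) x'(1)] by metis
    have "orth (Sus C (Sus C x')) (Sus C \<zeta>)"
      using tri_orth_left[OF tri_Sus[OF tri_Sus[OF w(3)]]] G(2)[OF w(1) z(2)] G(1)[OF w(2) z(2)] by blast
    then have "orth (Sus C x') \<zeta>" using orth_SusD tri_Obj w(3) tri_arrsD[OF tt] Sus_in_Obj by blast
    then have "orth \<phi> \<zeta>" using orth_iso_left[OF x'(2)] by blast
    then show ?thesis using tri_zero_second[OF tt _ Z(1) z(1)] by blast
  qed
  obtain z b g p \<delta> where z: "z \<in> Z" "Sus C b \<in> Z" and tz: "tri_arrs z w b g p \<delta>"
    using lowerE[OF WZ s(2)] .
  obtain \<alpha> \<beta> \<gamma> where tx: "tri_arrs (Sus C s) x w \<alpha> \<beta> \<gamma>" using s(4) unfolding tri_def by blast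
  note dz = tri_arrsD[OF tz] and dx = tri_arrsD[OF tx]
  \<comment> \<open>The candidate for the part of x in \<open>Z\<close>: the fibre of the composite
    from x through w to b.\<close>
  obtain e \<iota> h where te: "tri_arrs e x b \<iota> (p \<cdot> \<beta>) h"
    using tri_fiber[OF Cmp_in_Hom[OF dx(2) dz(2)]] .
  note de = tri_arrsD[OF te]
  \<comment> \<open>The octahedral axiom compares cones, which are the suspended fibres. After
    removing one suspension this says that e is an extension of z by \<Sigma> s, both in
    \<open>Z\<close>.\<close>
  have eZZ: "tri (Sus C (Sus C s)) (Sus C e) (Sus C z)"
    using octahedron[OF tri_arrs_rotate[OF tx] tri_arrs_rotate[OF tz] tri_arrs_rotate[OF te]]
    unfolding tri_def by metis
  have e1: "orth (Sus C e) z'" if z': "z' \<in> Z" for z'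
    using tri_orth_left[OF eZZ] E(1)[OF Ss z'] E(1)[OF z(1) z'] by blast
  have e2: "orth (Sus C e) y" if y: "Sus C y \<in> Z" "y \<in> Obj C" for y
    using orth_SusD[OF tri_orth_left[OF tri_Sus[OF eZZ] E(2)[OF Ss y(1)] E(2)[OF z(1) y(1)]]]
      Sus_in_Obj[OF de(5)] y(2) by blast
  obtain a c d where tt: "tri_arrs (Sus C t) (Sus C x) \<phi> a c d" using t(5) unfolding tri_def by blast
  note dt = tri_arrsD[OF tt]
  obtain z0 z1 g' p' \<delta>' where z0: "z0 \<in> Z" "Sus C z1 \<in> Z" and t0: "tri_arrs z0 t z1 g' p' \<delta>'"
    using lowerE[OF YZ t(1)] .
  note d0 = tri_arrsD[OF t0]
  note S\<iota> = SusA_in_Hom[OF de(1)]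
  \<comment> \<open>First direction: there are no arrows from \<Sigma> e to \<phi>, so \<iota>
    factors through t; below, none from e to z1, so it factors further through z0.\<close>
  have "c \<cdot> SusA C \<iota> = Zer C (Sus C e) \<phi>"
    using e1[OF \<phi>Z] Cmp_in_Hom[OF S\<iota> dt(2)] unfolding orth_def by blast
  then obtain \<kappa> where \<kappa>: "\<kappa> \<in> Hom C (Sus C e) (Sus C t)" "a \<cdot> \<kappa> = SusA C \<iota>" using tri_lift[OF tt S\<iota>] by metis
  obtain \<kappa>0 where \<kappa>0: "\<kappa>0 \<in> Hom C e t" "SusA C \<kappa>0 = \<kappa>" using SusA_full[OF de(5) d0(6) \<kappa>(1)] .
  obtain a0 where a0: "a0 \<in> Hom C t x" "SusA C a0 = a" using SusA_full[OF d0(6) de(6) dt(1)] .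
  have a\<kappa>: "a0 \<cdot> \<kappa>0 = \<iota>"
    using SusA_inj[OF Cmp_in_Hom[OF \<kappa>0(1) a0(1)] de(1)] SusA_Cmp[OF \<kappa>0(1) a0(1)] \<kappa>0(2) a0(2) \<kappa>(2) by simp
  have "orth e z1" using e1[OF z0(2)] orth_SusD de(5) d0(7) by blast
  then have "p' \<cdot> \<kappa>0 = Zer C e z1" using Cmp_in_Hom[OF \<kappa>0(1) d0(2)] unfolding orth_def by blast
  then obtain \<nu> where \<nu>: "\<nu> \<in> Hom C e z0" "g' \<cdot> \<nu> = \<kappa>0" using tri_lift[OF t0 \<kappa>0(1)] by metis
  have \<psi>: "a0 \<cdot> g' \<in> Hom C z0 x" using Cmp_in_Hom[OF d0(1) a0(1)] .
  have \<psi>\<nu>: "(a0 \<cdot> g') \<cdot> \<nu> = \<iota>" using Cmp_assoc[OF \<nu>(1) d0(1) a0(1)] \<nu>(2) a\<kappa> by simp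
  \<comment> \<open>Conversely the arrow from z0 to x is killed on the way to b, so it factors
    through e.\<close>
  have "orth z0 b" using orth_SusD[OF E(1)[OF z0(1) z(2)]] d0(5) dz(7) by blast
  then have "(p \<cdot> \<beta>) \<cdot> (a0 \<cdot> g') = Zer C z0 b" using Cmp_in_Hom[OF \<psi> de(2)] unfolding orth_def by blast
  then obtain \<mu> where \<mu>: "\<mu> \<in> Hom C z0 e" "\<iota> \<cdot> \<mu> = a0 \<cdot> g'" using tri_lift[OF te \<psi>] by metis
  \<comment> \<open>The two factorisations agree with the identity of e only after \<iota>.
    Uniqueness of lifts removes \<iota>, since there are no arrows from \<Sigma> e to b.\<close>
  have "\<iota> \<cdot> (\<mu> \<cdot> \<nu>) = \<iota> \<cdot> Idn C e"
    using Cmp_assoc[OF \<nu>(1) \<mu>(1) de(1)] \<mu>(2) \<psi>\<nu> Cmp_Idn_right[OF de(1)] by simp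
  then have "\<mu> \<cdot> \<nu> = Idn C e"
    using tri_lift_unique[OF te e2[OF z(2) dz(7)] Cmp_in_Hom[OF \<nu>(1) \<mu>(1)] Idn_in_Hom[OF de(5)]] by blast
  then have "e \<in> Z" using retract_closed[OF Z(1) z0(1) \<mu>(1) \<nu>(1)] by blast
  then show "\<exists>y \<in> Z. \<exists>z. Sus C z \<in> Z \<and> tri y x z" using te z(2) unfolding tri_def by blast
qed

text \<open>One presentation of x shows that it receives no arrows from \<Sigma> s. In the other
  presentation the first arrow therefore vanishes, which makes x a retract of a.\<close>

lemma lower_upper_antisym:
  assumes X: "additive_subcategory C X" and Y: "additive_subcategory C Y" "neg_orth Y"
    and low: "lower X Y" and up: "upper Y X"
  shows "X \<subseteq> Y"
proof
  fix x assume x: "x \<in> X"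
  obtain y z f g h where y: "y \<in> Y" "Sus C z \<in> Y" "tri y x z" using lowerE[OF low x] by metis
  obtain s a f g h where s: "s \<in> Y" "a \<in> Y" and t: "tri_arrs (Sus C s) x a f g h" using upperE[OF up x] .
  note d = tri_arrsD[OF t]
  have so: "s \<in> Obj C" using Y(1) s unfolding additive_subcategory_def by blast
  have "orth (Sus C s) z"
    using orth_SusD[OF neg_orthD(2)[OF Y(2) s(1) y(2)]] d(5) tri_Obj y(3) by blast
  then have "orth (Sus C s) x" using tri_orth_right[OF y(3)] neg_orthD(1)[OF Y(2) s(1) y(1)] by blast
  then have "f = Zer C (Sus C s) x" using d unfolding orth_def by blast
  then obtain r where "r \<in> Hom C a x" "r \<cdot> g = Idn C x" using tri_retraction[OF t] by metis
  then show "x \<in> Y" using retract_closed[OF Y(1) s(2)] d(2) by blast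
qed

end

section \<open>Equivalences of additive categories\<close>

lemma (in additive_category) additive_full_subcategory:
  assumes X: "additive_subcategory C X"
  shows "additive_category (full_subcategory C X)"
proof -
  have XO: "X \<subseteq> Obj C" using X unfolding additive_subcategory_def by blast
  obtain z where z: "is_zero_obj C z" using ex_zero_obj by blast
  then have "z \<in> X" using X unfolding additive_subcategory_def by blast
  then have "is_zero_obj (full_subcategory C X) z"
    using z XO unfolding is_zero_obj_def by (simp add: Hom_full_subcategory subset_iff)
  then have zero: "\<exists>z. is_zero_obj (full_subcategory C X) z" by blast
  have group: "comm_group (hom_group (full_subcategory C X) a b)" if ab: "a \<in> X" "b \<in> X" for a b
  proof -
    have "hom_group (full_subcategory C X) a b = hom_group C a b"
      unfolding hom_group_def using ab by (auto simp: Hom_full_subcategory)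
    then show ?thesis using hom_group_comm_group ab XO by (metis subsetD)
  qed
  have sum: "\<exists>c. direct_sum (full_subcategory C X) a b c" if ab: "a \<in> X" "b \<in> X" for a b
  proof -
    obtain c where c: "direct_sum C a b c" using ex_direct_sum ab XO by blast
    then have "c \<in> X" using X ab unfolding additive_subcategory_def by blast
    then have "direct_sum (full_subcategory C X) a b c"
      using ab c unfolding direct_sum_def is_biproduct_def by (simp add: Hom_full_subcategory)
    then show ?thesis by blast
  qed
  have ends: "Src C f \<in> X" "Tgt C f \<in> X" if "f \<in> Arr (full_subcategory C X)" for f
    using that by (auto simp: full_subcategory_def)
  show ?thesis
    by (intro additive_category.intro category.intro additive_category_axioms.intro)
      (use XO zero group sum ends in \<open>auto simp: Hom_full_subcategory Idn_in_Hom Cmp_in_Hom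
        Cmp_Idn_left Cmp_Idn_right Cmp_assoc Cmp_Add_left Cmp_Add_right\<close>)
qed

context additive_category
begin

section \<open>Kernels and cokernels up to isomorphism, as needed for merely essentially surjective
  functors\<close>

lemma cancel_iso_right:
  assumes "inverse_arrs C x d u u'" "s \<in> Hom C d c" "s' \<in> Hom C d c" "s \<cdot> u = s' \<cdot> u"
  shows "s = s'"
  using Cmp_right_inverse[OF inverse_arrs_sym[OF assms(1)]] assms by metis

lemma cancel_iso_left:
  assumes "inverse_arrs C d x u u'" "s \<in> Hom C c d" "s' \<in> Hom C c d" "u \<cdot> s = u \<cdot> s'"
  shows "s = s'"
  using Cmp_left_inverse[OF assms(1)] assms by metis

lemma kernel_precompose_iso:
  assumes k: "k \<in> Hom C c a" and f: "f \<in> Hom C a b" and ker: "is_kernel C k f"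
    and u: "inverse_arrs C x c u u'"
  shows "is_kernel C (k \<cdot> u) f"
proof -
  have uh: "u \<in> Hom C x c" "u' \<in> Hom C c x" using u by (auto simp: inverse_arrs_def)
  have ku: "k \<cdot> u \<in> Hom C x a" using Cmp_in_Hom[OF uh(1) k] .
  have 0: "f \<cdot> k = Zer C c b"
    and ex: "\<And>d t. t \<in> Hom C d a \<Longrightarrow> f \<cdot> t = Zer C d b \<Longrightarrow> \<exists>!s. s \<in> Hom C d c \<and> k \<cdot> s = t"
    using ker unfolding is_kernel_iff[OF k f] by blast+
  have "f \<cdot> (k \<cdot> u) = Zer C x b"
    using Cmp_assoc[OF uh(1) k f] 0 Cmp_Zer_left[OF uh(1)] Hom_Obj[OF f] by simp
  moreover have "\<exists>!s. s \<in> Hom C d x \<and> (k \<cdot> u) \<cdot> s = t"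
    if t: "t \<in> Hom C d a" and ft: "f \<cdot> t = Zer C d b" for d t
  proof -
    obtain s where s: "s \<in> Hom C d c" "k \<cdot> s = t"
      and un: "\<And>s'. s' \<in> Hom C d c \<Longrightarrow> k \<cdot> s' = t \<Longrightarrow> s' = s" using ex[OF t ft] by metis
    have us: "u' \<cdot> s \<in> Hom C d x" using Cmp_in_Hom[OF s(1) uh(2)] .
    have "(k \<cdot> u) \<cdot> (u' \<cdot> s) = t"
      using Cmp_assoc[OF us uh(1) k] Cmp_left_inverse[OF inverse_arrs_sym[OF u] s(1)] s(2) by simp
    moreover have "s' = u' \<cdot> s" if s': "s' \<in> Hom C d x" "(k \<cdot> u) \<cdot> s' = t" for s'
      using un[OF Cmp_in_Hom[OF s'(1) uh(1)]] Cmp_assoc[OF s'(1) uh(1) k] s'(2)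
        Cmp_left_inverse[OF u s'(1)] by simp
    ultimately show ?thesis using us by blast
  qed
  ultimately show ?thesis unfolding is_kernel_iff[OF ku f] by blast
qed

lemma kernel_postcompose_iso:
  assumes k: "k \<in> Hom C c a" and f: "f \<in> Hom C a b" and ker: "is_kernel C k f"
    and u: "inverse_arrs C b x u u'"
  shows "is_kernel C k (u \<cdot> f)"
proof -
  have uh: "u \<in> Hom C b x" "u' \<in> Hom C x b" using u by (auto simp: inverse_arrs_def)
  have uf: "u \<cdot> f \<in> Hom C a x" using Cmp_in_Hom[OF f uh(1)] .
  have eq: "(u \<cdot> f) \<cdot> t = Zer C d x \<longleftrightarrow> f \<cdot> t = Zer C d b" if t: "t \<in> Hom C d a" for d t
  proof -
    have "(u \<cdot> f) \<cdot> t = u \<cdot> (f \<cdot> t)" "Zer C d x = u \<cdot> Zer C d b"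
      using Cmp_assoc[OF t f uh(1)] Cmp_Zer_right[OF uh(1)] Hom_Obj[OF t] by simp_all
    then show ?thesis
      using cancel_iso_left[OF u Cmp_in_Hom[OF t f] Zer_in_Hom] Hom_Obj[OF f] Hom_Obj[OF t] by metis
  qed
  show ?thesis
    using ker unfolding is_kernel_iff[OF k f] is_kernel_iff[OF k uf] using eq k by blast
qed

lemma cokernel_postcompose_iso:
  assumes q: "q \<in> Hom C b c" and f: "f \<in> Hom C a b" and coker: "is_cokernel C q f"
    and u: "inverse_arrs C c x u u'"
  shows "is_cokernel C (u \<cdot> q) f"
proof -
  have uh: "u \<in> Hom C c x" "u' \<in> Hom C x c" using u by (auto simp: inverse_arrs_def)
  have uq: "u \<cdot> q \<in> Hom C b x" using Cmp_in_Hom[OF q uh(1)] .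
  have 0: "q \<cdot> f = Zer C a c"
    and ex: "\<And>d t. t \<in> Hom C b d \<Longrightarrow> t \<cdot> f = Zer C a d \<Longrightarrow> \<exists>!s. s \<in> Hom C c d \<and> s \<cdot> q = t"
    using coker unfolding is_cokernel_iff[OF q f] by blast+
  have "(u \<cdot> q) \<cdot> f = Zer C a x"
    using Cmp_assoc[OF f q uh(1)] 0 Cmp_Zer_right[OF uh(1)] Hom_Obj[OF f] by simp
  moreover have "\<exists>!s. s \<in> Hom C x d \<and> s \<cdot> (u \<cdot> q) = t"
    if t: "t \<in> Hom C b d" and tf: "t \<cdot> f = Zer C a d" for d t
  proof -
    obtain s where s: "s \<in> Hom C c d" "s \<cdot> q = t"
      and un: "\<And>s'. s' \<in> Hom C c d \<Longrightarrow> s' \<cdot> q = t \<Longrightarrow> s' = s" using ex[OF t tf] by metis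
    have us: "s \<cdot> u' \<in> Hom C x d" using Cmp_in_Hom[OF uh(2) s(1)] .
    have "(s \<cdot> u') \<cdot> (u \<cdot> q) = t"
      using Cmp_assoc[OF q uh(1) us] Cmp_right_inverse[OF u s(1)] s(2) by simp
    moreover have "s' = s \<cdot> u'" if s': "s' \<in> Hom C x d" "s' \<cdot> (u \<cdot> q) = t" for s'
      using un[OF Cmp_in_Hom[OF uh(1) s'(1)]] Cmp_assoc[OF q uh(1) s'(1)] s'(2)
        Cmp_right_inverse[OF inverse_arrs_sym[OF u] s'(1)] by simp
    ultimately show ?thesis using us by blast
  qed
  ultimately show ?thesis unfolding is_cokernel_iff[OF uq f] by blast
qed

lemma cokernel_precompose_iso:
  assumes q: "q \<in> Hom C b c" and f: "f \<in> Hom C a b" and coker: "is_cokernel C q f"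
    and u: "inverse_arrs C x a u u'"
  shows "is_cokernel C q (f \<cdot> u)"
proof -
  have uh: "u \<in> Hom C x a" "u' \<in> Hom C a x" using u by (auto simp: inverse_arrs_def)
  have fu: "f \<cdot> u \<in> Hom C x b" using Cmp_in_Hom[OF uh(1) f] .
  have eq: "t \<cdot> (f \<cdot> u) = Zer C x d \<longleftrightarrow> t \<cdot> f = Zer C a d" if t: "t \<in> Hom C b d" for d t
  proof -
    have "t \<cdot> (f \<cdot> u) = (t \<cdot> f) \<cdot> u" "Zer C x d = Zer C a d \<cdot> u"
      using Cmp_assoc[OF uh(1) f t] Cmp_Zer_left[OF uh(1)] Hom_Obj[OF t] by simp_all
    then show ?thesis
      using cancel_iso_right[OF u Cmp_in_Hom[OF f t] Zer_in_Hom] Hom_Obj[OF f] Hom_Obj[OF t] by metis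
  qed
  show ?thesis
    using coker unfolding is_cokernel_iff[OF q f] is_cokernel_iff[OF q fu] using eq q by blast
qed

end

text \<open>The functor \<open>F\<close>, \<open>G\<close> runs from \<open>Q\<close> to
  \<open>P\<close>, and properties are pulled back from \<open>P\<close> to \<open>Q\<close>. It
  will be desuspension, from \<Sigma> \<open>A\<close> to \<open>A\<close>.\<close>

locale additive_equivalence = P: additive_category P + Q: additive_category Q
  for P :: "('o, 'm, 'x) preadditive_scheme" and Q :: "('p, 'n, 'y) preadditive_scheme" +
  fixes F :: "'p \<Rightarrow> 'o" and G :: "'n \<Rightarrow> 'm"
  assumes G_Hom: "f \<in> Hom Q a b \<Longrightarrow> G f \<in> Hom P (F a) (F b)"
    and G_Cmp: "f \<in> Hom Q a b \<Longrightarrow> g \<in> Hom Q b c \<Longrightarrow> G (g \<cdot>\<^bsub>Q\<^esub> f) = G g \<cdot>\<^bsub>P\<^esub> G f"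
    and G_Zer: "a \<in> Obj Q \<Longrightarrow> b \<in> Obj Q \<Longrightarrow> G (Zer Q a b) = Zer P (F a) (F b)"
    and G_inj: "f \<in> Hom Q a b \<Longrightarrow> g \<in> Hom Q a b \<Longrightarrow> G f = G g \<Longrightarrow> f = g"
    and G_full: "a \<in> Obj Q \<Longrightarrow> b \<in> Obj Q \<Longrightarrow> h \<in> Hom P (F a) (F b) \<Longrightarrow> \<exists>f \<in> Hom Q a b. G f = h"
    and F_ess_surj: "d \<in> Obj P \<Longrightarrow> \<exists>a \<in> Obj Q. isomorphic P (F a) d"
begin

lemma F_cover:
  assumes "d \<in> Obj P"
  obtains x u u' where "x \<in> Obj Q" "inverse_arrs P (F x) d u u'" "u \<in> Hom P (F x) d"
    "u' \<in> Hom P d (F x)"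
  using F_ess_surj[OF assms] unfolding isomorphic_iff inverse_arrs_def by blast

lemma G_Cmp_Zer_iff:
  assumes "f \<in> Hom Q a b" "g \<in> Hom Q b c"
  shows "G g \<cdot>\<^bsub>P\<^esub> G f = Zer P (F a) (F c) \<longleftrightarrow> g \<cdot>\<^bsub>Q\<^esub> f = Zer Q a c"
proof -
  have o: "a \<in> Obj Q" "c \<in> Obj Q" using assms Q.Hom_Obj by blast+
  show ?thesis
    using G_Cmp[OF assms] G_Zer[OF o] G_inj[OF Q.Cmp_in_Hom[OF assms] Q.Zer_in_Hom[OF o]] by auto
qed

lemma kernel_iff:
  assumes k: "k \<in> Hom Q c a" and f: "f \<in> Hom Q a b"
  shows "is_kernel P (G k) (G f) \<longleftrightarrow> is_kernel Q k f"
proof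
  note Gk = G_Hom[OF k] and Gf = G_Hom[OF f]
  have o: "a \<in> Obj Q" "b \<in> Obj Q" "c \<in> Obj Q" using k f Q.Hom_Obj by blast+
  {
    assume L: "is_kernel P (G k) (G f)"
    have 0: "G f \<cdot>\<^bsub>P\<^esub> G k = Zer P (F c) (F b)"
      and ex: "\<And>d t. t \<in> Hom P d (F a) \<Longrightarrow> G f \<cdot>\<^bsub>P\<^esub> t = Zer P d (F b) \<Longrightarrow>
        \<exists>!s. s \<in> Hom P d (F c) \<and> G k \<cdot>\<^bsub>P\<^esub> s = t"
      using L unfolding is_kernel_iff[OF Gk Gf] by blast+
    have "\<exists>!s. s \<in> Hom Q d c \<and> k \<cdot>\<^bsub>Q\<^esub> s = t"
      if t: "t \<in> Hom Q d a" and ft: "f \<cdot>\<^bsub>Q\<^esub> t = Zer Q d b" for d t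
    proof -
      have d: "d \<in> Obj Q" using Q.Hom_Obj[OF t] by blast
      obtain s where s: "s \<in> Hom P (F d) (F c)" "G k \<cdot>\<^bsub>P\<^esub> s = G t"
        and un: "\<And>s'. s' \<in> Hom P (F d) (F c) \<Longrightarrow> G k \<cdot>\<^bsub>P\<^esub> s' = G t \<Longrightarrow> s' = s"
        using ex[OF G_Hom[OF t]] ft G_Cmp_Zer_iff[OF t f] by metis
      obtain s0 where s0: "s0 \<in> Hom Q d c" "G s0 = s" using G_full d o s by blast
      have "k \<cdot>\<^bsub>Q\<^esub> s0 = t" using G_inj[OF Q.Cmp_in_Hom[OF s0(1) k] t] G_Cmp[OF s0(1) k] s0 s by simp
      moreover have "s' = s0" if s': "s' \<in> Hom Q d c" "k \<cdot>\<^bsub>Q\<^esub> s' = t" for s'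
        using G_inj[OF s'(1) s0(1)] un[OF G_Hom[OF s'(1)]] G_Cmp[OF s'(1) k] s'(2) s0(2) by simp
      ultimately show ?thesis using s0 by blast
    qed
    then show "is_kernel Q k f"
      unfolding is_kernel_iff[OF k f] using 0 G_Cmp_Zer_iff[OF k f] by blast
  }
  {
    assume R: "is_kernel Q k f"
    have 0: "f \<cdot>\<^bsub>Q\<^esub> k = Zer Q c b"
      and ex: "\<And>d t. t \<in> Hom Q d a \<Longrightarrow> f \<cdot>\<^bsub>Q\<^esub> t = Zer Q d b \<Longrightarrow>
        \<exists>!s. s \<in> Hom Q d c \<and> k \<cdot>\<^bsub>Q\<^esub> s = t"
      using R unfolding is_kernel_iff[OF k f] by blast+
    have "\<exists>!s. s \<in> Hom P d (F c) \<and> G k \<cdot>\<^bsub>P\<^esub> s = t"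
      if t: "t \<in> Hom P d (F a)" and ft: "G f \<cdot>\<^bsub>P\<^esub> t = Zer P d (F b)" for d t
    proof -
      \<comment> \<open>A test object of \<open>P\<close> need not be a value of \<open>F\<close>.
        It is replaced by an isomorphic F x, the factorisation is found in \<open>Q\<close>, and the
        isomorphism is undone.\<close>
      obtain x u u' where x: "x \<in> Obj Q" and u: "inverse_arrs P (F x) d u u'"
        and uh: "u \<in> Hom P (F x) d" "u' \<in> Hom P d (F x)" using F_cover P.Hom_Obj[OF t] by metis
      obtain t0 where t0: "t0 \<in> Hom Q x a" "G t0 = t \<cdot>\<^bsub>P\<^esub> u"
        using G_full[OF x o(1) P.Cmp_in_Hom[OF uh(1) t]] by blast
      have "G f \<cdot>\<^bsub>P\<^esub> (t \<cdot>\<^bsub>P\<^esub> u) = Zer P (F x) (F b)"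
        using P.Cmp_assoc[OF uh(1) t Gf] ft P.Cmp_Zer_left[OF uh(1)] P.Hom_Obj[OF Gf] by simp
      then have "f \<cdot>\<^bsub>Q\<^esub> t0 = Zer Q x b" using G_Cmp_Zer_iff[OF t0(1) f] t0(2) by simp
      then obtain s0 where s0: "s0 \<in> Hom Q x c" "k \<cdot>\<^bsub>Q\<^esub> s0 = t0"
        and un: "\<And>s'. s' \<in> Hom Q x c \<Longrightarrow> k \<cdot>\<^bsub>Q\<^esub> s' = t0 \<Longrightarrow> s' = s0" using ex[OF t0(1)] by metis
      have h: "G s0 \<cdot>\<^bsub>P\<^esub> u' \<in> Hom P d (F c)" using P.Cmp_in_Hom[OF uh(2) G_Hom[OF s0(1)]] .
      have "G k \<cdot>\<^bsub>P\<^esub> (G s0 \<cdot>\<^bsub>P\<^esub> u') = (t \<cdot>\<^bsub>P\<^esub> u) \<cdot>\<^bsub>P\<^esub> u'"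
        using P.Cmp_assoc[OF uh(2) G_Hom[OF s0(1)] Gk] G_Cmp[OF s0(1) k] s0(2) t0(2) by simp
      then have e: "G k \<cdot>\<^bsub>P\<^esub> (G s0 \<cdot>\<^bsub>P\<^esub> u') = t"
        using P.Cmp_right_inverse[OF inverse_arrs_sym[OF u] t] by simp
      have "s' = G s0 \<cdot>\<^bsub>P\<^esub> u'" if s': "s' \<in> Hom P d (F c)" "G k \<cdot>\<^bsub>P\<^esub> s' = t" for s'
      proof -
        obtain s1 where s1: "s1 \<in> Hom Q x c" "G s1 = s' \<cdot>\<^bsub>P\<^esub> u"
          using G_full[OF x o(3) P.Cmp_in_Hom[OF uh(1) s'(1)]] by blast
        have "G (k \<cdot>\<^bsub>Q\<^esub> s1) = G t0"
          using G_Cmp[OF s1(1) k] s1(2) P.Cmp_assoc[OF uh(1) s'(1) Gk] s'(2) t0(2) by simp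
        then have "s1 = s0" using un[OF s1(1)] G_inj[OF Q.Cmp_in_Hom[OF s1(1) k] t0(1)] by blast
        then show ?thesis using s1(2) P.Cmp_right_inverse[OF inverse_arrs_sym[OF u] s'(1)] by simp
      qed
      then show ?thesis using h e by blast
    qed
    then show "is_kernel P (G k) (G f)"
      unfolding is_kernel_iff[OF Gk Gf] using 0 G_Cmp_Zer_iff[OF k f] by blast
  }
qed

lemma cokernel_iff:
  assumes q: "q \<in> Hom Q b c" and f: "f \<in> Hom Q a b"
  shows "is_cokernel P (G q) (G f) \<longleftrightarrow> is_cokernel Q q f"
proof
  note Gq = G_Hom[OF q] and Gf = G_Hom[OF f]
  have o: "a \<in> Obj Q" "b \<in> Obj Q" "c \<in> Obj Q" using q f Q.Hom_Obj by blast+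
  {
    assume L: "is_cokernel P (G q) (G f)"
    have 0: "G q \<cdot>\<^bsub>P\<^esub> G f = Zer P (F a) (F c)"
      and ex: "\<And>d t. t \<in> Hom P (F b) d \<Longrightarrow> t \<cdot>\<^bsub>P\<^esub> G f = Zer P (F a) d \<Longrightarrow>
        \<exists>!s. s \<in> Hom P (F c) d \<and> s \<cdot>\<^bsub>P\<^esub> G q = t"
      using L unfolding is_cokernel_iff[OF Gq Gf] by blast+
    have "\<exists>!s. s \<in> Hom Q c d \<and> s \<cdot>\<^bsub>Q\<^esub> q = t"
      if t: "t \<in> Hom Q b d" and ft: "t \<cdot>\<^bsub>Q\<^esub> f = Zer Q a d" for d t
    proof -
      have d: "d \<in> Obj Q" using Q.Hom_Obj[OF t] by blast
      obtain s where s: "s \<in> Hom P (F c) (F d)" "s \<cdot>\<^bsub>P\<^esub> G q = G t"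
        and un: "\<And>s'. s' \<in> Hom P (F c) (F d) \<Longrightarrow> s' \<cdot>\<^bsub>P\<^esub> G q = G t \<Longrightarrow> s' = s"
        using ex[OF G_Hom[OF t]] ft G_Cmp_Zer_iff[OF f t] by metis
      obtain s0 where s0: "s0 \<in> Hom Q c d" "G s0 = s" using G_full d o s by blast
      have "s0 \<cdot>\<^bsub>Q\<^esub> q = t" using G_inj[OF Q.Cmp_in_Hom[OF q s0(1)] t] G_Cmp[OF q s0(1)] s0 s by simp
      moreover have "s' = s0" if s': "s' \<in> Hom Q c d" "s' \<cdot>\<^bsub>Q\<^esub> q = t" for s'
        using G_inj[OF s'(1) s0(1)] un[OF G_Hom[OF s'(1)]] G_Cmp[OF q s'(1)] s'(2) s0(2) by simp
      ultimately show ?thesis using s0 by blast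
    qed
    then show "is_cokernel Q q f"
      unfolding is_cokernel_iff[OF q f] using 0 G_Cmp_Zer_iff[OF f q] by blast
  }
  {
    assume R: "is_cokernel Q q f"
    have 0: "q \<cdot>\<^bsub>Q\<^esub> f = Zer Q a c"
      and ex: "\<And>d t. t \<in> Hom Q b d \<Longrightarrow> t \<cdot>\<^bsub>Q\<^esub> f = Zer Q a d \<Longrightarrow>
        \<exists>!s. s \<in> Hom Q c d \<and> s \<cdot>\<^bsub>Q\<^esub> q = t"
      using R unfolding is_cokernel_iff[OF q f] by blast+
    have "\<exists>!s. s \<in> Hom P (F c) d \<and> s \<cdot>\<^bsub>P\<^esub> G q = t"
      if t: "t \<in> Hom P (F b) d" and ft: "t \<cdot>\<^bsub>P\<^esub> G f = Zer P (F a) d" for d t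
    proof -
      obtain x u u' where x: "x \<in> Obj Q" and u: "inverse_arrs P (F x) d u u'"
        and uh: "u \<in> Hom P (F x) d" "u' \<in> Hom P d (F x)" using F_cover P.Hom_Obj[OF t] by metis
      obtain t0 where t0: "t0 \<in> Hom Q b x" "G t0 = u' \<cdot>\<^bsub>P\<^esub> t"
        using G_full[OF o(2) x P.Cmp_in_Hom[OF t uh(2)]] by blast
      have "(u' \<cdot>\<^bsub>P\<^esub> t) \<cdot>\<^bsub>P\<^esub> G f = Zer P (F a) (F x)"
        using P.Cmp_assoc[OF Gf t uh(2)] ft P.Cmp_Zer_right[OF uh(2)] P.Hom_Obj[OF Gf] by simp
      then have "t0 \<cdot>\<^bsub>Q\<^esub> f = Zer Q a x" using G_Cmp_Zer_iff[OF f t0(1)] t0(2) by simp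
      then obtain s0 where s0: "s0 \<in> Hom Q c x" "s0 \<cdot>\<^bsub>Q\<^esub> q = t0"
        and un: "\<And>s'. s' \<in> Hom Q c x \<Longrightarrow> s' \<cdot>\<^bsub>Q\<^esub> q = t0 \<Longrightarrow> s' = s0" using ex[OF t0(1)] by metis
      have h: "u \<cdot>\<^bsub>P\<^esub> G s0 \<in> Hom P (F c) d" using P.Cmp_in_Hom[OF G_Hom[OF s0(1)] uh(1)] .
      have "(u \<cdot>\<^bsub>P\<^esub> G s0) \<cdot>\<^bsub>P\<^esub> G q = u \<cdot>\<^bsub>P\<^esub> (u' \<cdot>\<^bsub>P\<^esub> t)"
        using P.Cmp_assoc[OF Gq G_Hom[OF s0(1)] uh(1)] G_Cmp[OF q s0(1)] s0(2) t0(2) by simp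
      then have e: "(u \<cdot>\<^bsub>P\<^esub> G s0) \<cdot>\<^bsub>P\<^esub> G q = t"
        using P.Cmp_left_inverse[OF inverse_arrs_sym[OF u] t] by simp
      have "s' = u \<cdot>\<^bsub>P\<^esub> G s0" if s': "s' \<in> Hom P (F c) d" "s' \<cdot>\<^bsub>P\<^esub> G q = t" for s'
      proof -
        obtain s1 where s1: "s1 \<in> Hom Q c x" "G s1 = u' \<cdot>\<^bsub>P\<^esub> s'"
          using G_full[OF o(3) x P.Cmp_in_Hom[OF s'(1) uh(2)]] by blast
        have "G (s1 \<cdot>\<^bsub>Q\<^esub> q) = G t0"
          using G_Cmp[OF q s1(1)] s1(2) P.Cmp_assoc[OF Gq s'(1) uh(2)] s'(2) t0(2) by simp
        then have "s1 = s0" using un[OF s1(1)] G_inj[OF Q.Cmp_in_Hom[OF q s1(1)] t0(1)] by blast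
        then show ?thesis using s1(2) P.Cmp_left_inverse[OF inverse_arrs_sym[OF u] s'(1)] by simp
      qed
      then show ?thesis using h e by blast
    qed
    then show "is_cokernel P (G q) (G f)"
      unfolding is_cokernel_iff[OF Gq Gf] using 0 G_Cmp_Zer_iff[OF f q] by blast
  }
qed

lemma short_exact_iff:
  assumes "f \<in> Hom Q a b" "g \<in> Hom Q b c"
  shows "short_exact P (G f) (G g) \<longleftrightarrow> short_exact Q f g"
  unfolding short_exact_def using kernel_iff[OF assms] cokernel_iff[OF assms(2,1)] by simp

lemma mono_preserved:
  assumes f: "f \<in> Hom Q a b" and "is_mono Q f"
  shows "is_mono P (G f)"
proof (rule P.is_monoI[OF G_Hom[OF f]])
  fix d t assume t: "t \<in> Hom P d (F a)" and ft: "G f \<cdot>\<^bsub>P\<^esub> t = Zer P d (F b)"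
  obtain x u u' where x: "x \<in> Obj Q" and u: "inverse_arrs P (F x) d u u'"
    and uh: "u \<in> Hom P (F x) d" "u' \<in> Hom P d (F x)" using F_cover P.Hom_Obj[OF t] by metis
  have a: "a \<in> Obj Q" "b \<in> Obj Q" using Q.Hom_Obj[OF f] by auto
  obtain t0 where t0: "t0 \<in> Hom Q x a" "G t0 = t \<cdot>\<^bsub>P\<^esub> u"
    using G_full[OF x a(1) P.Cmp_in_Hom[OF uh(1) t]] by blast
  have "G f \<cdot>\<^bsub>P\<^esub> (t \<cdot>\<^bsub>P\<^esub> u) = Zer P (F x) (F b)"
    using P.Cmp_assoc[OF uh(1) t G_Hom[OF f]] ft P.Cmp_Zer_left[OF uh(1)] P.Hom_Obj[OF G_Hom[OF f]]
    by simp
  then have "f \<cdot>\<^bsub>Q\<^esub> t0 = f \<cdot>\<^bsub>Q\<^esub> Zer Q x a"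
    using G_Cmp_Zer_iff[OF t0(1) f] t0(2) Q.Cmp_Zer_right[OF f x] by simp
  then have "t0 = Zer Q x a"
    using assms(2) t0(1) Q.Zer_in_Hom[OF x a(1)] unfolding is_mono_iff[OF f] by blast
  then have "t \<cdot>\<^bsub>P\<^esub> u = Zer P d (F a) \<cdot>\<^bsub>P\<^esub> u"
    using t0(2) G_Zer[OF x a(1)] P.Cmp_Zer_left[OF uh(1)] P.Hom_Obj[OF t] by simp
  then show "t = Zer P d (F a)"
    using P.cancel_iso_right[OF u t] P.Zer_in_Hom P.Hom_Obj[OF t] by blast
qed

lemma epi_preserved:
  assumes f: "f \<in> Hom Q a b" and e: "is_epi Q f"
  shows "is_epi P (G f)"
  unfolding is_epi_iff[OF G_Hom[OF f]]
proof (intro allI ballI impI)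
  fix d g h
  assume g: "g \<in> Hom P (F b) d" and h: "h \<in> Hom P (F b) d" and gh: "g \<cdot>\<^bsub>P\<^esub> G f = h \<cdot>\<^bsub>P\<^esub> G f"
  obtain x u u' where x: "x \<in> Obj Q" and u: "inverse_arrs P (F x) d u u'"
    and uh: "u \<in> Hom P (F x) d" "u' \<in> Hom P d (F x)" using F_cover P.Hom_Obj[OF g] by metis
  have b: "b \<in> Obj Q" using Q.Hom_Obj[OF f] by auto
  obtain g0 where g0: "g0 \<in> Hom Q b x" "G g0 = u' \<cdot>\<^bsub>P\<^esub> g"
    using G_full[OF b x P.Cmp_in_Hom[OF g uh(2)]] by blast
  obtain h0 where h0: "h0 \<in> Hom Q b x" "G h0 = u' \<cdot>\<^bsub>P\<^esub> h"
    using G_full[OF b x P.Cmp_in_Hom[OF h uh(2)]] by blast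
  have "G (g0 \<cdot>\<^bsub>Q\<^esub> f) = G (h0 \<cdot>\<^bsub>Q\<^esub> f)"
    using G_Cmp[OF f g0(1)] G_Cmp[OF f h0(1)] g0(2) h0(2) gh
      P.Cmp_assoc[OF G_Hom[OF f] g uh(2)] P.Cmp_assoc[OF G_Hom[OF f] h uh(2)] by simp
  then have "g0 \<cdot>\<^bsub>Q\<^esub> f = h0 \<cdot>\<^bsub>Q\<^esub> f"
    using G_inj[OF Q.Cmp_in_Hom[OF f g0(1)] Q.Cmp_in_Hom[OF f h0(1)]] by blast
  then have "g0 = h0" using e g0(1) h0(1) unfolding is_epi_iff[OF f] by blast
  then show "g = h"
    using P.cancel_iso_left[OF inverse_arrs_sym[OF u] g h] g0(2) h0(2) by simp
qed

text \<open>Each arrow supplied by the axioms for \<open>P\<close> has one end outside the image of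
  \<open>F\<close>. Composing with an isomorphism moves that end into the image, after which
  fullness lifts the arrow to \<open>Q\<close>.\<close>

lemma abelian_transfer:
  assumes "abelian_category P"
  shows "abelian_category Q"
proof -
  interpret AP: abelian_category P using assms .
  show ?thesis
  proof unfold_locales
    fix f assume "f \<in> Arr Q"
    then obtain a b where f: "f \<in> Hom Q a b" by (rule that[OF HomI])
    then have o: "a \<in> Obj Q" "b \<in> Obj Q" using Q.Hom_Obj by blast+
    note Gf = G_Hom[OF f]
    obtain k where ker: "is_kernel P k (G f)" using AP.ex_kernel HomD[OF Gf] by blast
    note k = is_kernel_Hom[OF ker Gf]
    obtain x u u' where x: "x \<in> Obj Q" and u: "inverse_arrs P (F x) (Src P k) u u'"
      "u \<in> Hom P (F x) (Src P k)" using F_cover P.Hom_Obj[OF k] by metis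
    obtain k0 where "k0 \<in> Hom Q x a" "G k0 = k \<cdot>\<^bsub>P\<^esub> u"
      using G_full[OF x o(1) P.Cmp_in_Hom[OF u(2) k]] by blast
    then show "\<exists>k. is_kernel Q k f"
      using kernel_iff f P.kernel_precompose_iso[OF k Gf ker u(1)] by metis
    obtain q where cok: "is_cokernel P q (G f)" using AP.ex_cokernel HomD[OF Gf] by blast
    note q = is_cokernel_Hom[OF cok Gf]
    obtain y v v' where y: "y \<in> Obj Q" and v: "inverse_arrs P (F y) (Tgt P q) v v'"
      "v' \<in> Hom P (Tgt P q) (F y)" using F_cover P.Hom_Obj[OF q] by metis
    obtain q0 where "q0 \<in> Hom Q b y" "G q0 = v' \<cdot>\<^bsub>P\<^esub> q"
      using G_full[OF o(2) y P.Cmp_in_Hom[OF q v(2)]] by blast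
    then show "\<exists>q. is_cokernel Q q f"
      using cokernel_iff f P.cokernel_postcompose_iso[OF q Gf cok inverse_arrs_sym[OF v(1)]] by metis
  next
    fix f assume m: "is_mono Q f"
    then have "f \<in> Arr Q" unfolding is_mono_def by blast
    then obtain a b where f: "f \<in> Hom Q a b" by (rule that[OF HomI])
    then have o: "b \<in> Obj Q" using Q.Hom_Obj by blast
    note Gf = G_Hom[OF f]
    obtain g where ker: "is_kernel P (G f) g" using AP.mono_is_kernel mono_preserved[OF f m] by blast
    then have g: "g \<in> Hom P (F b) (Tgt P g)" using Gf by (auto simp: is_kernel_def Hom_def)
    obtain y v v' where y: "y \<in> Obj Q" and v: "inverse_arrs P (F y) (Tgt P g) v v'"
      "v' \<in> Hom P (Tgt P g) (F y)" using F_cover P.Hom_Obj[OF g] by metis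
    obtain g0 where "g0 \<in> Hom Q b y" "G g0 = v' \<cdot>\<^bsub>P\<^esub> g"
      using G_full[OF o y P.Cmp_in_Hom[OF g v(2)]] by blast
    then show "\<exists>g. is_kernel Q f g"
      using kernel_iff f P.kernel_postcompose_iso[OF Gf g ker inverse_arrs_sym[OF v(1)]] by metis
  next
    fix f assume m: "is_epi Q f"
    then have "f \<in> Arr Q" unfolding is_epi_def by blast
    then obtain a b where f: "f \<in> Hom Q a b" by (rule that[OF HomI])
    then have o: "a \<in> Obj Q" using Q.Hom_Obj by blast
    note Gf = G_Hom[OF f]
    obtain g where cok: "is_cokernel P (G f) g" using AP.epi_is_cokernel epi_preserved[OF f m] by blast
    then have g: "g \<in> Hom P (Src P g) (F a)" using Gf by (auto simp: is_cokernel_def Hom_def)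
    obtain y v v' where y: "y \<in> Obj Q" and v: "inverse_arrs P (F y) (Src P g) v v'"
      "v \<in> Hom P (F y) (Src P g)" using F_cover P.Hom_Obj[OF g] by metis
    obtain g0 where "g0 \<in> Hom Q y a" "G g0 = g \<cdot>\<^bsub>P\<^esub> v"
      using G_full[OF y o P.Cmp_in_Hom[OF v(2) g]] by blast
    then show "\<exists>g. is_cokernel Q f g"
      using cokernel_iff f P.cokernel_precompose_iso[OF Gf g cok v(1)] by metis
  qed
qed

end

section \<open>Suspended subcategories\<close>

context triangulated_category
begin

section \<open>Chosen desuspensions and the translation of the defining inclusions\<close>

lemma Desus_Obj: "c \<in> Obj C \<Longrightarrow> Desus C c \<in> Obj C"
  and Sus_Desus: "c \<in> Obj C \<Longrightarrow> isomorphic C (Sus C (Desus C c)) c"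
proof -
  have "Desus C c \<in> Obj C \<and> isomorphic C (Sus C (Desus C c)) c" if "c \<in> Obj C"
    unfolding Desus_def by (rule someI_ex) (use Sus_ess_surj[OF that] in blast)
  then show "c \<in> Obj C \<Longrightarrow> Desus C c \<in> Obj C"
    "c \<in> Obj C \<Longrightarrow> isomorphic C (Sus C (Desus C c)) c" by blast+
qed

lemma Desus_Sus: "c \<in> Obj C \<Longrightarrow> isomorphic C (Desus C (Sus C c)) c"
  using Sus_Desus[of "Sus C c"] isomorphic_Sus_iff Desus_Obj Sus_in_Obj by blast

lemma isomorphic_Desus: "isomorphic C a b \<Longrightarrow> isomorphic C (Desus C a) (Desus C b)"
proof -
  assume i: "isomorphic C a b"
  have o: "a \<in> Obj C" "b \<in> Obj C" using isomorphic_Obj[OF i] .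
  show "isomorphic C (Desus C a) (Desus C b)"
    using isomorphic_trans[OF isomorphic_trans[OF Sus_Desus[OF o(1)] i]
        isomorphic_sym[OF Sus_Desus[OF o(2)]]]
      isomorphic_Sus_iff[OF Desus_Obj[OF o(1)] Desus_Obj[OF o(2)]] by blast
qed

lemma closed_isomorphic:
  "additive_subcategory C X \<Longrightarrow> a \<in> X \<Longrightarrow> isomorphic C a b \<Longrightarrow> b \<in> X"
  unfolding additive_subcategory_def by blast

lemma Sus_subcat_1: "Sus_subcat C 1 X = {c \<in> Obj C. \<exists>x \<in> X. isomorphic C (Sus C x) c}"
  by (simp add: Sus_subcat_def Sus_pow_def)

text \<open>Exhibits \<Sigma> \<open>X\<close> as the preimage of \<open>X\<close> under
  \<open>Desus\<close>, so that closure properties of \<open>X\<close> can be pulled back.\<close>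

lemma Sus_subcat_1_iff:
  assumes X: "additive_subcategory C X"
  shows "c \<in> Sus_subcat C 1 X \<longleftrightarrow> c \<in> Obj C \<and> Desus C c \<in> X"
proof
  assume "c \<in> Sus_subcat C 1 X"
  then obtain x where x: "c \<in> Obj C" "x \<in> X" "isomorphic C (Sus C x) c" by (auto simp: Sus_subcat_1)
  have xo: "x \<in> Obj C" using X x unfolding additive_subcategory_def by blast
  have "isomorphic C x (Desus C c)"
    using isomorphic_trans[OF isomorphic_sym[OF Desus_Sus[OF xo]] isomorphic_Desus[OF x(3)]] .
  then show "c \<in> Obj C \<and> Desus C c \<in> X" using closed_isomorphic[OF X x(2)] x(1) by blast
next
  assume "c \<in> Obj C \<and> Desus C c \<in> X"
  then show "c \<in> Sus_subcat C 1 X" using Sus_Desus unfolding Sus_subcat_1 by blast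
qed

lemma Sus_subcat_minus_1_iff:
  assumes X: "additive_subcategory C X"
  shows "c \<in> Sus_subcat C (-1) X \<longleftrightarrow> c \<in> Obj C \<and> Sus C c \<in> X"
proof
  assume "c \<in> Sus_subcat C (-1) X"
  then obtain x where x: "c \<in> Obj C" "x \<in> X" "isomorphic C (Desus C x) c"
    by (auto simp: Sus_subcat_def Sus_pow_def)
  have xo: "x \<in> Obj C" using X x unfolding additive_subcategory_def by blast
  have "isomorphic C x (Sus C c)"
    using isomorphic_trans[OF isomorphic_sym[OF Sus_Desus[OF xo]] isomorphic_Sus[OF x(3)]] .
  then show "c \<in> Obj C \<and> Sus C c \<in> X" using closed_isomorphic[OF X x(2)] x(1) by blast
next
  assume "c \<in> Obj C \<and> Sus C c \<in> X"
  then show "c \<in> Sus_subcat C (-1) X" using Desus_Sus by (auto simp: Sus_subcat_def Sus_pow_def)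
qed

lemma star_iff: "e \<in> star C X Y \<longleftrightarrow> (\<exists>x \<in> X. \<exists>y \<in> Y. tri x e y)"
proof
  assume "e \<in> star C X Y"
  then show "\<exists>x \<in> X. \<exists>y \<in> Y. tri x e y"
    unfolding star_def short_triangle_def tri_def using tri_arrsI by blast
next
  assume "\<exists>x \<in> X. \<exists>y \<in> Y. tri x e y"
  then obtain x y f g h where t: "x \<in> X" "y \<in> Y" "tri_arrs x e y f g h" unfolding tri_def by blast
  note d = tri_arrsD[OF t(3)]
  have "short_triangle C f g" using d unfolding short_triangle_def by blast
  then show "e \<in> star C X Y" using t(1,2) d unfolding star_def by blast
qed

lemma interval_le_iff:
  assumes X: "additive_subcategory C X" and Y: "additive_subcategory C Y"
  shows "interval_le C X Y \<longleftrightarrow> lower X Y \<and> upper X Y"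
proof -
  have 1: "X \<subseteq> star C Y (Sus_subcat C (-1) Y) \<longleftrightarrow> lower X Y"
    unfolding lower_def subset_iff star_iff Bex_def Sus_subcat_minus_1_iff[OF Y] using tri_Obj by blast
  have XO: "x \<in> X \<Longrightarrow> x \<in> Obj C" for x using X unfolding additive_subcategory_def by blast
  have "(\<exists>s \<in> Sus_subcat C 1 X. \<exists>x \<in> X. tri s y x) \<longleftrightarrow> (\<exists>s \<in> X. \<exists>x \<in> X. tri (Sus C s) y x)" for y
  proof
    assume "\<exists>s \<in> Sus_subcat C 1 X. \<exists>x \<in> X. tri s y x"
    then obtain s a x where s: "a \<in> X" "isomorphic C (Sus C a) s" "x \<in> X" "tri s y x"
      unfolding Sus_subcat_1 by blast
    then have "tri (Sus C a) y x"
      using tri_iso[OF s(4) isomorphic_sym[OF s(2)]] isomorphic_refl tri_Obj s(4) by blast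
    then show "\<exists>s \<in> X. \<exists>x \<in> X. tri (Sus C s) y x" using s by blast
  next
    assume "\<exists>s \<in> X. \<exists>x \<in> X. tri (Sus C s) y x"
    then show "\<exists>s \<in> Sus_subcat C 1 X. \<exists>x \<in> X. tri s y x"
      unfolding Sus_subcat_1 using isomorphic_refl Sus_in_Obj XO by blast
  qed
  then have 2: "Y \<subseteq> star C (Sus_subcat C 1 X) X \<longleftrightarrow> upper X Y"
    unfolding upper_def subset_iff star_iff by blast
  show ?thesis unfolding interval_le_def using 1 2 by simp
qed

section \<open>Condition E_n as vanishing of Homs out of suspensions\<close>

lemma orth_Desus_iff:
  assumes "x \<in> Obj C" "y \<in> Obj C"
  shows "orth x (Desus C y) \<longleftrightarrow> orth (Sus C x) y"
  using orth_Sus_iff[OF assms(1) Desus_Obj[OF assms(2)]] orth_iso_right[OF Sus_Desus[OF assms(2)]]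
    orth_iso_right[OF isomorphic_sym[OF Sus_Desus[OF assms(2)]]] by blast

lemma funpow_Sus_Obj: "x \<in> Obj C \<Longrightarrow> (Sus C ^^ k) x \<in> Obj C"
  by (induction k) (simp_all add: Sus_in_Obj)

lemma funpow_Desus_Obj: "x \<in> Obj C \<Longrightarrow> (Desus C ^^ k) x \<in> Obj C"
  by (induction k) (simp_all add: Desus_Obj)

lemma orth_funpow_Desus_iff:
  assumes "x \<in> Obj C" "y \<in> Obj C"
  shows "orth x ((Desus C ^^ k) y) \<longleftrightarrow> orth ((Sus C ^^ k) x) y"
  using assms(1)
proof (induction k arbitrary: x)
  case (Suc k)
  have "orth x ((Desus C ^^ Suc k) y) \<longleftrightarrow> orth (Sus C x) ((Desus C ^^ k) y)"
    using orth_Desus_iff[OF Suc.prems funpow_Desus_Obj[OF assms(2)]] by simp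
  also have "\<dots> \<longleftrightarrow> orth ((Sus C ^^ k) (Sus C x)) y" using Suc.IH Sus_in_Obj Suc.prems by blast
  also have "(Sus C ^^ k) (Sus C x) = (Sus C ^^ Suc k) x" by (simp add: funpow_swap1)
  finally show ?case .
qed simp

lemma cond_E_iff:
  assumes "X \<subseteq> Obj C"
  shows "cond_E C n X \<longleftrightarrow>
    (\<forall>k. 0 < k \<and> enat k < n + 1 \<longrightarrow> (\<forall>x \<in> X. \<forall>y \<in> X. orth ((Sus C ^^ k) x) y))"
proof -
  have *: "Hom C x (Sus_pow C (- int k) y) = {Zer C x (Sus_pow C (- int k) y)} \<longleftrightarrow>
    orth ((Sus C ^^ k) x) y" if "x \<in> X" "y \<in> X" "0 < k" for x y k
  proof -
    have o: "x \<in> Obj C" "y \<in> Obj C" using that assms by blast+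
    have "Sus_pow C (- int k) y = (Desus C ^^ k) y" using that(3) by (simp add: Sus_pow_def)
    then show ?thesis
      using orth_funpow_Desus_iff[OF o] orth_iff[OF o(1) funpow_Desus_Obj[OF o(2)]] by simp
  qed
  show ?thesis
  proof
    assume E: "cond_E C n X"
    show "\<forall>k. 0 < k \<and> enat k < n + 1 \<longrightarrow> (\<forall>x \<in> X. \<forall>y \<in> X. orth ((Sus C ^^ k) x) y)"
    proof (intro allI impI ballI)
      fix k x y assume k: "0 < k \<and> enat k < n + 1" and xy: "x \<in> X" "y \<in> X"
      then have "Hom C x (Sus_pow C (- int k) y) = {Zer C x (Sus_pow C (- int k) y)}"
        using E[unfolded cond_E_def, rule_format, of "- int k" x y] by simp
      then show "orth ((Sus C ^^ k) x) y" using * xy k by blast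
    qed
  next
    assume R: "\<forall>k. 0 < k \<and> enat k < n + 1 \<longrightarrow> (\<forall>x \<in> X. \<forall>y \<in> X. orth ((Sus C ^^ k) x) y)"
    show "cond_E C n X"
      unfolding cond_E_def
    proof (intro allI impI ballI)
      fix i :: int and x y assume i: "i < 0 \<and> enat (nat (- i)) < n + 1" and xy: "x \<in> X" "y \<in> X"
      then have k: "0 < nat (- i)" "- int (nat (- i)) = i" by auto
      show "Hom C x (Sus_pow C i y) = {Zer C x (Sus_pow C i y)}"
        using *[OF xy k(1)] R i k xy by simp
    qed
  qed
qed

text \<open>The strict bound -n-1 < i includes i = -n, so n = 3 already covers the three
  degrees.\<close>

lemma cond_E_neg_orth:
  assumes "X \<subseteq> Obj C" "cond_E C n X" "3 \<le> n"
  shows "neg_orth X"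
proof -
  have "enat 3 < n + 1" "enat 2 < n + 1" "enat 1 < n + 1"
    using assms(3) by (cases n; simp add: one_enat_def numeral_eq_enat)+
  moreover have "orth ((Sus C ^^ k) x) y" if "0 < k" "enat k < n + 1" "x \<in> X" "y \<in> X" for k x y
    using assms(2) that unfolding cond_E_iff[OF assms(1)] by simp
  from this[of 1] this[of 2] this[of 3]
  have "orth (Sus C x) y" "orth (Sus C (Sus C x)) y" "orth (Sus C (Sus C (Sus C x))) y"
    if "x \<in> X" "y \<in> X" for x y
    using that calculation by (simp_all add: numeral_2_eq_2 numeral_3_eq_3)
  then show ?thesis unfolding neg_orth_def by simp
qed

lemma cond_E_Sus:
  assumes X: "additive_subcategory C X" and E: "cond_E C n X"
  shows "cond_E C n (Sus_subcat C 1 X)"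
proof -
  have XO: "X \<subseteq> Obj C" using X unfolding additive_subcategory_def by blast
  have SO: "Sus_subcat C 1 X \<subseteq> Obj C" by (auto simp: Sus_subcat_1)
  have pow: "isomorphic C ((Sus C ^^ k) a) ((Sus C ^^ k) b)" if "isomorphic C a b" for a b k
    using that by (induction k) (simp_all add: isomorphic_Sus)
  show ?thesis
    unfolding cond_E_iff[OF SO]
  proof (intro allI impI ballI)
    fix k x y
    assume k: "0 < k \<and> enat k < n + 1" and "x \<in> Sus_subcat C 1 X" "y \<in> Sus_subcat C 1 X"
    then obtain a b where a: "a \<in> X" "isomorphic C (Sus C a) x" and b: "b \<in> X" "isomorphic C (Sus C b) y"
      unfolding Sus_subcat_1 by blast
    have o: "a \<in> Obj C" "b \<in> Obj C" using a b XO by blast+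
    have "orth ((Sus C ^^ k) a) b" using E k a b unfolding cond_E_iff[OF XO] by blast
    then have "orth ((Sus C ^^ k) (Sus C a)) (Sus C b)"
      using orth_Sus_iff[OF funpow_Sus_Obj[OF o(1)] o(2)] by (simp add: funpow_swap1)
    then show "orth ((Sus C ^^ k) x) y"
      using orth_iso_left[OF pow[OF a(2)]] orth_iso_right[OF b(2)] by blast
  qed
qed

text \<open>The choice of isomorphisms \<open>unsus c\<close> from \<open>\<Sigma> (Desus c)\<close> to \<open>c\<close>, with inverses \<open>unsus' c\<close>, makes
  \<open>Desus\<close> a functor.\<close>

definition unsus_pair :: "'o \<Rightarrow> 'm \<times> 'm"
  where "unsus_pair c = (SOME p. inverse_arrs C (Sus C (Desus C c)) c (fst p) (snd p))"

definition unsus :: "'o \<Rightarrow> 'm" where "unsus c = fst (unsus_pair c)"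

definition unsus' :: "'o \<Rightarrow> 'm" where "unsus' c = snd (unsus_pair c)"

text \<open>Conjugation of f by the chosen isomorphisms, desuspended; full faithfulness of \<Sigma>
  makes the described arrow exist and be unique.\<close>

definition DesusA :: "'m \<Rightarrow> 'm"
  where "DesusA f = (SOME g. g \<in> Hom C (Desus C (Src C f)) (Desus C (Tgt C f)) \<and>
    SusA C g = unsus' (Tgt C f) \<cdot> (f \<cdot> unsus (Src C f)))"

lemma unsus: "c \<in> Obj C \<Longrightarrow> inverse_arrs C (Sus C (Desus C c)) c (unsus c) (unsus' c)"
proof -
  assume "c \<in> Obj C"
  then have "\<exists>p. inverse_arrs C (Sus C (Desus C c)) c (fst p) (snd p)"
    using Sus_Desus unfolding isomorphic_iff by fastforce
  then show ?thesis unfolding unsus_def unsus'_def unsus_pair_def by (rule someI_ex)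
qed

lemma unsus_Hom:
  assumes "c \<in> Obj C"
  shows "unsus c \<in> Hom C (Sus C (Desus C c)) c" "unsus' c \<in> Hom C c (Sus C (Desus C c))"
  using unsus[OF assms] unfolding inverse_arrs_def by blast+

lemma DesusA:
  assumes f: "f \<in> Hom C a b"
  shows "DesusA f \<in> Hom C (Desus C a) (Desus C b)" "SusA C (DesusA f) = unsus' b \<cdot> (f \<cdot> unsus a)"
proof -
  have o: "a \<in> Obj C" "b \<in> Obj C" using Hom_Obj[OF f] by blast+
  have "unsus' b \<cdot> (f \<cdot> unsus a) \<in> Hom C (Sus C (Desus C a)) (Sus C (Desus C b))"
    using Cmp_in_Hom[OF Cmp_in_Hom[OF unsus_Hom(1)[OF o(1)] f] unsus_Hom(2)[OF o(2)]] .
  then have "\<exists>g. g \<in> Hom C (Desus C a) (Desus C b) \<and> SusA C g = unsus' b \<cdot> (f \<cdot> unsus a)"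
    using SusA_full[OF Desus_Obj Desus_Obj] o by metis
  then have "\<exists>g. g \<in> Hom C (Desus C (Src C f)) (Desus C (Tgt C f)) \<and>
    SusA C g = unsus' (Tgt C f) \<cdot> (f \<cdot> unsus (Src C f))" using HomD[OF f] by simp
  from someI_ex[OF this, folded DesusA_def]
  show "DesusA f \<in> Hom C (Desus C a) (Desus C b)" "SusA C (DesusA f) = unsus' b \<cdot> (f \<cdot> unsus a)"
    using HomD[OF f] by simp_all
qed

lemma unsus_natural:
  assumes f: "f \<in> Hom C a b"
  shows "unsus b \<cdot> SusA C (DesusA f) = f \<cdot> unsus a"
  using DesusA(2)[OF f] Cmp_left_inverse[OF inverse_arrs_sym[OF unsus]] Hom_Obj[OF f]
    Cmp_in_Hom[OF unsus_Hom(1) f] by simp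

lemma unsus'_natural:
  assumes f: "f \<in> Hom C a b"
  shows "SusA C (DesusA f) \<cdot> unsus' a = unsus' b \<cdot> f"
proof -
  have o: "a \<in> Obj C" "b \<in> Obj C" using Hom_Obj[OF f] by blast+
  have "SusA C (DesusA f) = (unsus' b \<cdot> f) \<cdot> unsus a"
    using DesusA(2)[OF f] Cmp_assoc[OF unsus_Hom(1)[OF o(1)] f unsus_Hom(2)[OF o(2)]] by simp
  then show ?thesis
    using Cmp_right_inverse[OF inverse_arrs_sym[OF unsus[OF o(1)]]
      Cmp_in_Hom[OF f unsus_Hom(2)[OF o(2)]]] by simp
qed

text \<open>Naturality of \<open>unsus\<close> characterises \<open>DesusA\<close>, so compatibility
  with composition, zero arrows, identities and sums reduces to checking one square each.\<close>

lemma DesusA_eqI: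
  assumes f: "f \<in> Hom C a b" and g: "g \<in> Hom C (Desus C a) (Desus C b)"
    and e: "unsus b \<cdot> SusA C g = f \<cdot> unsus a"
  shows "DesusA f = g"
proof -
  have b: "b \<in> Obj C" using Hom_Obj[OF f] by blast
  have "SusA C (DesusA f) = SusA C g"
    using cancel_iso_left[OF unsus[OF b] SusA_in_Hom[OF DesusA(1)[OF f]] SusA_in_Hom[OF g]]
      unsus_natural[OF f] e by simp
  then show ?thesis using SusA_inj[OF DesusA(1)[OF f] g] by blast
qed

lemma DesusA_Cmp:
  assumes f: "f \<in> Hom C a b" and g: "g \<in> Hom C b c"
  shows "DesusA (g \<cdot> f) = DesusA g \<cdot> DesusA f"
proof (rule DesusA_eqI[OF Cmp_in_Hom[OF f g] Cmp_in_Hom[OF DesusA(1)[OF f] DesusA(1)[OF g]]])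
  have o: "a \<in> Obj C" "b \<in> Obj C" "c \<in> Obj C" using Hom_Obj f g by blast+
  note Df = DesusA(1)[OF f] and Dg = DesusA(1)[OF g]
  have "unsus c \<cdot> SusA C (DesusA g \<cdot> DesusA f) = (unsus c \<cdot> SusA C (DesusA g)) \<cdot> SusA C (DesusA f)"
    using SusA_Cmp[OF Df Dg] Cmp_assoc[OF SusA_in_Hom[OF Df] SusA_in_Hom[OF Dg] unsus_Hom(1)[OF o(3)]]
    by simp
  also have "\<dots> = g \<cdot> (unsus b \<cdot> SusA C (DesusA f))"
    using unsus_natural[OF g] Cmp_assoc[OF SusA_in_Hom[OF Df] unsus_Hom(1)[OF o(2)] g] by simp
  also have "\<dots> = (g \<cdot> f) \<cdot> unsus a"
    using unsus_natural[OF f] Cmp_assoc[OF unsus_Hom(1)[OF o(1)] f g] by simp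
  finally show "unsus c \<cdot> SusA C (DesusA g \<cdot> DesusA f) = (g \<cdot> f) \<cdot> unsus a" .
qed

lemma DesusA_Zer:
  assumes "a \<in> Obj C" "b \<in> Obj C"
  shows "DesusA (Zer C a b) = Zer C (Desus C a) (Desus C b)"
proof (rule DesusA_eqI)
  have D: "Desus C a \<in> Obj C" "Desus C b \<in> Obj C" using Desus_Obj assms by blast+
  show "unsus b \<cdot> SusA C (Zer C (Desus C a) (Desus C b)) = Zer C a b \<cdot> unsus a"
    using SusA_Zer[OF D] Cmp_Zer_right[OF unsus_Hom(1)[OF assms(2)]] Sus_in_Obj[OF D(1)]
      Cmp_Zer_left[OF unsus_Hom(1)[OF assms(1)] assms(2)] by simp
qed (use assms Desus_Obj Zer_in_Hom in blast)+

lemma DesusA_Idn: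
  assumes "a \<in> Obj C"
  shows "DesusA (Idn C a) = Idn C (Desus C a)"
proof (rule DesusA_eqI)
  show "unsus a \<cdot> SusA C (Idn C (Desus C a)) = Idn C a \<cdot> unsus a"
    using SusA_Idn[OF Desus_Obj[OF assms]] Cmp_Idn_left Cmp_Idn_right unsus_Hom(1)[OF assms] by simp
qed (use assms Desus_Obj Idn_in_Hom in blast)+

lemma DesusA_Add:
  assumes f: "f \<in> Hom C a b" and g: "g \<in> Hom C a b"
  shows "DesusA (f \<boxplus> g) = DesusA f \<boxplus> DesusA g"
proof (rule DesusA_eqI[OF Add_in_Hom[OF f g] Add_in_Hom[OF DesusA(1)[OF f] DesusA(1)[OF g]]])
  have o: "a \<in> Obj C" "b \<in> Obj C" using Hom_Obj f by blast+
  note Df = DesusA(1)[OF f] and Dg = DesusA(1)[OF g]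
  show "unsus b \<cdot> SusA C (DesusA f \<boxplus> DesusA g) = (f \<boxplus> g) \<cdot> unsus a"
    using SusA_Add[OF Df Dg] Cmp_Add_left[OF unsus_Hom(1)[OF o(1)] f g] unsus_natural[OF f]
      unsus_natural[OF g]
      Cmp_Add_right[OF SusA_in_Hom[OF Df] SusA_in_Hom[OF Dg] unsus_Hom(1)[OF o(2)]] by simp
qed

lemma DesusA_inj:
  assumes f: "f \<in> Hom C a b" and g: "g \<in> Hom C a b" and e: "DesusA f = DesusA g"
  shows "f = g"
  using cancel_iso_right[OF unsus f g] unsus_natural[OF f] unsus_natural[OF g] e Hom_Obj[OF f] by simp

lemma DesusA_full:
  assumes a: "a \<in> Obj C" and b: "b \<in> Obj C" and h: "h \<in> Hom C (Desus C a) (Desus C b)"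
  shows "\<exists>f \<in> Hom C a b. DesusA f = h"
proof -
  define f where "f = (unsus b \<cdot> SusA C h) \<cdot> unsus' a"
  have uh: "unsus b \<cdot> SusA C h \<in> Hom C (Sus C (Desus C a)) b"
    using Cmp_in_Hom[OF SusA_in_Hom[OF h] unsus_Hom(1)[OF b]] .
  have f: "f \<in> Hom C a b" unfolding f_def using Cmp_in_Hom[OF unsus_Hom(2)[OF a] uh] .
  have "DesusA f = h"
    by (rule DesusA_eqI[OF f h]) (simp add: f_def Cmp_right_inverse[OF unsus[OF a] uh])
  then show ?thesis using f by blast
qed

lemma direct_sum_Desus:
  assumes "direct_sum C a b c"
  shows "direct_sum C (Desus C a) (Desus C b) (Desus C c)"
proof -
  obtain i j p q where s: "is_biproduct C a b c i j p q" using assms unfolding direct_sum_def by blast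
  then have h: "a \<in> Obj C" "b \<in> Obj C" "c \<in> Obj C" "i \<in> Hom C a c" "j \<in> Hom C b c"
    "p \<in> Hom C c a" "q \<in> Hom C c b"
    and e: "p \<cdot> i = Idn C a" "q \<cdot> j = Idn C b" "p \<cdot> j = Zer C b a" "q \<cdot> i = Zer C a b"
      "(i \<cdot> p) \<boxplus> (j \<cdot> q) = Idn C c"
    unfolding is_biproduct_def by blast+
  have "(DesusA i \<cdot> DesusA p) \<boxplus> (DesusA j \<cdot> DesusA q) = Idn C (Desus C c)"
    using e(5) DesusA_Add[OF Cmp_in_Hom[OF h(6,4)] Cmp_in_Hom[OF h(7,5)]]
      DesusA_Cmp[OF h(6,4)] DesusA_Cmp[OF h(7,5)] DesusA_Idn[OF h(3)] by simp
  then have "is_biproduct C (Desus C a) (Desus C b) (Desus C c) (DesusA i) (DesusA j) (DesusA p) (DesusA q)"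
    unfolding is_biproduct_def
    using h Desus_Obj DesusA(1) DesusA_Cmp[OF h(4,6)] DesusA_Cmp[OF h(5,7)] DesusA_Cmp[OF h(5,6)]
      DesusA_Cmp[OF h(4,7)] e DesusA_Idn DesusA_Zer by simp
  then show ?thesis unfolding direct_sum_def by blast
qed

lemma additive_subcategory_Sus:
  assumes X: "additive_subcategory C X"
  shows "additive_subcategory C (Sus_subcat C 1 X)"
proof -
  note iff = Sus_subcat_1_iff[OF X]
  have zero: "z \<in> Sus_subcat C 1 X" if z: "is_zero_obj C z" for z
  proof -
    have zo: "z \<in> Obj C" "Idn C z = Zer C z z" using z zero_obj_iff by auto
    have "Idn C (Desus C z) = Zer C (Desus C z) (Desus C z)"
      using DesusA_Idn[OF zo(1)] DesusA_Zer[OF zo(1) zo(1)] zo(2) by simp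
    then have "is_zero_obj C (Desus C z)" using zero_obj_iff Desus_Obj zo by blast
    then show ?thesis using X zo(1) unfolding iff additive_subcategory_def by blast
  qed
  have sum: "c \<in> Sus_subcat C 1 X \<longleftrightarrow> a \<in> Sus_subcat C 1 X \<and> b \<in> Sus_subcat C 1 X"
    if s: "direct_sum C a b c" for a b c
  proof -
    have "a \<in> Obj C" "b \<in> Obj C" "c \<in> Obj C" using s unfolding direct_sum_def is_biproduct_def by blast+
    then show ?thesis using X direct_sum_Desus[OF s] unfolding iff additive_subcategory_def by blast
  qed
  have iso: "b \<in> Sus_subcat C 1 X" if "a \<in> Sus_subcat C 1 X" "isomorphic C a b" for a b
    using closed_isomorphic[OF X] isomorphic_Desus that isomorphic_Obj(2)[OF that(2)] unfolding iff by blast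
  have "Sus_subcat C 1 X \<subseteq> Obj C" by (auto simp: Sus_subcat_1)
  then show ?thesis unfolding additive_subcategory_def using zero sum iso by blast
qed

text \<open>Three backward rotations; each accounts for one of the three signs.\<close>

lemma tri_arrs_unrotate_Sus:
  assumes f: "f \<in> Hom C a b" and g: "g \<in> Hom C b c" and h: "h \<in> Hom C c (Sus C a)"
    and t: "(Neg C (SusA C f), Neg C (SusA C g), Neg C (SusA C h)) \<in> Tri C"
  shows "tri_arrs a b c f g h"
proof -
  have S: "Neg C (SusA C f) \<in> Hom C (Sus C a) (Sus C b)" "Neg C (SusA C g) \<in> Hom C (Sus C b) (Sus C c)"
    using f g SusA_in_Hom Neg_in_Hom by blast+
  have 1: "tri_arrs c (Sus C a) (Sus C b) h (Neg C (SusA C f)) (Neg C (SusA C g))"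
    using tri_arrs_unrotate[OF h S t] .
  have 2: "tri_arrs b c (Sus C a) g h (Neg C (SusA C f))"
    using tri_arrs_unrotate[OF g h S(1)] tri_arrsD(4)[OF 1] by blast
  show ?thesis using tri_arrs_unrotate[OF f g h] tri_arrsD(4)[OF 2] by blast
qed

lemma inverse_arrs_Neg:
  assumes "inverse_arrs C a b u u'"
  shows "inverse_arrs C a b (Neg C u) (Neg C u')"
  using assms Neg_in_Hom Cmp_Neg_Neg unfolding inverse_arrs_def by metis

text \<open>Suspending a triangle by three rotations negates its arrows. The signs on the first two
  are absorbed by using the negative of \<open>unsus\<close> at the middle vertex only; the third
  arrow may be chosen freely, since a short triangle records just two.\<close>

lemma short_triangle_DesusA:
  assumes f: "f \<in> Hom C a b" and g: "g \<in> Hom C b c"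
  shows "short_triangle C (DesusA f) (DesusA g) \<longleftrightarrow> short_triangle C f g"
proof
  have o: "a \<in> Obj C" "b \<in> Obj C" "c \<in> Obj C" using Hom_Obj f g by blast+
  note Df = DesusA(1)[OF f] and Dg = DesusA(1)[OF g]
  note SDf = SusA_in_Hom[OF Df] and SDg = SusA_in_Hom[OF Dg]
  note ua = unsus[OF o(1)] and ub = unsus[OF o(2)] and uc = unsus[OF o(3)]
  note ha = unsus_Hom[OF o(1)] and hb = unsus_Hom[OF o(2)] and hc = unsus_Hom[OF o(3)]
  {
    assume "short_triangle C (DesusA f) (DesusA g)"
    then obtain h where t: "tri_arrs (Desus C a) (Desus C b) (Desus C c) (DesusA f) (DesusA g) h"
      unfolding short_triangle_def using tri_arrsI[OF _ Df Dg] by blast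
    note St = tri_arrs_rotate[OF tri_arrs_rotate[OF tri_arrs_rotate[OF t]]]
    note d = tri_arrsD[OF St]
    have k: "SusA C (unsus a) \<cdot> Neg C (SusA C h) \<in> Hom C (Sus C (Desus C c)) (Sus C a)"
      using Cmp_in_Hom[OF d(3) SusA_in_Hom[OF ha(1)]] .
    have "tri_arrs a b c f g ((SusA C (unsus a) \<cdot> Neg C (SusA C h)) \<cdot> unsus' c)"
    proof (rule tri_arrs_iso[OF St ua inverse_arrs_Neg[OF ub] uc f _ g _ Cmp_in_Hom[OF hc(2) k]])
      show "Neg C (unsus b) \<cdot> Neg C (SusA C (DesusA f)) = f \<cdot> unsus a"
        using Cmp_Neg_Neg[OF SDf hb(1)] unsus_natural[OF f] by simp
      show "unsus c \<cdot> Neg C (SusA C (DesusA g)) = g \<cdot> Neg C (unsus b)"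
        using Cmp_Neg_right[OF SDg hc(1)] Cmp_Neg_right[OF hb(1) g] unsus_natural[OF g] by simp
    qed (simp add: Cmp_right_inverse[OF uc k])
    then show "short_triangle C f g" unfolding short_triangle_def tri_arrs_def by blast
  }
  {
    assume "short_triangle C f g"
    then obtain h where t: "tri_arrs a b c f g h"
      unfolding short_triangle_def using tri_arrsI[OF _ f g] by blast
    note d = tri_arrsD[OF t]
    have k: "SusA C (unsus' a) \<cdot> h \<in> Hom C c (Sus C (Sus C (Desus C a)))"
      using Cmp_in_Hom[OF d(3) SusA_in_Hom[OF ha(2)]] .
    have t2: "tri_arrs (Sus C (Desus C a)) (Sus C (Desus C b)) (Sus C (Desus C c))
      (Neg C (SusA C (DesusA f))) (Neg C (SusA C (DesusA g))) ((SusA C (unsus' a) \<cdot> h) \<cdot> unsus c)"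
    proof (rule tri_arrs_iso[OF t inverse_arrs_sym[OF ua] inverse_arrs_Neg[OF inverse_arrs_sym[OF ub]]
          inverse_arrs_sym[OF uc] Neg_in_Hom[OF SDf] _ Neg_in_Hom[OF SDg] _ Cmp_in_Hom[OF hc(1) k]])
      show "Neg C (unsus' b) \<cdot> f = Neg C (SusA C (DesusA f)) \<cdot> unsus' a"
        using Cmp_Neg_left[OF f hb(2)] Cmp_Neg_left[OF ha(2) SDf] unsus'_natural[OF f] by simp
      show "unsus' c \<cdot> g = Neg C (SusA C (DesusA g)) \<cdot> Neg C (unsus' b)"
        using Cmp_Neg_Neg[OF hb(2) SDg] unsus'_natural[OF g] by simp
    qed (simp add: Cmp_right_inverse[OF inverse_arrs_sym[OF uc] k])
    obtain h0 where h0: "h0 \<in> Hom C (Desus C c) (Sus C (Desus C a))"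
      "SusA C h0 = (SusA C (unsus' a) \<cdot> h) \<cdot> unsus c"
      using SusA_full[OF Desus_Obj[OF o(3)] Sus_in_Obj[OF Desus_Obj[OF o(1)]] tri_arrsD(3)[OF t2]] .
    \<comment> \<open>The third arrow has no sign in \<open>t2\<close>, so its desuspension must be
      negated to fit the pattern of three negated arrows.\<close>
    have "Neg C (SusA C (Neg C h0)) = (SusA C (unsus' a) \<cdot> h) \<cdot> unsus c"
      using SusA_Neg[OF h0(1)] Neg_Neg[OF SusA_in_Hom[OF h0(1)]] h0(2) by simp
    then have "tri_arrs (Desus C a) (Desus C b) (Desus C c) (DesusA f) (DesusA g) (Neg C h0)"
      using tri_arrs_unrotate_Sus[OF Df Dg Neg_in_Hom[OF h0(1)]] tri_arrsD(4)[OF t2] by simp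
    then show "short_triangle C (DesusA f) (DesusA g)"
      unfolding short_triangle_def tri_arrs_def by blast
  }
qed

text \<open>Abelianness is pulled back along desuspension. The same equivalence matches short exact
  sequences, and desuspension matches short triangles, so their agreement in \<open>A\<close> gives
  their agreement in \<Sigma> \<open>A\<close>.\<close>

lemma proper_abelian_Sus:
  assumes A: "proper_abelian C A"
  shows "proper_abelian C (Sus_subcat C 1 A)"
proof -
  have add: "additive_subcategory C A" and ab: "abelian_category (full_subcategory C A)"
    using A unfolding proper_abelian_def by blast+
  let ?S = "Sus_subcat C 1 A"
  have addS: "additive_subcategory C ?S" using additive_subcategory_Sus[OF add] .
  note iff = Sus_subcat_1_iff[OF add]
  have AO: "A \<subseteq> Obj C" using add unfolding additive_subcategory_def by blast
  interpret D: additive_equivalence "full_subcategory C A" "full_subcategory C ?S" "Desus C" DesusA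
  proof (intro additive_equivalence.intro additive_full_subcategory add addS
      additive_equivalence_axioms.intro)
    fix d assume "d \<in> Obj (full_subcategory C A)"
    then have d: "d \<in> A" "d \<in> Obj C" using AO by auto
    then have S: "Sus C d \<in> ?S"
      unfolding Sus_subcat_1 using isomorphic_refl Sus_in_Obj by blast
    obtain u u' where "inverse_arrs C (Desus C (Sus C d)) d u u'"
      using Desus_Sus[OF d(2)] unfolding isomorphic_iff by blast
    then have "inverse_arrs (full_subcategory C A) (Desus C (Sus C d)) d u u'"
      using d S unfolding inverse_arrs_def iff by (simp add: Hom_full_subcategory)
    then show "\<exists>a \<in> Obj (full_subcategory C ?S). isomorphic (full_subcategory C A) (Desus C a) d"
      using S unfolding isomorphic_iff by auto
  next
    fix a b h
    assume "a \<in> Obj (full_subcategory C ?S)" "b \<in> Obj (full_subcategory C ?S)"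
      "h \<in> Hom (full_subcategory C A) (Desus C a) (Desus C b)"
    then show "\<exists>f \<in> Hom (full_subcategory C ?S) a b. DesusA f = h"
      using DesusA_full unfolding Bex_def Hom_full_subcategory by (auto simp: iff)
  next
    fix f g a b
    assume "f \<in> Hom (full_subcategory C ?S) a b" "g \<in> Hom (full_subcategory C ?S) a b"
      "DesusA f = DesusA g"
    then show "f = g" using DesusA_inj unfolding Hom_full_subcategory by blast
  qed (auto simp: Hom_full_subcategory iff DesusA(1) DesusA_Cmp DesusA_Zer)
  have "short_exact (full_subcategory C ?S) f g \<longleftrightarrow>
    (\<exists>a' \<in> ?S. \<exists>a \<in> ?S. \<exists>a'' \<in> ?S. f \<in> Hom C a' a \<and> g \<in> Hom C a a'' \<and> short_triangle C f g)" for f g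
  proof -
    have key: "short_exact (full_subcategory C ?S) f g \<longleftrightarrow> short_triangle C f g"
      if f: "f \<in> Hom (full_subcategory C ?S) a' a" and g: "g \<in> Hom (full_subcategory C ?S) a a''"
      for a' a a''
    proof -
      have h: "f \<in> Hom C a' a" "g \<in> Hom C a a''" "Desus C a' \<in> A" "Desus C a \<in> A" "Desus C a'' \<in> A"
        using f g unfolding Hom_full_subcategory iff by blast+
      have "short_exact (full_subcategory C ?S) f g \<longleftrightarrow>
        short_exact (full_subcategory C A) (DesusA f) (DesusA g)"
        using D.short_exact_iff[OF f g] by simp
      also have "\<dots> \<longleftrightarrow> short_triangle C (DesusA f) (DesusA g)"
        unfolding proper_abelian_short_exact[OF A] using h DesusA(1) by blast
      also have "\<dots> \<longleftrightarrow> short_triangle C f g" using short_triangle_DesusA[OF h(1,2)] .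
      finally show ?thesis .
    qed
    show ?thesis
    proof
      assume L: "short_exact (full_subcategory C ?S) f g"
      then have "f \<in> Hom (full_subcategory C ?S) (Src C f) (Tgt C f)"
        "g \<in> Hom (full_subcategory C ?S) (Tgt C f) (Tgt C g)"
        unfolding short_exact_def is_kernel_def Hom_def by auto
      then show "\<exists>a' \<in> ?S. \<exists>a \<in> ?S. \<exists>a'' \<in> ?S. f \<in> Hom C a' a \<and> g \<in> Hom C a a'' \<and> short_triangle C f g"
        using key L unfolding Hom_full_subcategory by blast
    next
      assume "\<exists>a' \<in> ?S. \<exists>a \<in> ?S. \<exists>a'' \<in> ?S. f \<in> Hom C a' a \<and> g \<in> Hom C a a'' \<and> short_triangle C f g"
      then show "short_exact (full_subcategory C ?S) f g"
        using key unfolding Hom_full_subcategory by blast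
    qed
  qed
  then show ?thesis unfolding proper_abelian_def using addS D.abelian_transfer[OF ab] by blast
qed

section \<open>The interval\<close>

lemma lower_refl:
  assumes "additive_subcategory C X" shows "lower X X"
  unfolding lower_def
proof
  fix x assume x: "x \<in> X"
  obtain z where z: "is_zero_obj C z" using ex_zero_obj by blast
  have "x \<in> Obj C" using assms x unfolding additive_subcategory_def by blast
  then have "tri x x z" using tri_Idn z unfolding tri_def by blast
  moreover have "Sus C z \<in> X" using assms zero_obj_Sus[OF z] unfolding additive_subcategory_def by blast
  ultimately show "\<exists>y \<in> X. \<exists>z. Sus C z \<in> X \<and> tri y x z" using x by blast
qed

lemma upper_refl:
  assumes "additive_subcategory C X" shows "upper X X"
  unfolding upper_def
proof
  fix x assume x: "x \<in> X"
  obtain z where z: "is_zero_obj C z" using ex_zero_obj by blast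
  have "x \<in> Obj C" using assms x unfolding additive_subcategory_def by blast
  then have "tri (Sus C z) x x" using tri_zero_Idn zero_obj_Sus[OF z] unfolding tri_def by blast
  moreover have "z \<in> X" using assms z unfolding additive_subcategory_def by blast
  ultimately show "\<exists>s \<in> X. \<exists>a \<in> X. tri (Sus C s) x a" using x by blast
qed

lemma Sus_in_Sus_subcat: "additive_subcategory C X \<Longrightarrow> x \<in> X \<Longrightarrow> Sus C x \<in> Sus_subcat C 1 X"
  unfolding Sus_subcat_1 additive_subcategory_def using isomorphic_refl Sus_in_Obj by blast

lemma upper_iff_lower_Sus:
  assumes X: "additive_subcategory C X"
  shows "upper X Y \<longleftrightarrow> lower Y (Sus_subcat C 1 X)"
proof
  assume "upper X Y"
  then show "lower Y (Sus_subcat C 1 X)"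
    unfolding upper_def lower_def using Sus_in_Sus_subcat[OF X] by blast
next
  assume L: "lower Y (Sus_subcat C 1 X)"
  show "upper X Y"
    unfolding upper_def
  proof
    fix y assume "y \<in> Y"
    then obtain v z where v: "v \<in> Sus_subcat C 1 X" "Sus C z \<in> Sus_subcat C 1 X" "tri v y z"
      using lowerE[OF L] by metis
    obtain s x where s: "s \<in> X" "isomorphic C (Sus C s) v" "x \<in> X" "isomorphic C (Sus C x) (Sus C z)"
      using v(1,2) unfolding Sus_subcat_1 by blast
    have "isomorphic C x z"
      using isomorphic_Sus_iff s(3,4) X tri_Obj(3)[OF v(3)] unfolding additive_subcategory_def by blast
    then have "z \<in> X" using closed_isomorphic[OF X s(3)] by blast
    moreover have "tri (Sus C s) y z"
      using tri_iso[OF v(3) isomorphic_sym[OF s(2)]] isomorphic_refl tri_Obj v(3) by blast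
    ultimately show "\<exists>s \<in> X. \<exists>x \<in> X. tri (Sus C s) y x" using s(1) by blast
  qed
qed

text \<open>Suspend the triangle that presents x: its last vertex \<Sigma> z is already a member of
  \<open>Y\<close>, its first is the suspension of one.\<close>

lemma lower_Sus_upper:
  assumes Y: "additive_subcategory C Y" and L: "lower X Y"
  shows "upper Y (Sus_subcat C 1 X)"
  unfolding upper_def
proof
  fix v assume "v \<in> Sus_subcat C 1 X"
  then obtain x where x: "x \<in> X" "isomorphic C (Sus C x) v" unfolding Sus_subcat_1 by blast
  obtain y z where y: "y \<in> Y" "Sus C z \<in> Y" "tri y x z" using lowerE[OF L x(1)] by metis
  have "tri (Sus C y) v (Sus C z)"
    using tri_iso[OF tri_Sus[OF y(3)] _ x(2)] isomorphic_refl tri_Obj[OF tri_Sus[OF y(3)]] by blast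
  then show "\<exists>s \<in> Y. \<exists>a \<in> Y. tri (Sus C s) v a" using y by blast
qed

lemma lower_Sus_Sus:
  assumes Y: "additive_subcategory C Y" and L: "lower X Y"
  shows "lower (Sus_subcat C 1 X) (Sus_subcat C 1 Y)"
  using lower_Sus_upper[OF assms] upper_iff_lower_Sus[OF Y] by blast

lemma lower_trans:
  assumes X: "proper_abelian C X" "neg_orth X" and SX: "neg_orth (Sus_subcat C 1 X)"
    and Z: "additive_subcategory C Z" "neg_orth Z"
    and "lower W Z" "lower Y Z" "lower W X" "upper W X" "lower X Y" "upper X Y"
  shows "lower X Z"
proof (rule lower_trans_general[OF X _ _ SX _ _ Z assms(6-11)])
  have add: "additive_subcategory C X" using X unfolding proper_abelian_def by blast
  show "additive_subcategory C (Sus_subcat C 1 X)" using additive_subcategory_Sus[OF add] .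
  show "has_cones (Sus_subcat C 1 X)" using proper_abelian_has_cones[OF proper_abelian_Sus[OF X(1)]] .
  show "Sus C x \<in> Sus_subcat C 1 X" if "x \<in> X" for x using Sus_in_Sus_subcat[OF add that] .
  show "\<exists>x \<in> X. isomorphic C (Sus C x) v" if "v \<in> Sus_subcat C 1 X" for v
    using that unfolding Sus_subcat_1 by blast
qed

end

theorem theorem1:
  fixes C :: "('o, 'm) triangulated"
    and A :: "'o set"
    and n :: enat
  assumes "triangulated_category C"
    and "krull_schmidt_category C"
    and "proper_abelian C A"
    and "3 \<le> n"
  shows "partial_order (E_interval_order C n A) \<and>
    (cond_E C n A \<longrightarrow>
      least (E_interval_order C n A) A (E_interval C n A) \<and>
      greatest (E_interval_order C n A) (Sus_subcat C 1 A) (E_interval C n A))"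
proof -
  interpret triangulated_category C using assms(1) .
  let ?S = "Sus_subcat C 1"
  let ?I = "E_interval C n A"
  have A: "additive_subcategory C A" using assms(3) unfolding proper_abelian_def by blast
  have add: "additive_subcategory C X" if "proper_abelian C X" for X
    using that unfolding proper_abelian_def by blast
  have sub: "X \<subseteq> Obj C" if "additive_subcategory C X" for X
    using that unfolding additive_subcategory_def by blast
  \<comment> \<open>The two inclusions in the definition of the interval are literally
    \<open>interval_le C A B\<close>.\<close>
  have mem: "B \<in> ?I \<longleftrightarrow> proper_abelian C B \<and> cond_E C n B \<and> lower A B \<and> upper A B" for B
    using interval_le_iff[OF A add[of B]] unfolding E_interval_def interval_le_def by blast
  have I: "proper_abelian C B" "additive_subcategory C B" "neg_orth B" "neg_orth (?S B)"
    "lower A B" "upper A B" if "B \<in> ?I" for B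
  proof -
    show B: "proper_abelian C B" "lower A B" "upper A B" "additive_subcategory C B"
      using that mem add by blast+
    have E: "cond_E C n B" using that mem by blast
    show "neg_orth B" using cond_E_neg_orth[OF sub[OF B(4)] E assms(4)] .
    show "neg_orth (?S B)"
      using cond_E_neg_orth[OF sub[OF additive_subcategory_Sus[OF B(4)]] cond_E_Sus[OF B(4) E] assms(4)] .
  qed
  have le: "interval_le C X Y \<longleftrightarrow> lower X Y \<and> upper X Y" if "X \<in> ?I" "Y \<in> ?I" for X Y
    using interval_le_iff[OF I(2)[OF that(1)] I(2)[OF that(2)]] .
  have refl: "interval_le C X X" if "X \<in> ?I" for X
    using le[OF that that] lower_refl[OF I(2)[OF that]] upper_refl[OF I(2)[OF that]] by simp
  have antisym: "X = Y" if "X \<in> ?I" "Y \<in> ?I" "interval_le C X Y" "interval_le C Y X" for X Y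
  proof
    have "lower X Y" "upper X Y" "lower Y X" "upper Y X"
      using le[OF that(1,2)] le[OF that(2,1)] that(3,4) by simp_all
    then show "X \<subseteq> Y" "Y \<subseteq> X"
      using lower_upper_antisym[OF I(2)[OF that(1)] I(2,3)[OF that(2)]]
        lower_upper_antisym[OF I(2)[OF that(2)] I(2,3)[OF that(1)]] by simp_all
  qed
  have trans: "interval_le C X Z"
    if X: "X \<in> ?I" and Y: "Y \<in> ?I" and Z: "Z \<in> ?I" and "interval_le C X Y" "interval_le C Y Z" for X Y Z
  proof -
    have XY: "lower X Y" "upper X Y" and YZ: "lower Y Z" "upper Y Z" using that le by simp_all
    have "lower X Z"
      by (rule lower_trans[OF I(1)[OF X] I(3)[OF X] I(4)[OF X] I(2)[OF Z] I(3)[OF Z]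
            I(5)[OF Z] YZ(1) I(5)[OF X] I(6)[OF X] XY])
    \<comment> \<open>The missing half, read as a lower relation. Now \<open>Z\<close> is the middle
      object, placed between \<open>Y\<close> and \<Sigma> \<open>A\<close> just as \<open>X\<close>
      was between \<open>A\<close> and \<open>Y\<close>, and \<Sigma> \<open>X\<close> is the
      target.\<close>
    moreover have "lower Z (?S X)"
    proof (rule lower_trans[OF I(1)[OF Z] I(3)[OF Z] I(4)[OF Z]
          additive_subcategory_Sus[OF I(2)[OF X]] I(4)[OF X] _ _ YZ])
      show "lower Y (?S X)" using XY(2) upper_iff_lower_Sus[OF I(2)[OF X]] by simp
      show "lower (?S A) (?S X)" using lower_Sus_Sus[OF I(2)[OF X] I(5)[OF X]] .
      show "lower Z (?S A)" using I(6)[OF Z] upper_iff_lower_Sus[OF A] by blast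
      show "upper Z (?S A)" using lower_Sus_upper[OF I(2)[OF Z] I(5)[OF Z]] .
    qed
    ultimately show ?thesis using le[OF X Z] upper_iff_lower_Sus[OF I(2)[OF X]] by simp
  qed
  have po: "partial_order (E_interval_order C n A)"
    by unfold_locales (simp_all add: E_interval_order_def refl, (metis antisym | metis trans)+)
  have "least (E_interval_order C n A) A ?I" "greatest (E_interval_order C n A) (?S A) ?I"
    if E: "cond_E C n A"
  proof -
    have AI: "A \<in> ?I" unfolding mem using assms(3) E lower_refl[OF A] upper_refl[OF A] by blast
    \<comment> \<open>Both relations from \<open>A\<close> to \<Sigma> \<open>A\<close> are
      reflexivity of \<open>A\<close> in disguise: the upper half of reflexivity gives the lower
      relation, the lower half gives the upper one.\<close>
    have SI: "?S A \<in> ?I"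
      unfolding mem using proper_abelian_Sus[OF assms(3)] cond_E_Sus[OF A E]
        upper_refl[OF A] lower_refl[OF A] upper_iff_lower_Sus[OF A] lower_Sus_upper[OF A] by blast
    have "interval_le C A B" if "B \<in> ?I" for B using le[OF AI that] I(5,6)[OF that] by blast
    \<comment> \<open>The two halves of the membership of B exchange roles: \<open>upper A B\<close>
      says that B is lower than \<Sigma> \<open>A\<close>, and suspending \<open>lower A B\<close>
      gives the upper relation.\<close>
    moreover have "interval_le C B (?S A)" if "B \<in> ?I" for B
      using le[OF that SI] I(5,6)[OF that] upper_iff_lower_Sus[OF A] lower_Sus_upper[OF I(2)[OF that]] by simp
    ultimately show "least (E_interval_order C n A) A ?I" "greatest (E_interval_order C n A) (?S A) ?I"
      using AI SI unfolding least_def greatest_def Lower_def Upper_def E_interval_order_def by auto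
  qed
  then show ?thesis using po by blast
qed

end
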